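(* Let $N\ge 3$, $\mathcal J=\{1,\dots,N\}$, and for $i\in\mathcal J$ let $X^i,Q^i,Y^i$ be real-valued $\mathbf F$-progressively measurable processes of class [D] on $[0,T]$ such that for every $i\in\mathcal J$: (A1) $X^i$ is right continuous with left limits and has no negative predictable jumps; (A2) $Y^i$ is right continuous, i.e. $P$-a.s. $Y^i_t=\lim_{s\searrow t}Y^i_s$ for all $t<T$; (A3) $P$-a.s., for all $t\le T$, $X^i_t\le Q^i_t\le Y^i_t$; (A4) for every $\tau\in\mathcal T_0$, $P$-a.s. $\{Q^i_\tau<Y^i_\tau,\ \tau<T\}\subseteq\bigcap_{j=1}^N\{X^j_\tau<Y^j_\tau\}$. Let $(T^*_1,\dots,T^*_N)$ be the $N$-tuple of stopping times constructed in the context. Then $(T^*_1,\dots,T^*_N)$ is a Nash equilibrium point for the $N$-player nonzero-sum Dynkin game with payoffs $(J_i)_{i\in\mathcal J}$, i.e. for all $i\in\mathcal J$ and all $\theta\in\mathcal T_0$, $$J_i(T^*_1,\dots,T^*_{i-1},\theta,T^*_{i+1},\dots,T^*_N)\le J_i(T^*_1,\dots,T^*_N).$$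
   Context: Setting. $T>0$ is a real constant, $(\Omega,\mathcal F,P)$ is a probability space with a filtration $\mathbf F=(\mathcal F_t)_{t\le T}$ that is complete and right continuous. For a stopping time $\theta\le T$, $\mathcal T_\theta$ is the set of $\mathbf F$-stopping times $\tau$ with $\theta\le\tau\le T$ $P$-a.s. A progressively measurable process $\zeta$ on $[0,T]$ is of class [D] if $\{\zeta_\tau:\tau\in\mathcal T_0\}$ is uniformly integrable. "No negative predictable jumps" means that $X^i_\tau\ge X^i_{\tau-}$ a.s. at every predictable stopping time $\tau$. Relations between random variables hold $P$-a.s. Payoffs. For $T_1,\dots,T_N\in\mathcal T_0$ and $i\in\mathcal J$, with $R_i:=\min\{T_j: j\ne i\}$, $$J_i(T_1,\dots,T_N):=\mathbf E\big[X^i_{T_i}1_{\{T_i<R_i\}}+Q^i_{T_i}1_{\{T_i=R_i\}}+Y^i_{R_i}1_{\{T_i>R_i\}}\big].$$ Construction. Put $\widetilde Y^i_t:=Q^i_T1_{\{t=T\}}+Y^i_t1_{\{t<T\}}$ for $t\le T$. Define stopping times $(\tau_n)_{n\ge1}$ by $\tau_1=\dots=\tau_N=T$ and, for $n\ge N+1$, writing $n=Nq+i$ with integers $q$ and $1\le i\le N$, inductively: - $\theta_n:=\min\{\tau_{n-1},\tau_{n-2},\dots,\tau_{n-N+1}\}$; - $U^n_t:=X^i_t1_{\{t<\theta_n\}}+\widetilde Y^i_{\theta_n}1_{\{t\ge\theta_n\}}$, $t\le T$; - $W^n$ is the Snell envelope of $U^n$, i.e. the right continuous with left limits process with $W^n_t=\operatorname{ess\,sup}_{\nu\in\mathcal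 T_t}\mathbf E[U^n_\nu|\mathcal F_t]$, $t\le T$ (the smallest class [D] supermartingale dominating $U^n$); - $\mu_n:=\inf\{s\ge0: W^n_s=U^n_s\}$; - $\tau_n:=(\mu_n\wedge\tau_{n-N})1_{\{\mu_n\wedge\tau_{n-N}<\theta_n\}}+\tau_{n-N}1_{\{\mu_n\wedge\tau_{n-N}\ge\theta_n\}}$. For fixed $i\in\mathcal J$ the sequence $(\tau_{Nn+i})_{n\ge0}$ is non-increasing, and $T^*_i:=\lim_{n\to\infty}\tau_{Nn+i}$. *)

theory Defs
  imports "HOL-Probability.Probability"
begin

text \<open>
  The filtration is indexed by all reals so that the library's \<^const>\<open>filtration\<close> and
  \<^const>\<open>stopping_time\<close> apply; a filtration on \<open>[0, T]\<close> is extended by \<open>F t = F 0\<close> for \<open>t < 0\<close> and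
  \<open>F t = F T\<close> for \<open>t > T\<close>.  The choice of extension does not affect anything below: for a
  nonnegative time that is a.s. at most \<open>T\<close>, the stopping time condition at \<open>t\<close> outside \<open>[0, T]\<close>
  is automatic since null sets belong to \<open>F 0\<close>.
\<close>

locale dynkin_setting =
  prob_space M + complete_measure M + filtration "space M" F
  for M :: "'a measure" and F :: "real \<Rightarrow> 'a measure" +
  fixes T :: real
  assumes T_pos: "0 < T"
    and subalgebra_F: "\<And>t. subalgebra M (F t)"
    and complete_F: "null_sets M \<subseteq> sets (F 0)"
    and right_continuous_F: "\<And>t. 0 \<le> t \<Longrightarrow> t < T \<Longrightarrow> sets (F t) = (\<Inter>s\<in>{t<..T}. sets (F s))"

definition stopping_times ::
  "'a measure \<Rightarrow> (real \<Rightarrow> 'a measure) \<Rightarrow> real \<Rightarrow> ('a \<Rightarrow> real) \<Rightarrow> ('a \<Rightarrow> real) set" where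
  "stopping_times M F T \<theta> =
     {\<tau>. stopping_time F \<tau> \<and> (\<forall>\<omega>\<in>space M. 0 \<le> \<tau> \<omega>) \<and> (AE \<omega> in M. \<theta> \<omega> \<le> \<tau> \<omega> \<and> \<tau> \<omega> \<le> T)}"

text \<open>
  A process is a function \<open>Z :: real \<Rightarrow> 'a \<Rightarrow> real\<close>, with time as its first argument; its values
  at times outside \<open>[0, T]\<close> play no role.
\<close>

definition progressively_measurable ::
  "(real \<Rightarrow> 'a measure) \<Rightarrow> real \<Rightarrow> (real \<Rightarrow> 'a \<Rightarrow> real) \<Rightarrow> bool" where
  "progressively_measurable F T Z \<longleftrightarrow>
     (\<forall>t\<in>{0..T}. (\<lambda>(s, \<omega>). Z s \<omega>) \<in> borel_measurable (restrict_space borel {0..t} \<Otimes>\<^sub>M F t))"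

definition uniformly_integrable :: "'a measure \<Rightarrow> ('a \<Rightarrow> real) set \<Rightarrow> bool" where
  "uniformly_integrable M S \<longleftrightarrow>
     (\<forall>f\<in>S. integrable M f) \<and>
     (\<forall>\<epsilon>>0. \<exists>K\<ge>0. \<forall>f\<in>S. (\<integral>\<omega>. \<bar>f \<omega>\<bar> * indicator {\<omega>. K < \<bar>f \<omega>\<bar>} \<omega> \<partial>M) < \<epsilon>)"

definition class_D ::
  "'a measure \<Rightarrow> (real \<Rightarrow> 'a measure) \<Rightarrow> real \<Rightarrow> (real \<Rightarrow> 'a \<Rightarrow> real) \<Rightarrow> bool" where
  "class_D M F T Z \<longleftrightarrow>
     uniformly_integrable M {(\<lambda>\<omega>. Z (\<tau> \<omega>) \<omega>) | \<tau>. \<tau> \<in> stopping_times M F T (\<lambda>_. 0)}"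

definition right_continuous_paths ::
  "'a measure \<Rightarrow> real \<Rightarrow> (real \<Rightarrow> 'a \<Rightarrow> real) \<Rightarrow> bool" where
  "right_continuous_paths M T Z \<longleftrightarrow>
     (AE \<omega> in M. \<forall>t. 0 \<le> t \<and> t < T \<longrightarrow> ((\<lambda>s. Z s \<omega>) \<longlongrightarrow> Z t \<omega>) (at_right t))"

definition rcll_paths ::
  "'a measure \<Rightarrow> real \<Rightarrow> (real \<Rightarrow> 'a \<Rightarrow> real) \<Rightarrow> bool" where
  "rcll_paths M T Z \<longleftrightarrow>
     right_continuous_paths M T Z \<and>
     (AE \<omega> in M. \<forall>t. 0 < t \<and> t \<le> T \<longrightarrow> (\<exists>l. ((\<lambda>s. Z s \<omega>) \<longlongrightarrow> l) (at_left t)))"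

text \<open>The usual convention \<open>Z\<^bsub>0-\<^esub> = Z\<^sub>0\<close> is used, so there is no jump at time \<open>0\<close>.\<close>

definition left_limit :: "(real \<Rightarrow> 'a \<Rightarrow> real) \<Rightarrow> real \<Rightarrow> 'a \<Rightarrow> real" where
  "left_limit Z t \<omega> = (if t = 0 then Z 0 \<omega> else Lim (at_left t) (\<lambda>s. Z s \<omega>))"

text \<open>Predictable means announceable by a sequence of stopping times.\<close>

definition predictable_stopping_time ::
  "'a measure \<Rightarrow> (real \<Rightarrow> 'a measure) \<Rightarrow> real \<Rightarrow> ('a \<Rightarrow> real) \<Rightarrow> bool" where
  "predictable_stopping_time M F T \<tau> \<longleftrightarrow>
     \<tau> \<in> stopping_times M F T (\<lambda>_. 0) \<and>
     (\<exists>\<sigma>. (\<forall>k::nat. \<sigma> k \<in> stopping_times M F T (\<lambda>_. 0)) \<and>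
       (AE \<omega> in M. incseq (\<lambda>k. \<sigma> k \<omega>) \<and> (\<lambda>k. \<sigma> k \<omega>) \<longlonglongrightarrow> \<tau> \<omega> \<and>
          (0 < \<tau> \<omega> \<longrightarrow> (\<forall>k. \<sigma> k \<omega> < \<tau> \<omega>))))"

definition no_negative_predictable_jumps ::
  "'a measure \<Rightarrow> (real \<Rightarrow> 'a measure) \<Rightarrow> real \<Rightarrow> (real \<Rightarrow> 'a \<Rightarrow> real) \<Rightarrow> bool" where
  "no_negative_predictable_jumps M F T Z \<longleftrightarrow>
     (\<forall>\<tau>. predictable_stopping_time M F T \<tau> \<longrightarrow>
        (AE \<omega> in M. left_limit Z (\<tau> \<omega>) \<omega> \<le> Z (\<tau> \<omega>) \<omega>))"

text \<open>
  The essential supremum of a possibly uncountable family of random variables; the library's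
  \<^const>\<open>esssup\<close> is the essential supremum of a single function.
\<close>

definition is_ess_sup :: "'a measure \<Rightarrow> ('a \<Rightarrow> real) set \<Rightarrow> ('a \<Rightarrow> real) \<Rightarrow> bool" where
  "is_ess_sup M A g \<longleftrightarrow>
     g \<in> borel_measurable M \<and>
     (\<forall>f\<in>A. AE \<omega> in M. f \<omega> \<le> g \<omega>) \<and>
     (\<forall>h\<in>borel_measurable M. (\<forall>f\<in>A. AE \<omega> in M. f \<omega> \<le> h \<omega>) \<longrightarrow> (AE \<omega> in M. g \<omega> \<le> h \<omega>))"

text \<open>
  The Snell envelope is determined only up to indistinguishability; this is the property of
  being a version of it.
\<close>

definition snell_envelope ::
  "'a measure \<Rightarrow> (real \<Rightarrow> 'a measure) \<Rightarrow> real \<Rightarrow>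
   (real \<Rightarrow> 'a \<Rightarrow> real) \<Rightarrow> (real \<Rightarrow> 'a \<Rightarrow> real) \<Rightarrow> bool" where
  "snell_envelope M F T U W \<longleftrightarrow>
     rcll_paths M T W \<and>
     (\<forall>t\<in>{0..T}. W t \<in> borel_measurable (F t) \<and>
        is_ess_sup M
          {real_cond_exp M (F t) (\<lambda>\<omega>. U (\<nu> \<omega>) \<omega>) | \<nu>. \<nu> \<in> stopping_times M F T (\<lambda>_. t)}
          (W t))"

definition others_min :: "nat \<Rightarrow> (nat \<Rightarrow> 'a \<Rightarrow> real) \<Rightarrow> nat \<Rightarrow> 'a \<Rightarrow> real" where
  "others_min N S i \<omega> = Min ((\<lambda>j. S j \<omega>) ` ({1..N} - {i}))"

definition payoff ::
  "'a measure \<Rightarrow> nat \<Rightarrow> (nat \<Rightarrow> real \<Rightarrow> 'a \<Rightarrow> real) \<Rightarrow> (nat \<Rightarrow> real \<Rightarrow> 'a \<Rightarrow> real) \<Rightarrow>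
   (nat \<Rightarrow> real \<Rightarrow> 'a \<Rightarrow> real) \<Rightarrow> nat \<Rightarrow> (nat \<Rightarrow> 'a \<Rightarrow> real) \<Rightarrow> real" where
  "payoff M N X Q Y i S =
     (\<integral>\<omega>. X i (S i \<omega>) \<omega> * of_bool (S i \<omega> < others_min N S i \<omega>)
         + Q i (S i \<omega>) \<omega> * of_bool (S i \<omega> = others_min N S i \<omega>)
         + Y i (others_min N S i \<omega>) \<omega> * of_bool (S i \<omega> > others_min N S i \<omega>) \<partial>M)"

definition nash_equilibrium ::
  "'a measure \<Rightarrow> (real \<Rightarrow> 'a measure) \<Rightarrow> real \<Rightarrow> nat \<Rightarrow> (nat \<Rightarrow> real \<Rightarrow> 'a \<Rightarrow> real) \<Rightarrow>
   (nat \<Rightarrow> real \<Rightarrow> 'a \<Rightarrow> real) \<Rightarrow> (nat \<Rightarrow> real \<Rightarrow> 'a \<Rightarrow> real) \<Rightarrow> (nat \<Rightarrow> 'a \<Rightarrow> real) \<Rightarrow> bool" where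
  "nash_equilibrium M F T N X Q Y S \<longleftrightarrow>
     (\<forall>i\<in>{1..N}. S i \<in> stopping_times M F T (\<lambda>_. 0)) \<and>
     (\<forall>i\<in>{1..N}. \<forall>\<theta>\<in>stopping_times M F T (\<lambda>_. 0).
        payoff M N X Q Y i (S(i := \<theta>)) \<le> payoff M N X Q Y i S)"

definition Y_tilde ::
  "real \<Rightarrow> (real \<Rightarrow> 'a \<Rightarrow> real) \<Rightarrow> (real \<Rightarrow> 'a \<Rightarrow> real) \<Rightarrow> real \<Rightarrow> 'a \<Rightarrow> real" where
  "Y_tilde T Qi Yi t \<omega> = Qi T \<omega> * of_bool (t = T) + Yi t \<omega> * of_bool (t < T)"

definition theta_seq :: "nat \<Rightarrow> (nat \<Rightarrow> 'a \<Rightarrow> real) \<Rightarrow> nat \<Rightarrow> 'a \<Rightarrow> real" where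
  "theta_seq N \<tau> n \<omega> = Min ((\<lambda>k. \<tau> (n - k) \<omega>) ` {1..N - 1})"

definition stopped_payoff ::
  "real \<Rightarrow> (real \<Rightarrow> 'a \<Rightarrow> real) \<Rightarrow> (real \<Rightarrow> 'a \<Rightarrow> real) \<Rightarrow> (real \<Rightarrow> 'a \<Rightarrow> real) \<Rightarrow>
   ('a \<Rightarrow> real) \<Rightarrow> real \<Rightarrow> 'a \<Rightarrow> real" where
  "stopped_payoff T Xi Qi Yi \<theta> t \<omega> =
     Xi t \<omega> * of_bool (t < \<theta> \<omega>) + Y_tilde T Qi Yi (\<theta> \<omega>) \<omega> * of_bool (t \<ge> \<theta> \<omega>)"

text \<open>
  \<open>inf {s \<ge> 0. W\<^sub>s = U\<^sub>s}\<close> over \<open>s \<in> [0, T]\<close>.  Adding \<open>T\<close> to the set only fixes \<open>inf {} = T\<close>: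
  for a Snell envelope \<open>W\<close> of \<open>U\<close>, \<open>W\<^sub>T = U\<^sub>T\<close> almost surely.
\<close>

definition first_meeting ::
  "real \<Rightarrow> (real \<Rightarrow> 'a \<Rightarrow> real) \<Rightarrow> (real \<Rightarrow> 'a \<Rightarrow> real) \<Rightarrow> 'a \<Rightarrow> real" where
  "first_meeting T W U \<omega> = Inf (insert T {s. 0 \<le> s \<and> s \<le> T \<and> W s \<omega> = U s \<omega>})"

text \<open>
  The inductive construction: \<open>\<tau>\<close> is obtained from versions \<open>W n\<close> of the Snell envelopes.
  Indices run from \<open>1\<close>, and the values at \<open>n = 0\<close> are not used.
\<close>

definition equilibrium_construction ::
  "'a measure \<Rightarrow> (real \<Rightarrow> 'a measure) \<Rightarrow> real \<Rightarrow> nat \<Rightarrow> (nat \<Rightarrow> real \<Rightarrow> 'a \<Rightarrow> real) \<Rightarrow>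
   (nat \<Rightarrow> real \<Rightarrow> 'a \<Rightarrow> real) \<Rightarrow> (nat \<Rightarrow> real \<Rightarrow> 'a \<Rightarrow> real) \<Rightarrow>
   (nat \<Rightarrow> real \<Rightarrow> 'a \<Rightarrow> real) \<Rightarrow> (nat \<Rightarrow> 'a \<Rightarrow> real) \<Rightarrow> bool" where
  "equilibrium_construction M F T N X Q Y W \<tau> \<longleftrightarrow>
     (\<forall>n\<in>{1..N}. \<forall>\<omega>\<in>space M. \<tau> n \<omega> = T) \<and>
     (\<forall>n q i. n \<ge> N + 1 \<and> n = N * q + i \<and> i \<in> {1..N} \<longrightarrow>
       (let \<theta> = theta_seq N \<tau> n;
            U = stopped_payoff T (X i) (Q i) (Y i) \<theta>;
            \<mu> = first_meeting T (W n) U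
        in snell_envelope M F T U (W n) \<and>
           (\<forall>\<omega>\<in>space M. \<tau> n \<omega> =
              min (\<mu> \<omega>) (\<tau> (n - N) \<omega>) * of_bool (min (\<mu> \<omega>) (\<tau> (n - N) \<omega>) < \<theta> \<omega>)
              + \<tau> (n - N) \<omega> * of_bool (min (\<mu> \<omega>) (\<tau> (n - N) \<omega>) \<ge> \<theta> \<omega>))))"

definition limit_profile :: "nat \<Rightarrow> (nat \<Rightarrow> 'a \<Rightarrow> real) \<Rightarrow> nat \<Rightarrow> 'a \<Rightarrow> real" where
  "limit_profile N \<tau> i \<omega> = lim (\<lambda>n. \<tau> (N * n + i) \<omega>)"

end

(*
The optimal stopping problem behind each step is solved by first meeting times: without negative
predictable jumps, the times at which W - U first drops below 1/(m+1) increase to an optimal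
stopping time, and it is the first meeting time of W and U.  Hence tau_n is a best reply of the
moving player against theta_n (with Y in place of Q at ties before T).  Letting n tend to infinity,
optimality passes to the limit profile because (Y - X) on the event that a player moves strictly
ahead of opponents with the same limit time vanishes in mean.  Among players stopping together in the
limit before T, one moves strictly ahead in every late round, so X < Y cannot hold for all players
there, and by (A4) Q = Y at ties before T.
*)
theory Submission
  imports Defs
begin

text \<open>The process \<open>Q\<close> is only progressively measurable, so a reward paying
  \<open>Q\<close> at ties could not be handled by right continuity or by limits of stopping times.
  Paying \<open>Y\<close> instead at ties before \<open>T\<close> has two merits. The reward is
  constant from \<theta> on and the switch at \<theta> is upward because X \<le> Y, so the condition
  on predictable jumps of \<open>X\<close> carries over to it. It also bounds the true payoff of
  every deviation from above, so solving the modified problem settles the game as soon as both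
  payoffs agree at the equilibrium itself. Ties are therefore an issue only for the limit: in the
  construction different players have different times before \<open>T\<close>, but these may merge
  in the limit, and there the reward does not depend continuously on the times.

  The Snell envelope is given only through essential suprema at fixed times. Its values at random
  times are reached through finitely valued stopping times from above, and optimality is compared in
  means throughout.\<close>

section \<open>Uniform integrability\<close>

text \<open>
  Uniform integrability is used through the excess \<open>(\<bar>f\<bar> - K)\<^sup>+\<close>: being convex in \<open>f\<close>, it behaves well
  under sums and conditional expectations.
\<close>

abbreviation excess :: "'a measure \<Rightarrow> real \<Rightarrow> ('a \<Rightarrow> real) \<Rightarrow> real" where
  "excess M K f \<equiv> \<integral>\<omega>. max 0 (\<bar>f \<omega>\<bar> - K) \<partial>M"

definition ui_family :: "'a measure \<Rightarrow> ('a \<Rightarrow> real) set \<Rightarrow> bool" where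
  "ui_family M S \<longleftrightarrow> (\<forall>f\<in>S. integrable M f) \<and>
     (\<forall>\<epsilon>>0. \<exists>K\<ge>0. \<forall>f\<in>S. excess M K f \<le> \<epsilon>)"

lemma ui_familyD: "ui_family M S \<Longrightarrow> f \<in> S \<Longrightarrow> integrable M f"
  by (auto simp: ui_family_def)

lemma ui_familyE:
  assumes "ui_family M S" "\<epsilon> > 0"
  obtains K where "K \<ge> 0" "\<And>f. f \<in> S \<Longrightarrow> excess M K f \<le> \<epsilon>"
proof -
  have "\<exists>K\<ge>0. \<forall>f\<in>S. excess M K f \<le> \<epsilon>"
    using assms by (simp add: ui_family_def)
  then show thesis using that by blast
qed

lemma ui_family_mono: "ui_family M S \<Longrightarrow> S' \<subseteq> S \<Longrightarrow> ui_family M S'"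
  unfolding ui_family_def by blast

context finite_measure
begin

lemma integrable_excess [simp, intro]:
  fixes f :: "'a \<Rightarrow> real"
  shows "integrable M f \<Longrightarrow> integrable M (\<lambda>\<omega>. max 0 (\<bar>f \<omega>\<bar> - K))"
  by (intro integrable_max Bochner_Integration.integrable_diff integrable_abs) simp_all

lemma uniformly_integrable_ui_family:
  assumes "uniformly_integrable M S"
  shows "ui_family M S"
  unfolding ui_family_def
proof (intro conjI ballI allI impI)
  show "integrable M f" if "f \<in> S" for f
    using that assms by (auto simp: uniformly_integrable_def)
next
  fix \<epsilon> :: real assume "\<epsilon> > 0"
  then obtain K where K: "K \<ge> 0"
    "\<And>f. f \<in> S \<Longrightarrow> (\<integral>\<omega>. \<bar>f \<omega>\<bar> * indicator {\<omega>. K < \<bar>f \<omega>\<bar>} \<omega> \<partial>M) < \<epsilon>"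
    using assms unfolding uniformly_integrable_def by metis
  have "excess M K f \<le> \<epsilon>" if "f \<in> S" for f
  proof -
    have f[simp]: "integrable M f" using that assms by (auto simp: uniformly_integrable_def)
    then have [measurable]: "f \<in> borel_measurable M" by (rule borel_measurable_integrable)
    have eq: "(\<lambda>\<omega>. \<bar>f \<omega>\<bar> * indicator {\<omega>. K < \<bar>f \<omega>\<bar>} \<omega>) = (\<lambda>\<omega>. if K < \<bar>f \<omega>\<bar> then \<bar>f \<omega>\<bar> else 0)"
      by (auto simp: indicator_def)
    have "integrable M (\<lambda>\<omega>. if K < \<bar>f \<omega>\<bar> then \<bar>f \<omega>\<bar> else 0)"
      by (rule Bochner_Integration.integrable_bound[of _ f]) auto
    then have "excess M K f \<le> (\<integral>\<omega>. (if K < \<bar>f \<omega>\<bar> then \<bar>f \<omega>\<bar> else 0) \<partial>M)"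
      using K(1) f by (intro integral_mono) auto
    then show ?thesis using K(2)[OF that] unfolding eq by simp
  qed
  then show "\<exists>K\<ge>0. \<forall>f\<in>S. excess M K f \<le> \<epsilon>" using K(1) by blast
qed

text \<open>Thresholds add up: if |h| \<le> |f| + |g|, then the excess of \<open>h\<close> over
  \<open>K + L\<close> is at most the excess of \<open>f\<close> over \<open>K\<close> plus that of
  \<open>g\<close> over \<open>L\<close>. The tail integrals of |f| over {|f| > K} satisfy no such
  inequality.\<close>

lemma ui_family_dominated_sum:
  assumes A: "ui_family M A" and B: "ui_family M B"
    and S: "\<And>h. h \<in> S \<Longrightarrow> h \<in> borel_measurable M \<and>
      (\<exists>f\<in>A. \<exists>g\<in>B. AE \<omega> in M. \<bar>h \<omega>\<bar> \<le> \<bar>f \<omega>\<bar> + \<bar>g \<omega>\<bar>)"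
  shows "ui_family M S"
  unfolding ui_family_def
proof (intro conjI ballI allI impI)
  show int: "integrable M h" if h: "h \<in> S" for h
  proof -
    obtain f g where fg: "f \<in> A" "g \<in> B" "AE \<omega> in M. \<bar>h \<omega>\<bar> \<le> \<bar>f \<omega>\<bar> + \<bar>g \<omega>\<bar>" using S[OF h] by blast
    have "integrable M (\<lambda>\<omega>. \<bar>f \<omega>\<bar> + \<bar>g \<omega>\<bar>)" using ui_familyD[OF A fg(1)] ui_familyD[OF B fg(2)] by auto
    then show ?thesis by (rule Bochner_Integration.integrable_bound)
       (use S[OF h] fg(3) in \<open>auto elim: eventually_mono\<close>)
  qed
  fix \<epsilon> :: real assume e: "\<epsilon> > 0"
  obtain K where K: "K \<ge> 0" "\<And>f. f \<in> A \<Longrightarrow> excess M K f \<le> \<epsilon>/2"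
    using ui_familyE[OF A, of "\<epsilon>/2"] e by auto
  obtain L where L: "L \<ge> 0" "\<And>f. f \<in> B \<Longrightarrow> excess M L f \<le> \<epsilon>/2"
    using ui_familyE[OF B, of "\<epsilon>/2"] e by auto
  have "(\<integral>\<omega>. max 0 (\<bar>h \<omega>\<bar> - (K + L)) \<partial>M) \<le> \<epsilon>" if h: "h \<in> S" for h
  proof -
    obtain f g where fg: "f \<in> A" "g \<in> B" "AE \<omega> in M. \<bar>h \<omega>\<bar> \<le> \<bar>f \<omega>\<bar> + \<bar>g \<omega>\<bar>" using S[OF h] by blast
    have [simp]: "integrable M f" "integrable M g" using ui_familyD[OF A fg(1)] ui_familyD[OF B fg(2)] by auto
    have "(\<integral>\<omega>. max 0 (\<bar>h \<omega>\<bar> - (K + L)) \<partial>M)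
      \<le> (\<integral>\<omega>. max 0 (\<bar>f \<omega>\<bar> - K) + max 0 (\<bar>g \<omega>\<bar> - L) \<partial>M)"
    proof (rule integral_mono_AE)
      show "AE \<omega> in M. max 0 (\<bar>h \<omega>\<bar> - (K + L)) \<le> max 0 (\<bar>f \<omega>\<bar> - K) + max 0 (\<bar>g \<omega>\<bar> - L)"
        using fg(3) by eventually_elim (simp add: max_def)
    qed (simp_all add: int[OF h])
    also have "\<dots> = excess M K f + excess M L g"
      by (rule Bochner_Integration.integral_add) auto
    finally show ?thesis using K(2)[OF fg(1)] L(2)[OF fg(2)] by linarith
  qed
  then show "\<exists>K\<ge>0. \<forall>f\<in>S. excess M K f \<le> \<epsilon>"
    using K(1) L(1) by (intro exI[of _ "K + L"]) auto
qed

lemma ui_family_singleton: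
  assumes f: "integrable M f"
  shows "ui_family M {f}"
  unfolding ui_family_def
proof (intro conjI allI impI)
  fix \<epsilon> :: real assume e: "\<epsilon> > 0"
  have [measurable]: "f \<in> borel_measurable M" using f by (rule borel_measurable_integrable)
  have "(\<lambda>n. \<integral>\<omega>. max 0 (\<bar>f \<omega>\<bar> - real n) \<partial>M) \<longlonglongrightarrow> (\<integral>\<omega>. 0 \<partial>M)"
  proof (rule integral_dominated_convergence[where w = "\<lambda>\<omega>. \<bar>f \<omega>\<bar>"])
    show "AE \<omega> in M. (\<lambda>n. max 0 (\<bar>f \<omega>\<bar> - real n)) \<longlonglongrightarrow> 0"
    proof (intro always_eventually allI)
      fix \<omega>
      have "\<forall>\<^sub>F n in sequentially. max 0 (\<bar>f \<omega>\<bar> - real n) = 0"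
        using eventually_ge_at_top[of "nat \<lceil>\<bar>f \<omega>\<bar>\<rceil>"] by eventually_elim (simp add: max_def; linarith)
      then show "(\<lambda>n. max 0 (\<bar>f \<omega>\<bar> - real n)) \<longlonglongrightarrow> 0" by (rule tendsto_eventually)
    qed
  qed (use f in auto)
  then have "\<forall>\<^sub>F n in sequentially. (\<integral>\<omega>. max 0 (\<bar>f \<omega>\<bar> - real n) \<partial>M) < \<epsilon>"
    using e by (simp add: order_tendstoD)
  then obtain n :: nat where "(\<integral>\<omega>. max 0 (\<bar>f \<omega>\<bar> - real n) \<partial>M) < \<epsilon>"
    using eventually_happens'[OF sequentially_bot] by blast
  then show "\<exists>K\<ge>0. \<forall>g\<in>{f}. excess M K g \<le> \<epsilon>"
    by (intro exI[of _ "real n"]) auto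
qed (use f in auto)

lemma ui_family_bounded:
  assumes "ui_family M S"
  obtains C where "\<And>f. f \<in> S \<Longrightarrow> (\<integral>\<omega>. \<bar>f \<omega>\<bar> \<partial>M) \<le> C"
proof -
  obtain K where K: "K \<ge> 0" "\<And>f. f \<in> S \<Longrightarrow> excess M K f \<le> 1"
    using ui_familyE[OF assms, of 1] by auto
  have "(\<integral>\<omega>. \<bar>f \<omega>\<bar> \<partial>M) \<le> 1 + K * measure M (space M)" if "f \<in> S" for f
  proof -
    have [simp]: "integrable M f" using ui_familyD[OF assms that] .
    have "(\<integral>\<omega>. \<bar>f \<omega>\<bar> \<partial>M) \<le> (\<integral>\<omega>. max 0 (\<bar>f \<omega>\<bar> - K) + K \<partial>M)"
      by (intro integral_mono) auto
    also have "\<dots> = excess M K f + K * measure M (space M)"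
      by (subst Bochner_Integration.integral_add) auto
    finally show ?thesis using K(2)[OF that] by linarith
  qed
  then show thesis by (rule that)
qed

lemma ui_family_small_sets:
  assumes "ui_family M S" "\<epsilon> > 0"
  obtains \<delta> where "\<delta> > 0"
    "\<And>f A. f \<in> S \<Longrightarrow> A \<in> sets M \<Longrightarrow> measure M A \<le> \<delta> \<Longrightarrow> (\<integral>\<omega>. \<bar>f \<omega>\<bar> * indicator A \<omega> \<partial>M) \<le> \<epsilon>"
proof -
  obtain K where K: "K \<ge> 0" "\<And>f. f \<in> S \<Longrightarrow> excess M K f \<le> \<epsilon>/2"
    using ui_familyE[OF assms(1), of "\<epsilon>/2"] assms(2) by auto
  \<comment> \<open>The threshold \<open>\<epsilon> / (2 * (K + 1))\<close> makes the part of |f|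
    below \<open>K\<close> contribute at most \<open>\<epsilon>/2\<close>; the added 1 covers
    \<open>K = 0\<close>.\<close>
  have "(\<integral>\<omega>. \<bar>f \<omega>\<bar> * indicator A \<omega> \<partial>M) \<le> \<epsilon>"
    if f: "f \<in> S" and A: "A \<in> sets M" and small: "measure M A \<le> \<epsilon> / (2 * (K + 1))" for f A
  proof -
    have [simp]: "integrable M f" using ui_familyD[OF assms(1) f] .
    have iA: "integrable M (\<lambda>\<omega>. K * indicator A \<omega>)" using A by (simp add: emeasure_eq_measure)
    have "(\<integral>\<omega>. \<bar>f \<omega>\<bar> * indicator A \<omega> \<partial>M) \<le> (\<integral>\<omega>. max 0 (\<bar>f \<omega>\<bar> - K) + K * indicator A \<omega> \<partial>M)"
      using A iA by (intro integral_mono integrable_real_mult_indicator) (auto simp: indicator_def)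
    also have "\<dots> = excess M K f + K * measure M A"
      using A iA by (subst Bochner_Integration.integral_add) auto
    also have "K * measure M A \<le> (K + 1) * (\<epsilon> / (2 * (K + 1)))"
      using small K(1) by (intro mult_mono) auto
    also have "\<dots> = \<epsilon> / 2" using K(1) by (simp add: field_simps)
    finally show ?thesis using K(2)[OF f] by linarith
  qed
  moreover have "\<epsilon> / (2 * (K + 1)) > 0" using assms(2) K(1) by simp
  ultimately show thesis by (rule that[rotated])
qed

text \<open>Integrability of the limit is part of the conclusion: Fatou's lemma is applied to
  nonnegative extended integrals, where the finite bound \<open>c\<close> yields it. The Vitali
  theorem uses this for |g| and again for the excess of \<open>g\<close>.\<close>

lemma fatou_bound:
  fixes h :: "nat \<Rightarrow> 'a \<Rightarrow> real"
  assumes h: "\<And>n. integrable M (h n)" "\<And>n \<omega>. 0 \<le> h n \<omega>" "\<And>n. (\<integral>\<omega>. h n \<omega> \<partial>M) \<le> c"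
    and lim: "AE \<omega> in M. (\<lambda>n. h n \<omega>) \<longlonglongrightarrow> g \<omega>" and g: "g \<in> borel_measurable M" "\<And>\<omega>. 0 \<le> g \<omega>"
  shows "integrable M g \<and> (\<integral>\<omega>. g \<omega> \<partial>M) \<le> c"
proof -
  have c: "c \<ge> 0" using Bochner_Integration.integral_nonneg[of M "h 0", OF h(2)] h(3)[of 0] by linarith
  have [measurable]: "h n \<in> borel_measurable M" for n using h(1) by (rule borel_measurable_integrable)
  have "(\<integral>\<^sup>+\<omega>. ennreal (g \<omega>) \<partial>M) = (\<integral>\<^sup>+\<omega>. liminf (\<lambda>n. ennreal (h n \<omega>)) \<partial>M)"
    using lim by (intro nn_integral_cong_AE) (auto elim!: eventually_mono intro!: lim_imp_Liminf[symmetric])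
  also have "\<dots> \<le> liminf (\<lambda>n. \<integral>\<^sup>+\<omega>. ennreal (h n \<omega>) \<partial>M)"
    by (rule nn_integral_liminf) auto
  also have "\<dots> \<le> limsup (\<lambda>n. \<integral>\<^sup>+\<omega>. ennreal (h n \<omega>) \<partial>M)"
    by (rule Liminf_le_Limsup) auto
  also have "\<dots> \<le> ennreal c"
    by (intro Limsup_bounded always_eventually allI, subst nn_integral_eq_integral)
       (use h in \<open>auto intro: ennreal_leI\<close>)
  finally have le: "(\<integral>\<^sup>+\<omega>. ennreal (g \<omega>) \<partial>M) \<le> ennreal c" .
  then have int: "integrable M g"
    using g by (intro integrableI_nonneg) (auto simp: order_le_less_trans)
  then have "ennreal (\<integral>\<omega>. g \<omega> \<partial>M) \<le> ennreal c" using le g(2) by (simp add: nn_integral_eq_integral)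
  then show ?thesis using int c by simp
qed

theorem vitali_convergence:
  fixes f :: "nat \<Rightarrow> 'a \<Rightarrow> real"
  assumes ui: "ui_family M S" and f: "\<And>n. f n \<in> S"
    and lim: "AE \<omega> in M. (\<lambda>n. f n \<omega>) \<longlonglongrightarrow> g \<omega>" and g[measurable]: "g \<in> borel_measurable M"
  shows "integrable M g" "(\<lambda>n. \<integral>\<omega>. f n \<omega> \<partial>M) \<longlonglongrightarrow> (\<integral>\<omega>. g \<omega> \<partial>M)"
proof -
  have fi[simp]: "integrable M (f n)" for n using ui_familyD[OF ui f] .
  have [measurable]: "f n \<in> borel_measurable M" for n using fi by (rule borel_measurable_integrable)
  obtain C where C: "\<And>f. f \<in> S \<Longrightarrow> (\<integral>\<omega>. \<bar>f \<omega>\<bar> \<partial>M) \<le> C" using ui_family_bounded[OF ui] by auto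
  have "integrable M (\<lambda>\<omega>. \<bar>g \<omega>\<bar>) \<and> (\<integral>\<omega>. \<bar>g \<omega>\<bar> \<partial>M) \<le> C"
    by (rule fatou_bound[where h = "\<lambda>n \<omega>. \<bar>f n \<omega>\<bar>"])
       (use C[OF f] lim in \<open>auto intro: tendsto_rabs elim: eventually_mono\<close>)
  then show gi[simp]: "integrable M g" by (simp add: integrable_abs_iff)
  show "(\<lambda>n. \<integral>\<omega>. f n \<omega> \<partial>M) \<longlonglongrightarrow> (\<integral>\<omega>. g \<omega> \<partial>M)"
  proof (rule LIMSEQ_I)
    fix r :: real assume r: "r > 0"
    obtain K where K: "K \<ge> 0" "\<And>f. f \<in> S \<Longrightarrow> excess M K f \<le> r/4"
      using ui_familyE[OF ui, of "r/4"] r by auto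
    \<comment> \<open>Clamping to [-K, K] splits the convergence in two: the clamped integrals
      converge by dominated convergence, and the error of clamping is at most the excess over
      \<open>K\<close>, which is small for all \<open>f n\<close> by uniform integrability and for
      \<open>g\<close> by Fatou.\<close>
    define cl where "cl x = max (-K) (min K x)" for x :: real
    have cl_cont: "continuous_on UNIV cl" unfolding cl_def by (intro continuous_intros)
    have [measurable]: "cl \<in> borel_measurable borel" unfolding cl_def by measurable
    have cl_bd: "\<bar>cl x\<bar> \<le> K" for x using K(1) by (auto simp: cl_def)
    have cl_diff: "\<bar>x - cl x\<bar> = max 0 (\<bar>x\<bar> - K)" for x using K(1) by (auto simp: cl_def)
    have cl_int[simp]: "integrable M (\<lambda>\<omega>. cl (u \<omega>))" if "u \<in> borel_measurable M" for u
      by (rule integrable_const_bound[where B = K]) (use cl_bd that in auto)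
    have err: "\<bar>(\<integral>\<omega>. u \<omega> \<partial>M) - (\<integral>\<omega>. cl (u \<omega>) \<partial>M)\<bar> \<le> excess M K u"
      if u: "integrable M u" for u
    proof -
      have "\<bar>(\<integral>\<omega>. u \<omega> \<partial>M) - (\<integral>\<omega>. cl (u \<omega>) \<partial>M)\<bar> = \<bar>\<integral>\<omega>. u \<omega> - cl (u \<omega>) \<partial>M\<bar>"
        using u by (subst Bochner_Integration.integral_diff) auto
      also have "\<dots> \<le> (\<integral>\<omega>. \<bar>u \<omega> - cl (u \<omega>)\<bar> \<partial>M)" by (rule integral_abs_bound)
      finally show ?thesis by (simp add: cl_diff)
    qed
    have "integrable M (\<lambda>\<omega>. max 0 (\<bar>g \<omega>\<bar> - K)) \<and> excess M K g \<le> r/4"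
    proof (rule fatou_bound[where h = "\<lambda>n \<omega>. max 0 (\<bar>f n \<omega>\<bar> - K)"])
      show "AE \<omega> in M. (\<lambda>n. max 0 (\<bar>f n \<omega>\<bar> - K)) \<longlonglongrightarrow> max 0 (\<bar>g \<omega>\<bar> - K)"
        using lim by eventually_elim (intro tendsto_intros)
    qed (use K(2) f in auto)
    then have eg: "\<bar>(\<integral>\<omega>. g \<omega> \<partial>M) - (\<integral>\<omega>. cl (g \<omega>) \<partial>M)\<bar> \<le> r/4" using err[OF gi] by linarith
    have "(\<lambda>n. \<integral>\<omega>. cl (f n \<omega>) \<partial>M) \<longlonglongrightarrow> (\<integral>\<omega>. cl (g \<omega>) \<partial>M)"
    proof (rule integral_dominated_convergence[where w = "\<lambda>_. K"])
      show "AE \<omega> in M. (\<lambda>n. cl (f n \<omega>)) \<longlonglongrightarrow> cl (g \<omega>)"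
        using lim by eventually_elim (rule continuous_on_tendsto_compose[OF cl_cont], auto)
    qed (use cl_bd in auto)
    from LIMSEQ_D[OF this, of "r/4"] r
    obtain n0 where n0: "\<And>n. n \<ge> n0 \<Longrightarrow> \<bar>(\<integral>\<omega>. cl (f n \<omega>) \<partial>M) - (\<integral>\<omega>. cl (g \<omega>) \<partial>M)\<bar> < r/4"
      by auto
    have "norm ((\<integral>\<omega>. f n \<omega> \<partial>M) - (\<integral>\<omega>. g \<omega> \<partial>M)) < r" if "n \<ge> n0" for n
      using n0[OF that] err[OF fi, of n] K(2)[OF f, of n] eg r unfolding real_norm_def by linarith
    then show "\<exists>n0. \<forall>n\<ge>n0. norm ((\<integral>\<omega>. f n \<omega> \<partial>M) - (\<integral>\<omega>. g \<omega> \<partial>M)) < r" by blast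
  qed
qed

end

lemma (in complete_measure) borel_measurable_AE_eq:
  assumes f[measurable]: "f \<in> borel_measurable M" and eq: "AE \<omega> in M. f \<omega> = g \<omega>"
  shows "g \<in> borel_measurable (M :: 'a measure)"
proof (rule measurableI)
  fix A :: "'b::topological_space set" assume [measurable]: "A \<in> sets borel"
  show "g -` A \<inter> space M \<in> sets M"
    by (rule in_sets_AE[of "f -` A \<inter> space M"]) (use eq in \<open>auto elim!: eventually_mono\<close>)
qed auto

text \<open>The Snell envelope is only assumed measurable at each fixed time. Its measurability at a
  stopping time is obtained from this lemma, as an almost sure limit along finitely valued
  times.\<close>

lemma (in complete_measure) borel_measurable_AE_LIMSEQ:
  fixes f :: "nat \<Rightarrow> 'a \<Rightarrow> real"
  assumes [measurable]: "\<And>n. f n \<in> borel_measurable M" and lim: "AE \<omega> in M. (\<lambda>n. f n \<omega>) \<longlonglongrightarrow> g \<omega>"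
  shows "g \<in> borel_measurable M"
proof (rule borel_measurable_AE_eq)
  show "(\<lambda>\<omega>. lim (\<lambda>n. f n \<omega>)) \<in> borel_measurable M" by measurable
  show "AE \<omega> in M. lim (\<lambda>n. f n \<omega>) = g \<omega>" using lim by eventually_elim (rule limI)
qed

section \<open>Stopping times\<close>

context dynkin_setting
begin

abbreviation ST :: "('a \<Rightarrow> real) set" where
  "ST \<equiv> stopping_times M F T (\<lambda>_. 0)"

abbreviation STs :: "real \<Rightarrow> ('a \<Rightarrow> real) set" where
  "STs t \<equiv> stopping_times M F T (\<lambda>_. t)"

abbreviation mean_at :: "(real \<Rightarrow> 'a \<Rightarrow> real) \<Rightarrow> ('a \<Rightarrow> real) \<Rightarrow> real" where
  "mean_at Z \<nu> \<equiv> \<integral>\<omega>. Z (\<nu> \<omega>) \<omega> \<partial>M"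

abbreviation mean_on :: "'a set \<Rightarrow> (real \<Rightarrow> 'a \<Rightarrow> real) \<Rightarrow> ('a \<Rightarrow> real) \<Rightarrow> real" where
  "mean_on A Z \<nu> \<equiv> \<integral>\<omega>. Z (\<nu> \<omega>) \<omega> * indicator A \<omega> \<partial>M"

lemma sets_F_subset: "A \<in> sets (F t) \<Longrightarrow> A \<in> sets M"
  using subalgebra_F[of t] by (auto simp: subalgebra_def)

lemma borel_measurable_F: "f \<in> borel_measurable (F t) \<Longrightarrow> f \<in> borel_measurable M"
  by (rule measurable_from_subalg[OF subalgebra_F])

lemma null_sets_F: "A \<in> null_sets M \<Longrightarrow> 0 \<le> t \<Longrightarrow> A \<in> sets (F t)"
  using complete_F sets_F_mono[of 0 t] by blast

text \<open>Path properties hold only almost surely, so an event such as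
  \<open>near_time m \<omega> < t\<close> agrees with an event of \<open>F t\<close> only up to a
  null set; completeness at time 0 absorbs the difference.\<close>

lemma sets_F_AE:
  assumes A: "A \<in> sets (F t)" and t: "0 \<le> t" and B: "B \<subseteq> space M"
    and eq: "AE \<omega> in M. \<omega> \<in> A \<longleftrightarrow> \<omega> \<in> B"
  shows "B \<in> sets (F t)"
proof -
  have "AE \<omega> in M. \<omega> \<notin> B - A" "AE \<omega> in M. \<omega> \<notin> A - B"
    using eq by (auto elim: eventually_mono)
  then have "B - A \<in> null_sets M" "A - B \<in> null_sets M"
    using B sets.sets_into_space[OF sets_F_subset[OF A]] unfolding null_sets_iff_AE by auto
  from this[THEN null_sets_F, OF t]
  have "A \<union> (B - A) - (A - B) \<in> sets (F t)" using sets.Diff[OF sets.Un[OF A]] by blast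
  moreover have "A \<union> (B - A) - (A - B) = B" by auto
  ultimately show ?thesis by simp
qed

text \<open>From \<open>T\<close> on the event has full measure, so completeness puts it into
  \<open>F t\<close>; before 0 it is empty.\<close>

lemma ST_I:
  assumes nn: "\<And>\<omega>. \<omega> \<in> space M \<Longrightarrow> 0 \<le> \<sigma> \<omega>" and le: "AE \<omega> in M. \<sigma> \<omega> \<le> T"
    and meas: "\<And>t. 0 \<le> t \<Longrightarrow> t < T \<Longrightarrow> {\<omega>\<in>space M. \<sigma> \<omega> \<le> t} \<in> sets (F t)"
  shows "\<sigma> \<in> ST"
proof -
  have "{\<omega>\<in>space M. \<sigma> \<omega> \<le> t} \<in> sets (F t)" for t
  proof -
    consider "t < 0" | "0 \<le> t" "t < T" | "T \<le> t" by linarith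
    then show ?thesis
    proof cases
      case 1
      then have "{\<omega>\<in>space M. \<sigma> \<omega> \<le> t} = {}" using nn by force
      then show ?thesis by (simp only: sets.empty_sets)
    next
      case 3
      show ?thesis
        by (rule sets_F_AE[OF sets.top[of "F t"]]) (use 3 T_pos le in \<open>auto simp: space_F elim: eventually_mono\<close>)
    qed (use meas in auto)
  qed
  then have "stopping_time F \<sigma>" unfolding stopping_time_def pred_def by (simp add: space_F)
  then show ?thesis using nn le by (auto simp: stopping_times_def)
qed

text \<open>The event \<sigma> \<le> t is an intersection of events \<sigma> < \<open>d n\<close>
  with \<open>d n\<close> decreasing to \<open>t\<close>, which lies in \<open>F s\<close> for every
  later \<open>s\<close>; right continuity of the filtration brings it down to \<open>F t\<close>.
  Strict events are the natural ones for decreasing limits and for entry times of right continuous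
  paths.\<close>

lemma ST_less_I:
  assumes nn: "\<And>\<omega>. \<omega> \<in> space M \<Longrightarrow> 0 \<le> \<sigma> \<omega>" and le: "AE \<omega> in M. \<sigma> \<omega> \<le> T"
    and meas: "\<And>t. 0 < t \<Longrightarrow> t \<le> T \<Longrightarrow> {\<omega>\<in>space M. \<sigma> \<omega> < t} \<in> sets (F t)"
  shows "\<sigma> \<in> ST"
proof (rule ST_I[OF nn le])
  fix t :: real assume t: "0 \<le> t" "t < T"
  have "{\<omega>\<in>space M. \<sigma> \<omega> \<le> t} \<in> sets (F s)" if s: "s \<in> {t<..T}" for s
  proof -
    define d where "d n = t + (s - t) / (real n + 1)" for n :: nat
    have d_le: "d n \<le> s" and d_gr: "t < d n" for n
    proof -
      have "(s - t) / (real n + 1) \<le> (s - t) / 1" by (rule divide_left_mono) (use s in auto)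
      then show "d n \<le> s" by (simp add: d_def)
      show "t < d n" using s by (simp add: d_def)
    qed
    have d_lim: "d \<longlonglongrightarrow> t"
      unfolding d_def using tendsto_add[OF tendsto_const[of t] tendsto_mult[OF tendsto_const[of "s - t"] LIMSEQ_inverse_real_of_nat]]
      by (simp add: field_simps)
    have eq: "{\<omega>\<in>space M. \<sigma> \<omega> \<le> t} = (\<Inter>n. {\<omega>\<in>space M. \<sigma> \<omega> < d n})"
    proof safe
      fix \<omega> and n :: nat assume "\<sigma> \<omega> \<le> t" then show "\<sigma> \<omega> < d n" using d_gr[of n] by linarith
    next
      fix \<omega> assume *: "\<omega> \<in> (\<Inter>n. {\<omega>\<in>space M. \<sigma> \<omega> < d n})"
      then show "\<omega> \<in> space M" by auto
      show "\<sigma> \<omega> \<le> t" by (rule LIMSEQ_le_const[OF d_lim]) (use * in \<open>auto intro: less_imp_le\<close>)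
    qed
    have "{\<omega>\<in>space M. \<sigma> \<omega> < d n} \<in> sets (F s)" for n
      using meas[of "d n"] d_le[of n] d_gr[of n] sets_F_mono[of "d n" s] t s by auto
    then show ?thesis unfolding eq by auto
  qed
  then show "{\<omega>\<in>space M. \<sigma> \<omega> \<le> t} \<in> sets (F t)" using right_continuous_F[OF t] t by auto
qed

lemma ST_stopping_time: "\<sigma> \<in> ST \<Longrightarrow> stopping_time F \<sigma>"
  and ST_nonneg: "\<sigma> \<in> ST \<Longrightarrow> \<omega> \<in> space M \<Longrightarrow> 0 \<le> \<sigma> \<omega>"
  and ST_AE_le: "\<sigma> \<in> ST \<Longrightarrow> AE \<omega> in M. \<sigma> \<omega> \<le> T"
  by (auto simp: stopping_times_def)

lemma ST_AE_range: "\<sigma> \<in> ST \<Longrightarrow> AE \<omega> in M. 0 \<le> \<sigma> \<omega> \<and> \<sigma> \<omega> \<le> T"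
  by (auto simp: stopping_times_def)

lemma ST_measurable: "\<sigma> \<in> ST \<Longrightarrow> \<sigma> \<in> borel_measurable M"
  using measurable_stopping_time[OF ST_stopping_time] sets_F_subset space_F by blast

lemma ST_le_sets: "\<sigma> \<in> ST \<Longrightarrow> {\<omega>\<in>space M. \<sigma> \<omega> \<le> t} \<in> sets (F t)"
  using stopping_timeD[OF ST_stopping_time] by (auto simp: pred_def space_F)

lemma ST_less_sets: "\<sigma> \<in> ST \<Longrightarrow> {\<omega>\<in>space M. \<sigma> \<omega> < t} \<in> sets (F t)"
  using stopping_time_less_const[OF ST_stopping_time] by (auto simp: pred_def space_F)

lemma ST_const: "0 \<le> c \<Longrightarrow> c \<le> T \<Longrightarrow> (\<lambda>_. c) \<in> ST"
  by (auto simp: stopping_times_def stopping_time_const)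

lemma ST_min: "\<sigma> \<in> ST \<Longrightarrow> \<rho> \<in> ST \<Longrightarrow> (\<lambda>\<omega>. min (\<sigma> \<omega>) (\<rho> \<omega>)) \<in> ST"
  unfolding stopping_times_def by (auto intro!: stopping_time_min elim: eventually_mono)

lemma ST_max: "\<sigma> \<in> ST \<Longrightarrow> \<rho> \<in> ST \<Longrightarrow> (\<lambda>\<omega>. max (\<sigma> \<omega>) (\<rho> \<omega>)) \<in> ST"
  unfolding stopping_times_def by (auto intro!: stopping_time_max simp: le_max_iff_disj elim: eventually_elim2)

lemma ST_Min:
  assumes "finite A" "A \<noteq> {}" "\<And>a. a \<in> A \<Longrightarrow> f a \<in> ST"
  shows "(\<lambda>\<omega>. Min ((\<lambda>a. f a \<omega>) ` A)) \<in> ST"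
  using assms
proof (induction rule: finite_ne_induct)
  case (insert a A)
  have "(\<lambda>\<omega>. min (f a \<omega>) (Min ((\<lambda>a. f a \<omega>) ` A))) \<in> ST"
    by (rule ST_min) (use insert in auto)
  then show ?case using insert by simp
qed simp

lemma ST_cong_AE:
  assumes \<sigma>: "\<sigma> \<in> ST" and nn: "\<And>\<omega>. \<omega> \<in> space M \<Longrightarrow> 0 \<le> \<rho> \<omega>" and eq: "AE \<omega> in M. \<sigma> \<omega> = \<rho> \<omega>"
  shows "\<rho> \<in> ST"
proof (rule ST_I[OF nn])
  show "AE \<omega> in M. \<rho> \<omega> \<le> T" using eq ST_AE_le[OF \<sigma>] by eventually_elim simp
  show "{\<omega>\<in>space M. \<rho> \<omega> \<le> t} \<in> sets (F t)" if "0 \<le> t" for t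
    by (rule sets_F_AE[OF ST_le_sets[OF \<sigma>, of t] that]) (use eq in \<open>auto elim: eventually_mono\<close>)
qed

lemma ST_LIM_incseq:
  assumes \<sigma>: "\<And>n. \<sigma> n \<in> ST" and inc: "\<And>\<omega>. \<omega> \<in> space M \<Longrightarrow> incseq (\<lambda>n. \<sigma> n \<omega>)"
    and lim: "\<And>\<omega>. \<omega> \<in> space M \<Longrightarrow> (\<lambda>n. \<sigma> n \<omega>) \<longlonglongrightarrow> \<rho> \<omega>"
  shows "\<rho> \<in> ST"
proof (rule ST_I)
  have "\<sigma> 0 \<omega> \<le> \<rho> \<omega>" if "\<omega> \<in> space M" for \<omega>
    using incseq_le[OF inc lim] that by blast
  then show "0 \<le> \<rho> \<omega>" if "\<omega> \<in> space M" for \<omega> using ST_nonneg[OF \<sigma>, of \<omega> 0] that by force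
  have "AE \<omega> in M. \<forall>n. \<sigma> n \<omega> \<le> T" using ST_AE_le[OF \<sigma>] by (simp add: AE_all_countable)
  then show "AE \<omega> in M. \<rho> \<omega> \<le> T"
    using AE_space by eventually_elim (rule LIMSEQ_le_const2[OF lim], auto)
  fix t :: real
  have "{\<omega>\<in>space M. \<rho> \<omega> \<le> t} = (\<Inter>n. {\<omega>\<in>space M. \<sigma> n \<omega> \<le> t})"
  proof safe
    fix \<omega> n assume "\<omega> \<in> space M" "\<rho> \<omega> \<le> t"
    then show "\<sigma> n \<omega> \<le> t" using incseq_le[OF inc lim, of \<omega> n] by linarith
  next
    fix \<omega> assume *: "\<omega> \<in> (\<Inter>n. {\<omega>\<in>space M. \<sigma> n \<omega> \<le> t})"
    then show "\<omega> \<in> space M" by auto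
    then show "\<rho> \<omega> \<le> t" using * by (intro LIMSEQ_le_const2[OF lim]) auto
  qed
  moreover have "\<dots> \<in> sets (F t)" using ST_le_sets[OF \<sigma>] by auto
  ultimately show "{\<omega>\<in>space M. \<rho> \<omega> \<le> t} \<in> sets (F t)" by simp
qed

lemma ST_LIM_decseq:
  assumes \<sigma>: "\<And>n. \<sigma> n \<in> ST" and dec: "\<And>\<omega>. \<omega> \<in> space M \<Longrightarrow> decseq (\<lambda>n. \<sigma> n \<omega>)"
    and lim: "\<And>\<omega>. \<omega> \<in> space M \<Longrightarrow> (\<lambda>n. \<sigma> n \<omega>) \<longlonglongrightarrow> \<rho> \<omega>"
  shows "\<rho> \<in> ST"
proof (rule ST_less_I)
  show "0 \<le> \<rho> \<omega>" if "\<omega> \<in> space M" for \<omega>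
    by (rule LIMSEQ_le_const[OF lim[OF that]]) (use ST_nonneg[OF \<sigma> that] in auto)
  have le: "\<rho> \<omega> \<le> \<sigma> n \<omega>" if "\<omega> \<in> space M" for \<omega> n
    using decseq_ge[OF dec lim] that by blast
  show "AE \<omega> in M. \<rho> \<omega> \<le> T"
    using ST_AE_le[OF \<sigma>, of 0] AE_space by eventually_elim (use le[of _ 0] in force)
  fix t :: real
  have "{\<omega>\<in>space M. \<rho> \<omega> < t} = (\<Union>n. {\<omega>\<in>space M. \<sigma> n \<omega> < t})"
  proof safe
    fix \<omega> n assume "\<omega> \<in> space M" "\<sigma> n \<omega> < t"
    then show "\<rho> \<omega> < t" using le[of \<omega> n] by linarith
  next
    fix \<omega> assume *: "\<omega> \<in> space M" "\<rho> \<omega> < t"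
    then obtain n where "\<sigma> n \<omega> < t"
      using order_tendstoD(2)[OF lim[OF *(1)] *(2)] by (auto simp: eventually_sequentially)
    then show "\<omega> \<in> (\<Union>n. {\<omega>\<in>space M. \<sigma> n \<omega> < t})" using * by auto
  qed
  moreover have "\<dots> \<in> sets (F t)" using ST_less_sets[OF \<sigma>] by auto
  ultimately show "{\<omega>\<in>space M. \<rho> \<omega> < t} \<in> sets (F t)" by simp
qed

text \<open>The event \<open>A\<close> is decided at time \<sigma>, and whichever alternative is
  taken comes no earlier than \<sigma>. Hence by the time an alternative has occurred, it is known
  whether it was the one chosen.\<close>

lemma ST_If:
  assumes \<sigma>: "\<sigma> \<in> ST" and A: "A \<in> sets (pre_sigma \<sigma>)" and \<rho>: "\<rho> \<in> ST" "\<rho>' \<in> ST"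
    and le: "AE \<omega> in M. \<omega> \<in> A \<longrightarrow> \<sigma> \<omega> \<le> \<rho> \<omega>" "AE \<omega> in M. \<omega> \<notin> A \<longrightarrow> \<sigma> \<omega> \<le> \<rho>' \<omega>"
  shows "(\<lambda>\<omega>. if \<omega> \<in> A then \<rho> \<omega> else \<rho>' \<omega>) \<in> ST"
proof (rule ST_I)
  show "0 \<le> (if \<omega> \<in> A then \<rho> \<omega> else \<rho>' \<omega>)" if "\<omega> \<in> space M" for \<omega>
    using ST_nonneg \<rho> that by auto
  show "AE \<omega> in M. (if \<omega> \<in> A then \<rho> \<omega> else \<rho>' \<omega>) \<le> T"
    using ST_AE_le[OF \<rho>(1)] ST_AE_le[OF \<rho>(2)] by eventually_elim simp
  fix t :: real assume t: "0 \<le> t"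
  have A1: "{\<omega>\<in>A. \<sigma> \<omega> \<le> t} \<in> sets (F t)"
    by (rule sets_pre_sigmaD[OF ST_stopping_time[OF \<sigma>] A])
  have "space M - A \<in> sets (pre_sigma \<sigma>)" using A sets.compl_sets[OF A] by (simp add: space_pre_sigma)
  then have A2: "{\<omega>\<in>space M - A. \<sigma> \<omega> \<le> t} \<in> sets (F t)"
    by (rule sets_pre_sigmaD[OF ST_stopping_time[OF \<sigma>]])
  have AM: "A \<subseteq> space M" using sets.sets_into_space[OF A] by (simp add: space_pre_sigma)
  let ?B = "({\<omega>\<in>A. \<sigma> \<omega> \<le> t} \<inter> {\<omega>\<in>space M. \<rho> \<omega> \<le> t}) \<union>
            ({\<omega>\<in>space M - A. \<sigma> \<omega> \<le> t} \<inter> {\<omega>\<in>space M. \<rho>' \<omega> \<le> t})"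
  have "?B \<in> sets (F t)" using A1 A2 ST_le_sets[OF \<rho>(1)] ST_le_sets[OF \<rho>(2)] by auto
  then show "{\<omega>\<in>space M. (if \<omega> \<in> A then \<rho> \<omega> else \<rho>' \<omega>) \<le> t} \<in> sets (F t)"
  proof (rule sets_F_AE[OF _ t])
    show "AE \<omega> in M. \<omega> \<in> ?B \<longleftrightarrow> \<omega> \<in> {\<omega>\<in>space M. (if \<omega> \<in> A then \<rho> \<omega> else \<rho>' \<omega>) \<le> t}"
      using le AE_space by eventually_elim (use AM in auto)
  qed auto
qed

lemma pre_sigma_less: "\<sigma> \<in> ST \<Longrightarrow> \<kappa> \<in> ST \<Longrightarrow> {\<omega>\<in>space M. \<sigma> \<omega> < \<kappa> \<omega>} \<in> sets (pre_sigma \<sigma>)"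
  using stopping_time_less[OF ST_stopping_time ST_stopping_time] by (auto simp: pred_def space_pre_sigma)

lemma ST_If_less:
  assumes \<sigma>: "\<sigma> \<in> ST" and \<kappa>: "\<kappa> \<in> ST" and \<rho>: "\<rho> \<in> ST" "\<rho>' \<in> ST"
    and le: "AE \<omega> in M. \<sigma> \<omega> < \<kappa> \<omega> \<longrightarrow> \<sigma> \<omega> \<le> \<rho> \<omega>" "AE \<omega> in M. \<not> \<sigma> \<omega> < \<kappa> \<omega> \<longrightarrow> \<sigma> \<omega> \<le> \<rho>' \<omega>"
  shows "(\<lambda>\<omega>. if \<sigma> \<omega> < \<kappa> \<omega> then \<rho> \<omega> else \<rho>' \<omega>) \<in> ST"
proof -
  have "(\<lambda>\<omega>. if \<omega> \<in> {\<omega>\<in>space M. \<sigma> \<omega> < \<kappa> \<omega>} then \<rho> \<omega> else \<rho>' \<omega>) \<in> ST"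
    by (rule ST_If[OF \<sigma> pre_sigma_less[OF \<sigma> \<kappa>] \<rho>]) (use le AE_space in \<open>auto elim: eventually_elim2\<close>)
  then show ?thesis
    by (rule ST_cong_AE) (use \<rho> ST_nonneg in auto)
qed

text \<open>Selecting a stopping time separately on each slice {\<sigma> = t} is admissible because
  \<open>\<nu> t\<close> comes almost surely no earlier than \<open>t\<close>: if it has occurred by
  \<open>s\<close>, then t \<le> s and the slice belongs to \<open>F s\<close>. Finitely many slices
  keep the union measurable.\<close>

lemma ST_paste_simple:
  assumes \<sigma>: "\<sigma> \<in> ST" and R: "finite R" "R \<subseteq> {0..T}" "\<And>\<omega>. \<omega> \<in> space M \<Longrightarrow> \<sigma> \<omega> \<in> R"
    and \<nu>: "\<And>t. t \<in> R \<Longrightarrow> \<nu> t \<in> stopping_times M F T (\<lambda>_. t)"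
  shows "(\<lambda>\<omega>. \<nu> (\<sigma> \<omega>) \<omega>) \<in> ST"
proof (rule ST_I)
  have AE\<nu>: "AE \<omega> in M. \<forall>t\<in>R. t \<le> \<nu> t \<omega> \<and> \<nu> t \<omega> \<le> T"
    by (rule AE_finite_allI[OF R(1)]) (use \<nu> in \<open>auto simp: stopping_times_def\<close>)
  have \<nu>ST: "\<nu> t \<in> ST" if "t \<in> R" for t
    using \<nu>[OF that] R(2) that by (auto simp: stopping_times_def elim: eventually_mono)
  show "0 \<le> \<nu> (\<sigma> \<omega>) \<omega>" if "\<omega> \<in> space M" for \<omega>
    using ST_nonneg[OF \<nu>ST[OF R(3)[OF that]] that] .
  show "AE \<omega> in M. \<nu> (\<sigma> \<omega>) \<omega> \<le> T"
    using AE\<nu> AE_space by eventually_elim (use R(3) in auto)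
  fix s :: real assume s: "0 \<le> s"
  let ?B = "\<Union>t\<in>R \<inter> {..s}. {\<omega>\<in>space M. \<sigma> \<omega> = t} \<inter> {\<omega>\<in>space M. \<nu> t \<omega> \<le> s}"
  have "{\<omega>\<in>space M. \<sigma> \<omega> = t} \<in> sets (F s)" if "t \<le> s" for t
    using stopping_time_eq_const[OF ST_stopping_time[OF \<sigma>], of t] sets_F_mono[OF that]
    by (auto simp: pred_def space_F)
  then have "?B \<in> sets (F s)" using R(1) ST_le_sets[OF \<nu>ST] by auto
  then show "{\<omega>\<in>space M. \<nu> (\<sigma> \<omega>) \<omega> \<le> s} \<in> sets (F s)"
  proof (rule sets_F_AE[OF _ s])
    show "AE \<omega> in M. \<omega> \<in> ?B \<longleftrightarrow> \<omega> \<in> {\<omega>\<in>space M. \<nu> (\<sigma> \<omega>) \<omega> \<le> s}"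
      using AE\<nu> AE_space by eventually_elim (use R(3) in force)
  qed auto
qed

section \<open>Approximation of stopping times from above by finitely many values\<close>

definition grid_time :: "nat \<Rightarrow> ('a \<Rightarrow> real) \<Rightarrow> 'a \<Rightarrow> real" where
  "grid_time n \<sigma> \<omega> = min T (real_of_int \<lceil>real (Suc n) * \<sigma> \<omega>\<rceil> / real (Suc n))"

lemma grid_ceiling_nonneg:
  fixes x :: real
  assumes "0 \<le> x"
  shows "- 1 < real (Suc n) * x"
proof -
  have "0 \<le> real (Suc n) * x" using assms by (intro mult_nonneg_nonneg of_nat_0_le_iff)
  then show ?thesis by (rule less_le_trans[rotated]) simp
qed

lemma grid_time_ST:
  assumes \<sigma>: "\<sigma> \<in> ST"
  shows "grid_time n \<sigma> \<in> ST"
proof (rule ST_I)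
  show "0 \<le> grid_time n \<sigma> \<omega>" if "\<omega> \<in> space M" for \<omega>
    using ST_nonneg[OF \<sigma> that] T_pos unfolding grid_time_def
    using grid_ceiling_nonneg[OF ST_nonneg[OF \<sigma> that], of n]
    by (auto intro!: divide_nonneg_pos simp del: of_nat_Suc)
  show "AE \<omega> in M. grid_time n \<sigma> \<omega> \<le> T" by (auto simp: grid_time_def)
  fix t :: real assume t: "t < T"
  \<comment> \<open>The last grid point not after \<open>t\<close>. Rounding \<sigma> up gives a
    value up to \<open>t\<close> exactly when \<sigma> does not exceed this point, so the event is
    already in \<open>F s\<close>.\<close>
  define s where "s = real_of_int \<lfloor>real (Suc n) * t\<rfloor> / real (Suc n)"
  have "real_of_int \<lfloor>real (Suc n) * t\<rfloor> \<le> real (Suc n) * t" by (rule of_int_floor_le)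
  then have "s \<le> t" unfolding s_def by (simp add: divide_le_eq mult.commute del: of_nat_Suc)
  have "grid_time n \<sigma> \<omega> \<le> t \<longleftrightarrow> \<sigma> \<omega> \<le> s" for \<omega>
  proof -
    have "grid_time n \<sigma> \<omega> \<le> t \<longleftrightarrow> real_of_int \<lceil>real (Suc n) * \<sigma> \<omega>\<rceil> \<le> real (Suc n) * t"
      using t unfolding grid_time_def min_le_iff_disj
      by (auto simp: divide_le_eq mult.commute simp del: of_nat_Suc)
    also have "\<dots> \<longleftrightarrow> \<lceil>real (Suc n) * \<sigma> \<omega>\<rceil> \<le> \<lfloor>real (Suc n) * t\<rfloor>" by (simp only: le_floor_iff)
    also have "\<dots> \<longleftrightarrow> real (Suc n) * \<sigma> \<omega> \<le> real_of_int \<lfloor>real (Suc n) * t\<rfloor>" by (simp only: ceiling_le_iff)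
    also have "\<dots> \<longleftrightarrow> \<sigma> \<omega> \<le> s" unfolding s_def by (simp add: le_divide_eq mult.commute del: of_nat_Suc)
    finally show ?thesis .
  qed
  then have "{\<omega>\<in>space M. grid_time n \<sigma> \<omega> \<le> t} = {\<omega>\<in>space M. \<sigma> \<omega> \<le> s}" by simp
  also have "\<dots> \<in> sets (F t)" using ST_le_sets[OF \<sigma>, of s] sets_F_mono[OF \<open>s \<le> t\<close>] by auto
  finally show "{\<omega>\<in>space M. grid_time n \<sigma> \<omega> \<le> t} \<in> sets (F t)" .
qed

lemma grid_time_le: "grid_time n \<sigma> \<omega> \<le> T"
  by (simp add: grid_time_def)

lemma grid_time_ge:
  assumes "\<sigma> \<omega> \<le> T"
  shows "\<sigma> \<omega> \<le> grid_time n \<sigma> \<omega>"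
proof -
  have "real (Suc n) * \<sigma> \<omega> \<le> real_of_int \<lceil>real (Suc n) * \<sigma> \<omega>\<rceil>" by (rule le_of_int_ceiling)
  then have "\<sigma> \<omega> \<le> real_of_int \<lceil>real (Suc n) * \<sigma> \<omega>\<rceil> / real (Suc n)"
    by (simp add: le_divide_eq mult.commute del: of_nat_Suc)
  then show ?thesis using assms by (simp add: grid_time_def)
qed

lemma grid_time_LIMSEQ:
  assumes "\<sigma> \<omega> \<le> T"
  shows "(\<lambda>n. grid_time n \<sigma> \<omega>) \<longlonglongrightarrow> \<sigma> \<omega>"
proof (rule tendsto_sandwich[of "\<lambda>_. \<sigma> \<omega>" _ _ "\<lambda>n. \<sigma> \<omega> + inverse (real (Suc n))"])
  have "grid_time n \<sigma> \<omega> \<le> \<sigma> \<omega> + inverse (real (Suc n))" for n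
  proof -
    have "real_of_int \<lceil>real (Suc n) * \<sigma> \<omega>\<rceil> \<le> real (Suc n) * \<sigma> \<omega> + 1" by linarith
    then have "real_of_int \<lceil>real (Suc n) * \<sigma> \<omega>\<rceil> / real (Suc n) \<le> (real (Suc n) * \<sigma> \<omega> + 1) / real (Suc n)"
      by (intro divide_right_mono) auto
    also have "\<dots> = \<sigma> \<omega> + inverse (real (Suc n))" by (simp add: field_simps)
    finally show ?thesis unfolding grid_time_def by (rule min.coboundedI2)
  qed
  then show "\<forall>\<^sub>F n in sequentially. grid_time n \<sigma> \<omega> \<le> \<sigma> \<omega> + inverse (real (Suc n))" by simp
  show "(\<lambda>n. \<sigma> \<omega> + inverse (real (Suc n))) \<longlonglongrightarrow> \<sigma> \<omega>"
    using tendsto_add[OF tendsto_const[of "\<sigma> \<omega>"] LIMSEQ_inverse_real_of_nat] by simp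
qed (use grid_time_ge[of \<sigma> \<omega>] assms in auto)

lemma grid_time_simple:
  obtains R where "finite R" "R \<subseteq> {0..T}"
    "\<And>\<sigma> \<omega>. 0 \<le> \<sigma> \<omega> \<Longrightarrow> grid_time n \<sigma> \<omega> \<in> R"
proof
  let ?g = "\<lambda>k. min T (real_of_int k / real (Suc n))"
  let ?R = "?g ` {0..\<lceil>real (Suc n) * T\<rceil>}"
  show "finite ?R" by simp
  show "?R \<subseteq> {0..T}" using T_pos by (auto simp del: of_nat_Suc)
  show "grid_time n \<sigma> \<omega> \<in> ?R" if "0 \<le> \<sigma> \<omega>" for \<sigma> :: "'a \<Rightarrow> real" and \<omega>
  proof (cases "\<sigma> \<omega> \<le> T")
    case True
    then have "\<lceil>real (Suc n) * \<sigma> \<omega>\<rceil> \<in> {0..\<lceil>real (Suc n) * T\<rceil>}"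
      using grid_ceiling_nonneg[OF that, of n]
      by (auto intro!: ceiling_mono mult_left_mono simp del: of_nat_Suc)
    then show ?thesis unfolding grid_time_def by (rule imageI)
  next
    case False
    have *: "real (Suc n) * x \<le> real_of_int \<lceil>real (Suc n) * x\<rceil>" for x by (rule le_of_int_ceiling)
    have "x \<le> real_of_int \<lceil>real (Suc n) * x\<rceil> / real (Suc n)" for x
      using *[of x] by (simp add: le_divide_eq mult.commute del: of_nat_Suc)
    from this[of "\<sigma> \<omega>"] this[of T] False
    have "grid_time n \<sigma> \<omega> = ?g \<lceil>real (Suc n) * T\<rceil>" unfolding grid_time_def by simp
    moreover have "\<lceil>real (Suc n) * T\<rceil> \<in> {0..\<lceil>real (Suc n) * T\<rceil>}"
      using grid_ceiling_nonneg[of T n] T_pos by (auto simp del: of_nat_Suc)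
    ultimately show ?thesis by blast
  qed
qed

text \<open>One null set serves all sequences and all limit points, which makes the statement
  applicable to random times. The sequence may hit its limit, unlike in \<open>at_right\<close>; at
  \<open>t = T\<close> it is constant, so nothing is asked of the path there.\<close>

lemma right_continuous_paths_LIMSEQ:
  assumes "right_continuous_paths M T Z"
  shows "AE \<omega> in M. \<forall>s t. 0 \<le> t \<longrightarrow> (\<forall>n. t \<le> s n \<and> s n \<le> T) \<longrightarrow> s \<longlonglongrightarrow> t \<longrightarrow> (\<lambda>n::nat. Z (s n) \<omega>) \<longlonglongrightarrow> Z t \<omega>"
  using assms unfolding right_continuous_paths_def
proof eventually_elim
  case (elim \<omega>)
  show ?case
  proof (intro allI impI)
    fix s :: "nat \<Rightarrow> real" and t assume t: "0 \<le> t" and s: "\<forall>n. t \<le> s n \<and> s n \<le> T" and lim: "s \<longlonglongrightarrow> t"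
    show "(\<lambda>n. Z (s n) \<omega>) \<longlonglongrightarrow> Z t \<omega>"
    proof (cases "t < T")
      case False
      then have "s n = t" for n using s by (metis linorder_not_less order_antisym order_trans)
      then show ?thesis by simp
    next
      case True
      then have "((\<lambda>s. Z s \<omega>) \<longlongrightarrow> Z t \<omega>) (at_right t)" using elim t by blast
      then have "((\<lambda>s. Z s \<omega>) \<longlongrightarrow> Z t \<omega>) (at t within {t..})"
        by (simp add: at_within_Ici_at_right)
      then have "continuous (at t within {t..}) (\<lambda>s. Z s \<omega>)" by (simp add: continuous_within)
      then show ?thesis using lim s unfolding continuous_within_sequentially by (auto simp: comp_def)
    qed
  qed
qed

end

section \<open>Optimal stopping\<close>

text \<open>\<open>U_left\<close> is the form in which the condition on predictable jumps enters. It
  speaks of sequences of stopping times and not of single paths, since a path of \<open>U\<close>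
  may well jump downwards at times that no increasing sequence of stopping times announces.\<close>

locale optimal_stopping = dynkin_setting M F T
  for M :: "'a measure" and F T +
  fixes U W :: "real \<Rightarrow> 'a \<Rightarrow> real"
  assumes U_adapted: "\<And>t. 0 \<le> t \<Longrightarrow> t \<le> T \<Longrightarrow> U t \<in> borel_measurable (F t)"
    and U_ui: "ui_family M ((\<lambda>\<nu> \<omega>. U (\<nu> \<omega>) \<omega>) ` ST)"
    and U_rc: "right_continuous_paths M T U"
    and U_left: "\<And>\<sigma> \<rho>. (\<And>n. \<sigma> n \<in> ST) \<Longrightarrow> (\<And>\<omega>. \<omega> \<in> space M \<Longrightarrow> incseq (\<lambda>n. \<sigma> n \<omega>)) \<Longrightarrow>
      (\<And>\<omega>. \<omega> \<in> space M \<Longrightarrow> (\<lambda>n. \<sigma> n \<omega>) \<longlonglongrightarrow> \<rho> \<omega>) \<Longrightarrow>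
      AE \<omega> in M. \<exists>L. (\<lambda>n::nat. U (\<sigma> n \<omega>) \<omega>) \<longlonglongrightarrow> L \<and> L \<le> U (\<rho> \<omega>) \<omega>"
    and snell: "snell_envelope M F T U W"
begin

section \<open>The Snell envelope at fixed times\<close>

lemma U_integrable: "\<nu> \<in> ST \<Longrightarrow> integrable M (\<lambda>\<omega>. U (\<nu> \<omega>) \<omega>)"
  by (rule ui_familyD[OF U_ui]) auto

lemma U_bdd: "bdd_above (mean_at U ` ST)"
proof -
  obtain C where C: "\<And>f. f \<in> (\<lambda>\<nu> \<omega>. U (\<nu> \<omega>) \<omega>) ` ST \<Longrightarrow> (\<integral>\<omega>. \<bar>f \<omega>\<bar> \<partial>M) \<le> C"
    using ui_family_bounded[OF U_ui] by blast
  show ?thesis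
  proof (rule bdd_aboveI2)
    fix \<nu> assume \<nu>: "\<nu> \<in> ST"
    have "mean_at U \<nu> \<le> (\<integral>\<omega>. \<bar>U (\<nu> \<omega>) \<omega>\<bar> \<partial>M)"
      by (intro integral_mono integrable_abs U_integrable \<nu>) auto
    also have "\<dots> \<le> C" by (rule C) (use \<nu> in auto)
    finally show "mean_at U \<nu> \<le> C" .
  qed
qed

lemma ST_from: "0 \<le> t \<Longrightarrow> \<nu> \<in> STs t \<Longrightarrow> \<nu> \<in> ST"
  by (auto simp: stopping_times_def elim: eventually_mono)

lemma W_rc: "right_continuous_paths M T W"
  using snell by (auto simp: snell_envelope_def rcll_paths_def)

lemma W_adapted: "0 \<le> t \<Longrightarrow> t \<le> T \<Longrightarrow> W t \<in> borel_measurable (F t)"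
  using snell by (auto simp: snell_envelope_def)

lemma W_ess_sup:
  "0 \<le> t \<Longrightarrow> t \<le> T \<Longrightarrow> is_ess_sup M
     {real_cond_exp M (F t) (\<lambda>\<omega>. U (\<nu> \<omega>) \<omega>) | \<nu>. \<nu> \<in> STs t} (W t)"
  using snell by (auto simp: snell_envelope_def)

lemma cond_exp_le_W:
  assumes "0 \<le> t" "t \<le> T" "\<nu> \<in> STs t"
  shows "AE \<omega> in M. real_cond_exp M (F t) (\<lambda>\<omega>. U (\<nu> \<omega>) \<omega>) \<omega> \<le> W t \<omega>"
  using W_ess_sup[OF assms(1,2)] assms(3) unfolding is_ess_sup_def by blast

lemma pre_sigma_const: "B \<in> sets (F t) \<Longrightarrow> B \<in> sets (pre_sigma (\<lambda>_. t))"
proof (rule sets_pre_sigmaI[OF stopping_time_const])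
  fix s assume B: "B \<in> sets (F t)"
  show "{\<omega>\<in>B. t \<le> s} \<in> sets (F s)"
    using B sets_F_mono[of t s] by (cases "t \<le> s") auto
qed

text \<open>Paste the two stopping times along the event on which the first one does better.\<close>

lemma cond_exp_directed:
  assumes t: "0 \<le> t" "t \<le> T"
    and \<nu>: "\<nu> \<in> STs t" "\<nu>' \<in> STs t"
  defines "E \<equiv> \<lambda>\<nu>. real_cond_exp M (F t) (\<lambda>\<omega>. U (\<nu> \<omega>) \<omega>)"
  shows "\<exists>\<rho>\<in>STs t. AE \<omega> in M. E \<rho> \<omega> = max (E \<nu> \<omega>) (E \<nu>' \<omega>)"
proof -
  interpret Ft: finite_measure_subalgebra M "F t"
    by standard (rule subalgebra_F)
  define B where "B = {\<omega>\<in>space (F t). E \<nu>' \<omega> \<le> E \<nu> \<omega>}"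
  have [measurable]: "E \<nu> \<in> borel_measurable (F t)" for \<nu> by (simp add: E_def)
  have B[measurable]: "B \<in> sets (F t)" unfolding B_def by measurable
  have [measurable]: "B \<in> sets M" using B by (rule sets_F_subset)
  define \<rho> where "\<rho> \<omega> = (if \<omega> \<in> B then \<nu> \<omega> else \<nu>' \<omega>)" for \<omega>
  have ST: "\<nu> \<in> ST" "\<nu>' \<in> ST" using \<nu> t by (auto intro: ST_from)
  have int: "integrable M (\<lambda>\<omega>. U (\<nu> \<omega>) \<omega>)" "integrable M (\<lambda>\<omega>. U (\<nu>' \<omega>) \<omega>)"
    using ST by (auto intro: U_integrable)
  have "\<rho> \<in> ST" unfolding \<rho>_def
    by (rule ST_If[OF ST_const[OF t] pre_sigma_const[OF B] ST])
       (use \<nu> in \<open>auto simp: stopping_times_def elim: eventually_mono\<close>)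
  moreover have "AE \<omega> in M. t \<le> \<rho> \<omega> \<and> \<rho> \<omega> \<le> T"
  proof -
    have "AE \<omega> in M. t \<le> \<nu> \<omega> \<and> \<nu> \<omega> \<le> T" "AE \<omega> in M. t \<le> \<nu>' \<omega> \<and> \<nu>' \<omega> \<le> T"
      using \<nu> by (auto simp: stopping_times_def)
    then show ?thesis by eventually_elim (simp add: \<rho>_def)
  qed
  ultimately have \<rho>: "\<rho> \<in> STs t" by (auto simp: stopping_times_def)
  let ?f = "\<lambda>\<omega>. indicator B \<omega> * U (\<nu> \<omega>) \<omega>"
  let ?g = "\<lambda>\<omega>. indicator (space M - B) \<omega> * U (\<nu>' \<omega>) \<omega>"
  have intf: "integrable M ?f" using integrable_mult_indicator[OF \<open>B \<in> sets M\<close> int(1)] by simp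
  have intg: "integrable M ?g" using integrable_mult_indicator[OF _ int(2), of "space M - B"] by simp
  have CB: "space M - B \<in> sets (F t)" using sets.compl_sets[OF B] by (simp add: space_F)
  have "AE \<omega> in M. E \<rho> \<omega> = real_cond_exp M (F t) (\<lambda>\<omega>. ?f \<omega> + ?g \<omega>) \<omega>"
    unfolding E_def
  proof (rule Ft.real_cond_exp_cong)
    show "AE \<omega> in M. U (\<rho> \<omega>) \<omega> = ?f \<omega> + ?g \<omega>"
      using AE_space by eventually_elim (auto simp: \<rho>_def indicator_def)
    show "(\<lambda>\<omega>. U (\<rho> \<omega>) \<omega>) \<in> borel_measurable M"
      using U_integrable[OF ST_from[OF t(1) \<rho>]] by (rule borel_measurable_integrable)
    show "(\<lambda>\<omega>. ?f \<omega> + ?g \<omega>) \<in> borel_measurable M"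
      using intf intg by (intro borel_measurable_add borel_measurable_integrable)
  qed
  moreover have "AE \<omega> in M. real_cond_exp M (F t) (\<lambda>\<omega>. ?f \<omega> + ?g \<omega>) \<omega>
      = real_cond_exp M (F t) ?f \<omega> + real_cond_exp M (F t) ?g \<omega>"
    by (rule Ft.real_cond_exp_add[OF intf intg])
  moreover have "AE \<omega> in M. real_cond_exp M (F t) ?f \<omega> = indicator B \<omega> * E \<nu> \<omega>"
    unfolding E_def by (rule Ft.real_cond_exp_mult) (use int intf B in auto)
  moreover have "AE \<omega> in M. real_cond_exp M (F t) ?g \<omega> = indicator (space M - B) \<omega> * E \<nu>' \<omega>"
    unfolding E_def by (rule Ft.real_cond_exp_mult) (use int intg CB in auto)
  ultimately have "AE \<omega> in M. E \<rho> \<omega> = max (E \<nu> \<omega>) (E \<nu>' \<omega>)"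
    using AE_space by eventually_elim (auto simp: B_def space_F indicator_def)
  with \<rho> show ?thesis by blast
qed

text \<open>The conditional expectations of the rewards are closed under maxima, so running maxima
  of a sequence whose means approach the supremum \<open>m\<close> increase to some limit
  \<open>h\<close>. No conditional expectation exceeds \<open>h\<close>, as otherwise pasting would
  push a mean beyond \<open>m\<close>; so minimality of the essential supremum gives
  \<open>W t = h\<close> almost surely. The approximation is stated for means over events of
  \<open>F t\<close>, the form needed for slices of stopping times.\<close>

lemma W_approx:
  assumes t: "0 \<le> t" "t \<le> T"
  shows "integrable M (W t)"
    and "\<exists>b. (\<forall>k. b k \<in> STs t) \<and>
      (\<forall>B\<in>sets (F t). (\<lambda>k::nat. mean_on B U (b k)) \<longlonglongrightarrow> (\<integral>\<omega>. W t \<omega> * indicator B \<omega> \<partial>M))"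
proof -
  interpret Ft: finite_measure_subalgebra M "F t"
    by standard (rule subalgebra_F)
  define E where "E \<nu> = real_cond_exp M (F t) (\<lambda>\<omega>. U (\<nu> \<omega>) \<omega>)" for \<nu>
  have int: "integrable M (\<lambda>\<omega>. U (\<nu> \<omega>) \<omega>)" if "\<nu> \<in> STs t" for \<nu>
    using that t by (auto intro: U_integrable ST_from)
  have E_int[simp]: "integrable M (E \<nu>)" if "\<nu> \<in> STs t" for \<nu>
    unfolding E_def by (rule Ft.real_cond_exp_int(1)[OF int[OF that]])
  have E_integral: "(\<integral>\<omega>. E \<nu> \<omega> \<partial>M) = mean_at U \<nu>" if "\<nu> \<in> STs t" for \<nu>
    unfolding E_def by (rule Ft.real_cond_exp_int(2)[OF int[OF that]])
  have [measurable]: "E \<nu> \<in> borel_measurable M" for \<nu> by (simp add: E_def)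
  have "\<forall>\<nu>\<in>STs t. \<forall>\<nu>'\<in>STs t. \<exists>\<rho>. \<rho> \<in> STs t \<and> (AE \<omega> in M. E \<rho> \<omega> = max (E \<nu> \<omega>) (E \<nu>' \<omega>))"
    using cond_exp_directed[OF t] unfolding E_def by blast
  then obtain p where p: "\<And>\<nu> \<nu>'. \<nu> \<in> STs t \<Longrightarrow> \<nu>' \<in> STs t \<Longrightarrow> p \<nu> \<nu>' \<in> STs t"
    "\<And>\<nu> \<nu>'. \<nu> \<in> STs t \<Longrightarrow> \<nu>' \<in> STs t \<Longrightarrow> AE \<omega> in M. E (p \<nu> \<nu>') \<omega> = max (E \<nu> \<omega>) (E \<nu>' \<omega>)"
    unfolding Bex_def[symmetric] by metis
  define m where "m = (SUP \<nu>\<in>STs t. \<integral>\<omega>. E \<nu> \<omega> \<partial>M)"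
  have tS: "(\<lambda>_. t) \<in> STs t" using t by (auto simp: stopping_times_def stopping_time_const)
  have bdd: "bdd_above ((\<lambda>\<nu>. \<integral>\<omega>. E \<nu> \<omega> \<partial>M) ` STs t)"
    by (rule bdd_above_mono[OF U_bdd]) (use E_integral ST_from[OF t(1)] in auto)
  have le_m: "(\<integral>\<omega>. E \<nu> \<omega> \<partial>M) \<le> m" if "\<nu> \<in> STs t" for \<nu>
    unfolding m_def by (rule cSUP_upper[OF that bdd])
  have "\<exists>\<nu>\<in>STs t. m - inverse (real (Suc k)) < (\<integral>\<omega>. E \<nu> \<omega> \<partial>M)" for k
  proof -
    have "m - inverse (real (Suc k)) < m" by simp
    then show ?thesis unfolding m_def using less_cSUP_iff[OF _ bdd] tS by blast
  qed
  then obtain a where a: "\<And>k. a k \<in> STs t" "\<And>k. m - inverse (real (Suc k)) < (\<integral>\<omega>. E (a k) \<omega> \<partial>M)"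
    by metis
  define b where "b = rec_nat (a 0) (\<lambda>k \<nu>. p \<nu> (a (Suc k)))"
  have b0: "b 0 = a 0" and bS: "b (Suc k) = p (b k) (a (Suc k))" for k by (simp_all add: b_def)
  have b: "b k \<in> STs t" for k by (induction k) (simp_all add: b0 bS a p)
  have AE1: "AE \<omega> in M. \<forall>k. E (b (Suc k)) \<omega> = max (E (b k) \<omega>) (E (a (Suc k)) \<omega>)"
    unfolding AE_all_countable bS using p(2) a b by blast
  have inc: "AE \<omega> in M. incseq (\<lambda>k. E (b k) \<omega>)"
    using AE1 by eventually_elim (auto intro!: incseq_SucI)
  have ab: "AE \<omega> in M. E (a k) \<omega> \<le> E (b k) \<omega>" for k
    using AE1 by eventually_elim (cases k, auto simp: b0)
  have Eb: "m - inverse (real (Suc k)) < (\<integral>\<omega>. E (b k) \<omega> \<partial>M)" for k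
    using a(2)[of k] integral_mono_AE[OF E_int[OF a(1)] E_int[OF b] ab, of k] by linarith
  have Wm[measurable]: "W t \<in> borel_measurable M" using W_adapted[OF t] by (rule borel_measurable_F)
  have AEW: "AE \<omega> in M. \<forall>k. E (b k) \<omega> \<le> W t \<omega>"
    unfolding AE_all_countable using cond_exp_le_W[OF t b] by (simp add: E_def)
  define h where "h \<omega> = lim (\<lambda>k. E (b k) \<omega>)" for \<omega>
  have [measurable]: "h \<in> borel_measurable M" unfolding h_def by measurable
  have hlim: "AE \<omega> in M. (\<lambda>k. E (b k) \<omega>) \<longlonglongrightarrow> h \<omega>"
    using inc AEW
  proof eventually_elim
    case (elim \<omega>)
    then obtain L where "(\<lambda>k. E (b k) \<omega>) \<longlonglongrightarrow> L" using incseq_convergent by blast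
    then show ?case unfolding h_def using limI by force
  qed
  have hW: "AE \<omega> in M. h \<omega> \<le> W t \<omega>"
    using hlim AEW by eventually_elim (rule LIMSEQ_le_const2, auto)
  have bh: "AE \<omega> in M. \<forall>k. E (b k) \<omega> \<le> h \<omega>"
    using hlim inc by eventually_elim (auto intro: incseq_le)
  have Eh: "AE \<omega> in M. E \<nu> \<omega> \<le> h \<omega>" if \<nu>: "\<nu> \<in> STs t" for \<nu>
  proof -
    \<comment> \<open>The part of \<open>E \<nu>\<close> above \<open>h\<close> is bounded in mean
      by the gain from pasting \<nu> with \<open>b k\<close>, which is at most
      \<open>1/(k+1)\<close> because \<open>b k\<close> already comes that close to
      \<open>m\<close>. Its integrability rests on \<open>E (b 0) \<le> h\<close>, as
      \<open>h\<close> itself is not yet known to be integrable.\<close>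
    let ?f = "\<lambda>\<omega>. max 0 (E \<nu> \<omega> - h \<omega>)"
    have fint: "integrable M ?f"
    proof (rule Bochner_Integration.integrable_bound)
      show "integrable M (\<lambda>\<omega>. max 0 (E \<nu> \<omega> - E (b 0) \<omega>))" using \<nu> b by auto
      show "AE \<omega> in M. norm (?f \<omega>) \<le> norm (max 0 (E \<nu> \<omega> - E (b 0) \<omega>))"
        using bh by eventually_elim (drule spec[of _ 0], auto)
    qed measurable
    have "(\<integral>\<omega>. ?f \<omega> \<partial>M) \<le> inverse (real (Suc k))" for k
    proof -
      obtain \<rho> where \<rho>: "\<rho> \<in> STs t" "AE \<omega> in M. E \<rho> \<omega> = max (E \<nu> \<omega>) (E (b k) \<omega>)" using p[OF \<nu> b] by blast
      have "(\<integral>\<omega>. ?f \<omega> \<partial>M) \<le> (\<integral>\<omega>. E \<rho> \<omega> - E (b k) \<omega> \<partial>M)"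
      proof (rule integral_mono_AE[OF fint])
        show "AE \<omega> in M. ?f \<omega> \<le> E \<rho> \<omega> - E (b k) \<omega>"
          using bh \<rho>(2) by eventually_elim (drule spec[of _ k], auto)
      qed (use \<rho> b in auto)
      also have "\<dots> = (\<integral>\<omega>. E \<rho> \<omega> \<partial>M) - (\<integral>\<omega>. E (b k) \<omega> \<partial>M)"
        by (rule Bochner_Integration.integral_diff) (use \<rho> b in auto)
      finally show ?thesis using Eb[of k] le_m[OF \<rho>(1)] by linarith
    qed
    then have "(\<integral>\<omega>. ?f \<omega> \<partial>M) \<le> 0" by (intro LIMSEQ_le_const[OF LIMSEQ_inverse_real_of_nat]) auto
    moreover have "0 \<le> (\<integral>\<omega>. ?f \<omega> \<partial>M)" by (rule Bochner_Integration.integral_nonneg) auto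
    ultimately have "AE \<omega> in M. ?f \<omega> = 0"
      using integral_nonneg_eq_0_iff_AE[OF fint] by auto
    then show ?thesis by eventually_elim (auto simp: max_def split: if_splits)
  qed
  have "AE \<omega> in M. W t \<omega> \<le> h \<omega>"
  proof -
    let ?A = "{real_cond_exp M (F t) (\<lambda>\<omega>. U (\<nu> \<omega>) \<omega>) | \<nu>. \<nu> \<in> STs t}"
    have "\<forall>f\<in>?A. AE \<omega> in M. f \<omega> \<le> h \<omega>" using Eh unfolding E_def by blast
    moreover have "h \<in> borel_measurable M" by measurable
    ultimately show ?thesis using W_ess_sup[OF t] unfolding is_ess_sup_def by blast
  qed
  with hW have Wh: "AE \<omega> in M. h \<omega> = W t \<omega>" by eventually_elim auto
  with hlim have Wlim: "AE \<omega> in M. (\<lambda>k. E (b k) \<omega>) \<longlonglongrightarrow> W t \<omega>" by eventually_elim simp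
  have intlim: "(\<lambda>k. \<integral>\<omega>. E (b k) \<omega> \<partial>M) \<longlonglongrightarrow> m"
  proof (rule tendsto_sandwich[of "\<lambda>k. m - inverse (real (Suc k))" _ _ "\<lambda>_. m"])
    show "(\<lambda>k. m - inverse (real (Suc k))) \<longlonglongrightarrow> m"
      using tendsto_diff[OF tendsto_const[of m] LIMSEQ_inverse_real_of_nat] by simp
  qed (use Eb le_m[OF b] in \<open>auto intro!: always_eventually less_imp_le\<close>)
  show Wint: "integrable M (W t)"
    by (rule integrable_monotone_convergence[of M "\<lambda>k. E (b k)"]) (use b inc Wlim intlim in auto)
  have "(\<lambda>k. mean_on B U (b k)) \<longlonglongrightarrow> (\<integral>\<omega>. W t \<omega> * indicator B \<omega> \<partial>M)"
    if B: "B \<in> sets (F t)" for B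
  proof -
    have [measurable]: "B \<in> sets M" using B by (rule sets_F_subset)
    have eq: "mean_on B U (b k) = (\<integral>\<omega>. E (b k) \<omega> * indicator B \<omega> \<partial>M)" for k
    proof -
      have "(\<integral>\<omega>. indicator B \<omega> * E (b k) \<omega> \<partial>M) = (\<integral>\<omega>. indicator B \<omega> * U (b k \<omega>) \<omega> \<partial>M)"
        unfolding E_def
      proof (rule Ft.real_cond_exp_intg(2))
        show "integrable M (\<lambda>\<omega>. indicator B \<omega> * U (b k \<omega>) \<omega>)"
          using integrable_mult_indicator[OF \<open>B \<in> sets M\<close> int[OF b]] by simp
        show "(\<lambda>\<omega>. U (b k \<omega>) \<omega>) \<in> borel_measurable M" using int[OF b] by (rule borel_measurable_integrable)
      qed (use B in simp)
      then show ?thesis by (simp add: mult.commute)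
    qed
    show ?thesis unfolding eq
    proof (rule integral_dominated_convergence[where w = "\<lambda>\<omega>. \<bar>W t \<omega>\<bar> + \<bar>E (b 0) \<omega>\<bar>"])
      show "integrable M (\<lambda>\<omega>. \<bar>W t \<omega>\<bar> + \<bar>E (b 0) \<omega>\<bar>)" using Wint b by auto
      show "AE \<omega> in M. (\<lambda>k. E (b k) \<omega> * indicator B \<omega>) \<longlonglongrightarrow> W t \<omega> * indicator B \<omega>"
        using Wlim by eventually_elim (intro tendsto_intros)
      show "AE \<omega> in M. norm (E (b k) \<omega> * indicator B \<omega>) \<le> \<bar>W t \<omega>\<bar> + \<bar>E (b 0) \<omega>\<bar>" for k
        using AEW inc
      proof eventually_elim
        case (elim \<omega>)
        have "E (b 0) \<omega> \<le> E (b k) \<omega>" using elim(2) by (simp add: incseq_def)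
        moreover have "E (b k) \<omega> \<le> W t \<omega>" using elim(1) by blast
        ultimately show ?case by (auto simp: indicator_def)
      qed
    qed measurable
  qed
  with b show "\<exists>b. (\<forall>k. b k \<in> STs t) \<and>
      (\<forall>B\<in>sets (F t). (\<lambda>k::nat. mean_on B U (b k)) \<longlonglongrightarrow> (\<integral>\<omega>. W t \<omega> * indicator B \<omega> \<partial>M))"
    by blast
qed

lemma U_le_W_on:
  assumes t: "0 \<le> t" "t \<le> T" and \<nu>: "\<nu> \<in> STs t" and B: "B \<in> sets (F t)"
  shows "mean_on B U \<nu> \<le> (\<integral>\<omega>. W t \<omega> * indicator B \<omega> \<partial>M)"
proof -
  interpret Ft: finite_measure_subalgebra M "F t"
    by standard (rule subalgebra_F)
  let ?E = "real_cond_exp M (F t) (\<lambda>\<omega>. U (\<nu> \<omega>) \<omega>)"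
  have [measurable]: "B \<in> sets M" using B by (rule sets_F_subset)
  have int: "integrable M (\<lambda>\<omega>. U (\<nu> \<omega>) \<omega>)" by (rule U_integrable[OF ST_from[OF t(1) \<nu>]])
  have iB: "integrable M (\<lambda>\<omega>. indicator B \<omega> * f \<omega>)" if "integrable M f" for f :: "'a \<Rightarrow> real"
    using integrable_mult_indicator[OF \<open>B \<in> sets M\<close> that] by simp
  have "(\<integral>\<omega>. indicator B \<omega> * U (\<nu> \<omega>) \<omega> \<partial>M) = (\<integral>\<omega>. indicator B \<omega> * ?E \<omega> \<partial>M)"
    by (rule Ft.real_cond_exp_intg(2)[symmetric]) (use B int iB[OF int] in auto)
  also have "\<dots> \<le> (\<integral>\<omega>. indicator B \<omega> * W t \<omega> \<partial>M)"
  proof (rule integral_mono_AE)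
    show "AE \<omega> in M. indicator B \<omega> * ?E \<omega> \<le> indicator B \<omega> * W t \<omega>"
      using cond_exp_le_W[OF t \<nu>] by eventually_elim (auto simp: indicator_def)
  qed (use iB Ft.real_cond_exp_int(1)[OF int] W_approx(1)[OF t] in auto)
  finally show ?thesis by (simp add: mult.commute)
qed

text \<open>At a fixed time the comparison comes from stopping there, with a null set depending on
  the time. Rational times give one null set, and right continuity of both paths extends the
  inequality to all times before \<open>T\<close>; the terminal time is added by hand because it
  cannot be approached from the right.\<close>

lemma U_le_W: "AE \<omega> in M. \<forall>t\<in>{0..T}. U t \<omega> \<le> W t \<omega>"
proof -
  have AEt: "AE \<omega> in M. U t \<omega> \<le> W t \<omega>" if t: "0 \<le> t" "t \<le> T" for t
  proof -
    interpret Ft: finite_measure_subalgebra M "F t"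
      by standard (rule subalgebra_F)
    have tS: "(\<lambda>_. t) \<in> STs t" using t by (auto simp: stopping_times_def stopping_time_const)
    have "AE \<omega> in M. real_cond_exp M (F t) (U t) \<omega> = U t \<omega>"
      by (rule Ft.real_cond_exp_F_meas) (use U_integrable[OF ST_const[OF t]] U_adapted[OF t] in auto)
    with cond_exp_le_W[OF t tS] show ?thesis by eventually_elim simp
  qed
  have "AE \<omega> in M. \<forall>q\<in>insert T (\<rat> \<inter> {0..T}). U q \<omega> \<le> W q \<omega>"
    by (rule AE_ball_countable[THEN iffD2]) (use countable_rat T_pos AEt in auto)
  then show ?thesis
    using U_rc[unfolded right_continuous_paths_def] W_rc[unfolded right_continuous_paths_def]
  proof eventually_elim
    case (elim \<omega>)
    show ?case
    proof
      fix t assume t: "t \<in> {0..T}"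
      show "U t \<omega> \<le> W t \<omega>"
      proof (cases "t = T")
        case False
        then have tT: "0 \<le> t \<and> t < T" using t by auto
        show ?thesis
        proof (rule ccontr)
          assume "\<not> U t \<omega> \<le> W t \<omega>"
          then have pos: "0 < U t \<omega> - W t \<omega>" by simp
          have "((\<lambda>s. U s \<omega> - W s \<omega>) \<longlongrightarrow> U t \<omega> - W t \<omega>) (at_right t)"
            using elim(2,3) tT by (intro tendsto_diff) auto
          then have "\<forall>\<^sub>F s in at_right t. 0 < U s \<omega> - W s \<omega>" using pos by (rule order_tendstoD)
          then obtain c where c: "c > t" "\<And>s. t < s \<Longrightarrow> s < c \<Longrightarrow> 0 < U s \<omega> - W s \<omega>"
            unfolding eventually_at_right_field by blast
          obtain q where q: "q \<in> \<rat>" "t < q" "q < min c T" using Rats_dense_in_real[of t "min c T"] c tT by auto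
          then have "U q \<omega> \<le> W q \<omega>" using elim(1) tT by auto
          with c(2)[of q] q show False by auto
        qed
      qed (use elim(1) in auto)
    qed
  qed
qed

lemma U_le_W_ST: "\<sigma> \<in> ST \<Longrightarrow> AE \<omega> in M. U (\<sigma> \<omega>) \<omega> \<le> W (\<sigma> \<omega>) \<omega>"
  using U_le_W ST_AE_range[of \<sigma>] by (auto elim: eventually_elim2)

section \<open>The Snell envelope at finitely valued stopping times\<close>

definition simple_ST :: "('a \<Rightarrow> real) \<Rightarrow> bool" where
  "simple_ST \<sigma> \<longleftrightarrow> \<sigma> \<in> ST \<and> (\<exists>R. finite R \<and> R \<subseteq> {0..T} \<and> (\<forall>\<omega>\<in>space M. \<sigma> \<omega> \<in> R))"

lemma simple_grid_time: "\<sigma> \<in> ST \<Longrightarrow> simple_ST (grid_time n \<sigma>)"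
  unfolding simple_ST_def using grid_time_ST grid_time_simple[of n] ST_nonneg by metis

lemma pre_sigma_slice:
  assumes "\<sigma> \<in> ST" "A \<in> sets (pre_sigma \<sigma>)"
  shows "{\<omega>\<in>A. \<sigma> \<omega> = t} \<in> sets (F t)"
proof -
  have "{\<omega>\<in>space M. \<sigma> \<omega> = t} \<in> sets (F t)"
    using stopping_time_eq_const[OF ST_stopping_time[OF assms(1)]] by (simp add: pred_def space_F)
  then have "{\<omega>\<in>A. \<sigma> \<omega> \<le> t} \<inter> {\<omega>\<in>space M. \<sigma> \<omega> = t} \<in> sets (F t)"
    using sets_pre_sigmaD[OF ST_stopping_time[OF assms(1)] assms(2)] by blast
  moreover have "A \<subseteq> space M" using sets.sets_into_space[OF assms(2)] by (simp add: space_pre_sigma)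
  then have "{\<omega>\<in>A. \<sigma> \<omega> \<le> t} \<inter> {\<omega>\<in>space M. \<sigma> \<omega> = t} = {\<omega>\<in>A. \<sigma> \<omega> = t}" by auto
  ultimately show ?thesis by simp
qed

lemma sum_slices:
  fixes f :: "real \<Rightarrow> real"
  assumes "finite R" "\<sigma> \<omega> \<in> R"
  shows "f (\<sigma> \<omega>) * indicator A \<omega> = (\<Sum>t\<in>R. f t * indicator {\<omega>\<in>A. \<sigma> \<omega> = t} \<omega>)"
proof -
  have "(\<Sum>t\<in>R. f t * indicator {\<omega>\<in>A. \<sigma> \<omega> = t} \<omega>) = (\<Sum>t\<in>R. if t = \<sigma> \<omega> then f t * indicator A \<omega> else 0)"
    by (rule sum.cong) (auto simp: indicator_def)
  then show ?thesis using assms by simp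
qed

text \<open>Each slice {\<sigma> = t} lies in \<open>F t\<close>, so the facts at fixed times apply
  slice by slice and add up over the finitely many values. The second claim says that
  \<open>W\<close> is approximated by rewards, the third that it dominates them.\<close>

lemma simple_W:
  assumes "simple_ST \<sigma>"
  shows "integrable M (\<lambda>\<omega>. W (\<sigma> \<omega>) \<omega>)"
    and "A \<in> sets (pre_sigma \<sigma>) \<Longrightarrow> \<exists>b. (\<forall>k. b k \<in> ST) \<and>
      (\<lambda>k::nat. mean_on A U (b k)) \<longlonglongrightarrow> mean_on A W \<sigma>"
    and "\<nu> \<in> ST \<Longrightarrow> AE \<omega> in M. \<sigma> \<omega> \<le> \<nu> \<omega> \<Longrightarrow> mean_at U \<nu> \<le> mean_at W \<sigma>"
proof -
  obtain R where \<sigma>: "\<sigma> \<in> ST" and R: "finite R" "R \<subseteq> {0..T}" "\<And>\<omega>. \<omega> \<in> space M \<Longrightarrow> \<sigma> \<omega> \<in> R"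
    using assms unfolding simple_ST_def by blast
  have Wi: "integrable M (W t)" if "t \<in> R" for t using W_approx(1)[of t] R(2) that by auto
  have spA: "space M \<in> sets (pre_sigma \<sigma>)" using sets.top[of "pre_sigma \<sigma>"] by (simp add: space_pre_sigma)
  have slM: "{\<omega>\<in>A. \<sigma> \<omega> = t} \<in> sets M" if "A \<in> sets (pre_sigma \<sigma>)" for A t
    using pre_sigma_slice[OF \<sigma> that] by (rule sets_F_subset)
  have WA: "integrable M (\<lambda>\<omega>. W (\<sigma> \<omega>) \<omega> * indicator A \<omega>)"
    "mean_on A W \<sigma> = (\<Sum>t\<in>R. \<integral>\<omega>. W t \<omega> * indicator {\<omega>\<in>A. \<sigma> \<omega> = t} \<omega> \<partial>M)"
    if A: "A \<in> sets (pre_sigma \<sigma>)" for A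
  proof -
    have i: "integrable M (\<lambda>\<omega>. W t \<omega> * indicator {\<omega>\<in>A. \<sigma> \<omega> = t} \<omega>)" if "t \<in> R" for t
      by (rule integrable_real_mult_indicator[OF slM[OF A] Wi[OF that]])
    have eq: "W (\<sigma> \<omega>) \<omega> * indicator A \<omega> = (\<Sum>t\<in>R. W t \<omega> * indicator {\<omega>\<in>A. \<sigma> \<omega> = t} \<omega>)"
      if "\<omega> \<in> space M" for \<omega> by (rule sum_slices[where \<sigma> = \<sigma> and \<omega> = \<omega>, OF R(1) R(3)[OF that]])
    show "integrable M (\<lambda>\<omega>. W (\<sigma> \<omega>) \<omega> * indicator A \<omega>)"
    proof (rule Bochner_Integration.integrable_cong[THEN iffD2])
      show "integrable M (\<lambda>\<omega>. \<Sum>t\<in>R. W t \<omega> * indicator {\<omega>\<in>A. \<sigma> \<omega> = t} \<omega>)"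
        using i by (rule Bochner_Integration.integrable_sum)
    qed (use eq in auto)
    show "mean_on A W \<sigma> = (\<Sum>t\<in>R. \<integral>\<omega>. W t \<omega> * indicator {\<omega>\<in>A. \<sigma> \<omega> = t} \<omega> \<partial>M)"
    proof -
      have "mean_on A W \<sigma> = (\<integral>\<omega>. (\<Sum>t\<in>R. W t \<omega> * indicator {\<omega>\<in>A. \<sigma> \<omega> = t} \<omega>) \<partial>M)"
        by (intro Bochner_Integration.integral_cong refl eq)
      also have "\<dots> = (\<Sum>t\<in>R. \<integral>\<omega>. W t \<omega> * indicator {\<omega>\<in>A. \<sigma> \<omega> = t} \<omega> \<partial>M)"
        by (rule Bochner_Integration.integral_sum[OF i])
      finally show ?thesis .
    qed
  qed
  show "integrable M (\<lambda>\<omega>. W (\<sigma> \<omega>) \<omega>)"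
    by (rule Bochner_Integration.integrable_cong[THEN iffD1, OF refl _ WA(1)[OF spA]]) simp
  show "\<exists>b. (\<forall>k. b k \<in> ST) \<and>
      (\<lambda>k::nat. mean_on A U (b k)) \<longlonglongrightarrow> mean_on A W \<sigma>"
    if A: "A \<in> sets (pre_sigma \<sigma>)"
  proof -
    have "\<forall>t\<in>R. \<exists>b. (\<forall>k. b k \<in> STs t) \<and>
      (\<forall>B\<in>sets (F t). (\<lambda>k::nat. mean_on B U (b k)) \<longlonglongrightarrow> (\<integral>\<omega>. W t \<omega> * indicator B \<omega> \<partial>M))"
      using W_approx(2) R(2) by auto
    from bchoice[OF this] obtain \<beta> where \<beta>: "\<And>t k. t \<in> R \<Longrightarrow> \<beta> t k \<in> STs t"
      "\<And>t B. t \<in> R \<Longrightarrow> B \<in> sets (F t) \<Longrightarrow>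
        (\<lambda>k::nat. mean_on B U (\<beta> t k)) \<longlonglongrightarrow> (\<integral>\<omega>. W t \<omega> * indicator B \<omega> \<partial>M)"
      by blast
    \<comment> \<open>The approximating sequences of the slices are run in parallel with a common
      index; finiteness of \<open>R\<close> lets the limits be added.\<close>
    define b where "b k \<omega> = \<beta> (\<sigma> \<omega>) k \<omega>" for k \<omega>
    have b: "b k \<in> ST" for k
      unfolding b_def by (rule ST_paste_simple[OF \<sigma> R, of "\<lambda>t. \<beta> t k"]) (use \<beta>(1) in auto)
    have eq: "mean_on A U (b k) = (\<Sum>t\<in>R. \<integral>\<omega>. U (\<beta> t k \<omega>) \<omega> * indicator {\<omega>\<in>A. \<sigma> \<omega> = t} \<omega> \<partial>M)" for k
    proof -
      have i: "integrable M (\<lambda>\<omega>. U (\<beta> t k \<omega>) \<omega> * indicator {\<omega>\<in>A. \<sigma> \<omega> = t} \<omega>)" if "t \<in> R" for t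
        by (rule integrable_real_mult_indicator[OF slM[OF A] U_integrable[OF ST_from[OF _ \<beta>(1)[OF that]]]])
           (use that R(2) in auto)
      have eq: "U (b k \<omega>) \<omega> * indicator A \<omega> = (\<Sum>t\<in>R. U (\<beta> t k \<omega>) \<omega> * indicator {\<omega>\<in>A. \<sigma> \<omega> = t} \<omega>)"
        if "\<omega> \<in> space M" for \<omega>
        unfolding b_def by (rule sum_slices[where \<sigma> = \<sigma> and \<omega> = \<omega> and f = "\<lambda>t. U (\<beta> t k \<omega>) \<omega>", OF R(1) R(3)[OF that]])
      have "mean_on A U (b k) = (\<integral>\<omega>. (\<Sum>t\<in>R. U (\<beta> t k \<omega>) \<omega> * indicator {\<omega>\<in>A. \<sigma> \<omega> = t} \<omega>) \<partial>M)"
        by (intro Bochner_Integration.integral_cong refl eq)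
      also have "\<dots> = (\<Sum>t\<in>R. \<integral>\<omega>. U (\<beta> t k \<omega>) \<omega> * indicator {\<omega>\<in>A. \<sigma> \<omega> = t} \<omega> \<partial>M)"
        by (rule Bochner_Integration.integral_sum[OF i])
      finally show ?thesis .
    qed
    have "(\<lambda>k. mean_on A U (b k)) \<longlonglongrightarrow> mean_on A W \<sigma>"
      unfolding eq WA(2)[OF A] by (intro tendsto_sum \<beta>(2) pre_sigma_slice[OF \<sigma> A])
    with b show ?thesis by blast
  qed
  show "mean_at U \<nu> \<le> mean_at W \<sigma>"
    if \<nu>: "\<nu> \<in> ST" and le: "AE \<omega> in M. \<sigma> \<omega> \<le> \<nu> \<omega>"
  proof -
    \<comment> \<open>\<nu> is only known to come after \<sigma>, so on the slice {\<sigma> = t} it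
      is replaced by the later of \<open>t\<close> and \<nu>, which is at least \<open>t\<close>
      everywhere and agrees with \<nu> almost surely on the slice.\<close>
    have mx: "(\<lambda>\<omega>. max t (\<nu> \<omega>)) \<in> STs t" if "t \<in> R" for t
      using ST_max[OF ST_const \<nu>, of t] R(2) that by (auto simp: stopping_times_def elim: eventually_mono)
    have i: "integrable M (\<lambda>\<omega>. U (max t (\<nu> \<omega>)) \<omega> * indicator {\<omega>\<in>space M. \<sigma> \<omega> = t} \<omega>)" if "t \<in> R" for t
      by (rule integrable_real_mult_indicator[OF slM[OF spA] U_integrable[OF ST_from[OF _ mx[OF that]]]])
         (use that R(2) in auto)
    have eq: "U (max (\<sigma> \<omega>) (\<nu> \<omega>)) \<omega> * indicator (space M) \<omega>
        = (\<Sum>t\<in>R. U (max t (\<nu> \<omega>)) \<omega> * indicator {\<omega>\<in>space M. \<sigma> \<omega> = t} \<omega>)"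
      if "\<omega> \<in> space M" for \<omega>
      by (rule sum_slices[where \<sigma> = \<sigma> and \<omega> = \<omega> and f = "\<lambda>t. U (max t (\<nu> \<omega>)) \<omega>", OF R(1) R(3)[OF that]])
    have "mean_at U \<nu> = (\<integral>\<omega>. (\<Sum>t\<in>R. U (max t (\<nu> \<omega>)) \<omega> * indicator {\<omega>\<in>space M. \<sigma> \<omega> = t} \<omega>) \<partial>M)"
    proof (rule integral_cong_AE)
      show "(\<lambda>\<omega>. U (\<nu> \<omega>) \<omega>) \<in> borel_measurable M" using U_integrable[OF \<nu>] by (rule borel_measurable_integrable)
      show "(\<lambda>\<omega>. \<Sum>t\<in>R. U (max t (\<nu> \<omega>)) \<omega> * indicator {\<omega>\<in>space M. \<sigma> \<omega> = t} \<omega>) \<in> borel_measurable M"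
        using i by (intro borel_measurable_sum borel_measurable_integrable)
      show "AE \<omega> in M. U (\<nu> \<omega>) \<omega> = (\<Sum>t\<in>R. U (max t (\<nu> \<omega>)) \<omega> * indicator {\<omega>\<in>space M. \<sigma> \<omega> = t} \<omega>)"
        using le AE_space
      proof eventually_elim
        case (elim \<omega>)
        then have "max (\<sigma> \<omega>) (\<nu> \<omega>) = \<nu> \<omega>" by simp
        then show ?case using eq[OF elim(2)] elim(2) by simp
      qed
    qed
    also have "\<dots> = (\<Sum>t\<in>R. \<integral>\<omega>. U (max t (\<nu> \<omega>)) \<omega> * indicator {\<omega>\<in>space M. \<sigma> \<omega> = t} \<omega> \<partial>M)"
      by (rule Bochner_Integration.integral_sum[OF i])
    also have "\<dots> \<le> (\<Sum>t\<in>R. \<integral>\<omega>. W t \<omega> * indicator {\<omega>\<in>space M. \<sigma> \<omega> = t} \<omega> \<partial>M)"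
      by (rule sum_mono, rule U_le_W_on[OF _ _ mx pre_sigma_slice[OF \<sigma> spA]]) (use R(2) in auto)
    also have "\<dots> = mean_on (space M) W \<sigma>" by (rule WA(2)[OF spA, symmetric])
    also have "\<dots> = mean_at W \<sigma>" by (rule Bochner_Integration.integral_cong) auto
    finally show ?thesis .
  qed
qed

text \<open>The excess of \<open>W\<close> is split by sign. On the event {W > K}, which is known at
  time \<sigma>, the mean of \<open>W - K\<close> is a limit of means of \<open>U - K\<close> along
  stopping times and thus bounded by an excess of \<open>U\<close>. Where \<open>W\<close> is very
  negative, U \<le> W makes \<open>U\<close> at least as negative. So a threshold for
  \<open>U\<close> with half the tolerance serves for \<open>W\<close>.\<close>

lemma simple_W_ui: "ui_family M ((\<lambda>\<sigma> \<omega>. W (\<sigma> \<omega>) \<omega>) ` {\<sigma>. simple_ST \<sigma>})"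
  unfolding ui_family_def
proof (intro conjI ballI allI impI)
  show "integrable M f" if "f \<in> (\<lambda>\<sigma> \<omega>. W (\<sigma> \<omega>) \<omega>) ` {\<sigma>. simple_ST \<sigma>}" for f
    using that by (rule imageE) (simp add: simple_W(1))
  fix \<epsilon> :: real assume "\<epsilon> > 0"
  then have "\<epsilon>/2 > 0" by simp
  from ui_familyE[OF U_ui this] obtain K where K: "K \<ge> 0"
    "\<And>f. f \<in> (\<lambda>\<nu> \<omega>. U (\<nu> \<omega>) \<omega>) ` ST \<Longrightarrow> excess M K f \<le> \<epsilon>/2"
    by blast
  have UK: "(\<integral>\<omega>. max 0 (\<bar>U (\<nu> \<omega>) \<omega>\<bar> - K) \<partial>M) \<le> \<epsilon>/2" if "\<nu> \<in> ST" for \<nu>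
    using K(2)[OF imageI[OF that]] .
  have "(\<integral>\<omega>. max 0 (\<bar>W (\<sigma> \<omega>) \<omega>\<bar> - K) \<partial>M) \<le> \<epsilon>" if \<sigma>: "simple_ST \<sigma>" for \<sigma>
  proof -
    obtain R where \<sigma>ST: "\<sigma> \<in> ST" and R: "finite R" "R \<subseteq> {0..T}" "\<And>\<omega>. \<omega> \<in> space M \<Longrightarrow> \<sigma> \<omega> \<in> R"
      using \<sigma> unfolding simple_ST_def by blast
    have Wi[simp]: "integrable M (\<lambda>\<omega>. W (\<sigma> \<omega>) \<omega>)" by (rule simple_W(1)[OF \<sigma>])
    have Ui[simp]: "integrable M (\<lambda>\<omega>. U (\<sigma> \<omega>) \<omega>)" by (rule U_integrable[OF \<sigma>ST])
    define A where "A = {\<omega>\<in>space M. K < W (\<sigma> \<omega>) \<omega>}"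
    have A: "A \<in> sets (pre_sigma \<sigma>)"
    proof (rule sets_pre_sigmaI[OF ST_stopping_time[OF \<sigma>ST]])
      fix s
      have "{\<omega>\<in>space M. \<sigma> \<omega> = t} \<inter> {\<omega>\<in>space M. K < W t \<omega>} \<in> sets (F s)" if "t \<in> R" "t \<le> s" for t
      proof -
        have "{\<omega>\<in>space M. \<sigma> \<omega> = t} \<in> sets (F t)"
          using stopping_time_eq_const[OF ST_stopping_time[OF \<sigma>ST]] by (simp add: pred_def space_F)
        moreover have "{\<omega>\<in>space (F t). K < W t \<omega>} \<in> sets (F t)"
          using W_adapted[of t] R(2) that by (intro borel_measurable_less) auto
        ultimately show ?thesis using sets_F_mono[OF that(2)] by (auto simp: space_F)
      qed
      then have "(\<Union>t\<in>R \<inter> {..s}. {\<omega>\<in>space M. \<sigma> \<omega> = t} \<inter> {\<omega>\<in>space M. K < W t \<omega>}) \<in> sets (F s)"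
        using R(1) by auto
      also have "(\<Union>t\<in>R \<inter> {..s}. {\<omega>\<in>space M. \<sigma> \<omega> = t} \<inter> {\<omega>\<in>space M. K < W t \<omega>}) = {\<omega>\<in>A. \<sigma> \<omega> \<le> s}"
        using R(3) by (auto simp: A_def)
      finally show "{\<omega>\<in>A. \<sigma> \<omega> \<le> s} \<in> sets (F s)" .
    qed
    have [measurable]: "(\<lambda>\<omega>. W (\<sigma> \<omega>) \<omega>) \<in> borel_measurable M"
      using Wi by (rule borel_measurable_integrable)
    have AM[measurable]: "A \<in> sets M" unfolding A_def by measurable
    have intA: "integrable M (\<lambda>\<omega>. f \<omega> * indicator A \<omega>)" if "integrable M f" for f :: "'a \<Rightarrow> real"
      by (rule integrable_real_mult_indicator[OF AM that])
    have subtr: "(\<integral>\<omega>. (f \<omega> - K) * indicator A \<omega> \<partial>M) = (\<integral>\<omega>. f \<omega> * indicator A \<omega> \<partial>M) - K * measure M A"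
      if "integrable M f" for f
    proof -
      have "(\<integral>\<omega>. (f \<omega> - K) * indicator A \<omega> \<partial>M) = (\<integral>\<omega>. f \<omega> * indicator A \<omega> - K * indicator A \<omega> \<partial>M)"
        by (simp add: left_diff_distrib)
      also have "\<dots> = (\<integral>\<omega>. f \<omega> * indicator A \<omega> \<partial>M) - (\<integral>\<omega>. K * indicator A \<omega> \<partial>M)"
        by (rule Bochner_Integration.integral_diff[OF intA[OF that]]) (simp add: emeasure_eq_measure)
      finally show ?thesis by simp
    qed
    have W_excess: "(\<integral>\<omega>. max 0 (W (\<sigma> \<omega>) \<omega> - K) \<partial>M) \<le> \<epsilon>/2"
    proof -
      obtain b where b: "\<And>k. b k \<in> ST" "(\<lambda>k::nat. mean_on A U (b k))
          \<longlonglongrightarrow> mean_on A W \<sigma>"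
        using simple_W(2)[OF \<sigma> A] by blast
      have "mean_on A U (b k) - K * measure M A \<le> \<epsilon>/2" for k
      proof -
        have "(\<integral>\<omega>. (U (b k \<omega>) \<omega> - K) * indicator A \<omega> \<partial>M) \<le> (\<integral>\<omega>. max 0 (\<bar>U (b k \<omega>) \<omega>\<bar> - K) \<partial>M)"
        proof (rule integral_mono)
          show "integrable M (\<lambda>\<omega>. (U (b k \<omega>) \<omega> - K) * indicator A \<omega>)"
            by (rule intA) (use U_integrable[OF b(1)] in simp)
        qed (use U_integrable[OF b(1)] in \<open>auto simp: indicator_def\<close>)
        with UK[OF b(1)[of k]] show ?thesis unfolding subtr[OF U_integrable[OF b(1)]] by linarith
      qed
      then have "mean_on A W \<sigma> - K * measure M A \<le> \<epsilon>/2"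
        by (intro LIMSEQ_le_const2[OF tendsto_diff[OF b(2) tendsto_const]]) auto
      moreover have "(\<integral>\<omega>. max 0 (W (\<sigma> \<omega>) \<omega> - K) \<partial>M) = (\<integral>\<omega>. (W (\<sigma> \<omega>) \<omega> - K) * indicator A \<omega> \<partial>M)"
        by (rule Bochner_Integration.integral_cong) (auto simp: A_def indicator_def)
      ultimately show ?thesis using subtr[OF Wi] by simp
    qed
    have "(\<integral>\<omega>. max 0 (\<bar>W (\<sigma> \<omega>) \<omega>\<bar> - K) \<partial>M)
      \<le> (\<integral>\<omega>. max 0 (W (\<sigma> \<omega>) \<omega> - K) + max 0 (\<bar>U (\<sigma> \<omega>) \<omega>\<bar> - K) \<partial>M)"
    proof (rule integral_mono_AE)
      show "AE \<omega> in M. max 0 (\<bar>W (\<sigma> \<omega>) \<omega>\<bar> - K) \<le> max 0 (W (\<sigma> \<omega>) \<omega> - K) + max 0 (\<bar>U (\<sigma> \<omega>) \<omega>\<bar> - K)"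
        using U_le_W_ST[OF \<sigma>ST] by eventually_elim linarith
    qed auto
    also have "\<dots> = (\<integral>\<omega>. max 0 (W (\<sigma> \<omega>) \<omega> - K) \<partial>M) + (\<integral>\<omega>. max 0 (\<bar>U (\<sigma> \<omega>) \<omega>\<bar> - K) \<partial>M)"
      by (rule Bochner_Integration.integral_add) auto
    also have "\<dots> \<le> \<epsilon>" using W_excess UK[OF \<sigma>ST] by linarith
    finally show ?thesis .
  qed
  then have "\<forall>f\<in>(\<lambda>\<sigma> \<omega>. W (\<sigma> \<omega>) \<omega>) ` {\<sigma>. simple_ST \<sigma>}. excess M K f \<le> \<epsilon>"
    by blast
  with K(1) show "\<exists>K\<ge>0. \<forall>f\<in>(\<lambda>\<sigma> \<omega>. W (\<sigma> \<omega>) \<omega>) ` {\<sigma>. simple_ST \<sigma>}. excess M K f \<le> \<epsilon>"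
    by (rule exI[of _ K, OF conjI])
qed

section \<open>Extension to arbitrary stopping times\<close>

lemma W_grid_LIMSEQ:
  assumes \<sigma>: "\<sigma> \<in> ST"
  shows "AE \<omega> in M. (\<lambda>n. W (grid_time n \<sigma> \<omega>) \<omega>) \<longlonglongrightarrow> W (\<sigma> \<omega>) \<omega>"
  using right_continuous_paths_LIMSEQ[OF W_rc] ST_AE_range[OF \<sigma>]
proof eventually_elim
  case (elim \<omega>)
  then show ?case
    using grid_time_ge[of \<sigma> \<omega>] grid_time_le[of _ \<sigma> \<omega>] grid_time_LIMSEQ[of \<sigma> \<omega>] by simp
qed

lemma W_ST:
  assumes \<sigma>: "\<sigma> \<in> ST"
  shows W_integrable: "integrable M (\<lambda>\<omega>. W (\<sigma> \<omega>) \<omega>)"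
    and W_grid_integral: "(\<lambda>n. mean_at W (grid_time n \<sigma>)) \<longlonglongrightarrow> mean_at W \<sigma>"
proof -
  have "(\<lambda>\<omega>. W (\<sigma> \<omega>) \<omega>) \<in> borel_measurable M"
    by (rule borel_measurable_AE_LIMSEQ[OF _ W_grid_LIMSEQ[OF \<sigma>]])
       (rule borel_measurable_integrable[OF simple_W(1)[OF simple_grid_time[OF \<sigma>]]])
  note * = vitali_convergence[OF simple_W_ui _ W_grid_LIMSEQ[OF \<sigma>] this]
  show "integrable M (\<lambda>\<omega>. W (\<sigma> \<omega>) \<omega>)" by (rule *(1)) (use simple_grid_time[OF \<sigma>] in auto)
  show "(\<lambda>n. mean_at W (grid_time n \<sigma>)) \<longlonglongrightarrow> mean_at W \<sigma>"
    by (rule *(2)) (use simple_grid_time[OF \<sigma>] in auto)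
qed

text \<open>Together with \<open>U_integral_le_W\<close>, this plays the role of optional sampling:
  at a stopping time, the mean of \<open>W\<close> lies below every common bound for the mean
  rewards and above the mean reward of any later stopping time. Both pass from grid times to
  \<sigma> through the convergence of the means of \<open>W\<close>.\<close>

lemma W_integral_le:
  assumes \<sigma>: "\<sigma> \<in> ST" and c: "\<And>\<nu>. \<nu> \<in> ST \<Longrightarrow> mean_at U \<nu> \<le> c"
  shows "mean_at W \<sigma> \<le> c"
proof (rule LIMSEQ_le_const2[OF W_grid_integral[OF \<sigma>]], intro exI allI impI)
  fix n
  let ?g = "grid_time n \<sigma>"
  have A: "space M \<in> sets (pre_sigma ?g)" using sets.top[of "pre_sigma ?g"] by (simp add: space_pre_sigma)
  have sp: "(\<integral>\<omega>. f \<omega> * indicator (space M) \<omega> \<partial>M) = (\<integral>\<omega>. f \<omega> \<partial>M)" for f :: "'a \<Rightarrow> real"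
    by (rule Bochner_Integration.integral_cong) auto
  obtain b where b: "\<And>k. b k \<in> ST" "(\<lambda>k::nat. mean_at U (b k)) \<longlonglongrightarrow> mean_at W ?g"
    using simple_W(2)[OF simple_grid_time[OF \<sigma>] A] unfolding sp by blast
  show "mean_at W ?g \<le> c"
    by (rule LIMSEQ_le_const2[OF b(2)]) (use c b(1) in auto)
qed

lemma U_integral_LIMSEQ:
  assumes \<nu>: "\<And>n. \<nu> n \<in> ST" and lim: "AE \<omega> in M. (\<lambda>n. U (\<nu> n \<omega>) \<omega>) \<longlonglongrightarrow> g \<omega>"
  shows "integrable M g" "(\<lambda>n. mean_at U (\<nu> n)) \<longlonglongrightarrow> (\<integral>\<omega>. g \<omega> \<partial>M)"
proof -
  have "g \<in> borel_measurable M"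
    by (rule borel_measurable_AE_LIMSEQ[OF _ lim]) (rule borel_measurable_integrable[OF U_integrable[OF \<nu>]])
  note * = vitali_convergence[OF U_ui _ lim this]
  show "integrable M g" by (rule *(1)) (use \<nu> in auto)
  show "(\<lambda>n. mean_at U (\<nu> n)) \<longlonglongrightarrow> (\<integral>\<omega>. g \<omega> \<partial>M)" by (rule *(2)) (use \<nu> in auto)
qed

text \<open>Grid times lie above \<sigma> and may overtake \<nu>, so \<nu> is delayed to the later
  of the two. Right continuity of \<open>U\<close> makes the delay disappear in the limit.\<close>

lemma U_integral_le_W:
  assumes \<sigma>: "\<sigma> \<in> ST" and \<nu>: "\<nu> \<in> ST" and le: "AE \<omega> in M. \<sigma> \<omega> \<le> \<nu> \<omega>"
  shows "mean_at U \<nu> \<le> mean_at W \<sigma>"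
proof -
  let ?\<nu> = "\<lambda>n \<omega>. max (grid_time n \<sigma> \<omega>) (\<nu> \<omega>)"
  have ST: "?\<nu> n \<in> ST" for n by (rule ST_max[OF grid_time_ST[OF \<sigma>] \<nu>])
  have "AE \<omega> in M. (\<lambda>n. U (?\<nu> n \<omega>) \<omega>) \<longlonglongrightarrow> U (\<nu> \<omega>) \<omega>"
    using right_continuous_paths_LIMSEQ[OF U_rc] ST_AE_range[OF \<sigma>] ST_AE_range[OF \<nu>] le
  proof eventually_elim
    case (elim \<omega>)
    have "(\<lambda>n. ?\<nu> n \<omega>) \<longlonglongrightarrow> max (\<sigma> \<omega>) (\<nu> \<omega>)"
      using grid_time_LIMSEQ[of \<sigma> \<omega>] elim by (intro tendsto_intros) auto
    then have "(\<lambda>n. ?\<nu> n \<omega>) \<longlonglongrightarrow> \<nu> \<omega>" using elim by (simp add: max_absorb2)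
    then show ?case
      using elim(1)[rule_format, of "\<nu> \<omega>" "\<lambda>n. ?\<nu> n \<omega>"] elim grid_time_le[of _ \<sigma> \<omega>] by simp
  qed
  then have "(\<lambda>n. mean_at U (?\<nu> n)) \<longlonglongrightarrow> mean_at U \<nu>"
    by (rule U_integral_LIMSEQ(2)[of ?\<nu>, OF ST])
  moreover have "mean_at U (?\<nu> n) \<le> mean_at W (grid_time n \<sigma>)" for n
    by (rule simple_W(3)[OF simple_grid_time[OF \<sigma>] ST]) auto
  ultimately show ?thesis using LIMSEQ_le[OF _ W_grid_integral[OF \<sigma>]] by blast
qed

section \<open>Near-meeting times and the optimal stopping time\<close>

lemma W_T_le: "AE \<omega> in M. W T \<omega> \<le> U T \<omega>"
proof -
  interpret FT: finite_measure_subalgebra M "F T"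
    by standard (rule subalgebra_F)
  have T: "0 \<le> T" "T \<le> T" using T_pos by auto
  have UT: "integrable M (U T)" using U_integrable[OF ST_const[OF T]] .
  have "AE \<omega> in M. real_cond_exp M (F T) (\<lambda>\<omega>. U (\<nu> \<omega>) \<omega>) \<omega> \<le> U T \<omega>"
    if \<nu>: "\<nu> \<in> STs T" for \<nu>
  proof -
    have "AE \<omega> in M. T \<le> \<nu> \<omega> \<and> \<nu> \<omega> \<le> T" using \<nu> by (auto simp: stopping_times_def)
    then have "AE \<omega> in M. U (\<nu> \<omega>) \<omega> = U T \<omega>"
      by eventually_elim (metis order_antisym)
    then have "AE \<omega> in M. real_cond_exp M (F T) (\<lambda>\<omega>. U (\<nu> \<omega>) \<omega>) \<omega> = real_cond_exp M (F T) (U T) \<omega>"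
      by (rule FT.real_cond_exp_cong) (use U_integrable[OF ST_from[OF T(1) \<nu>]] UT in auto)
    moreover have "AE \<omega> in M. real_cond_exp M (F T) (U T) \<omega> = U T \<omega>"
      by (rule FT.real_cond_exp_F_meas[OF UT U_adapted[OF T]])
    ultimately show ?thesis by eventually_elim simp
  qed
  then have "\<forall>f\<in>{real_cond_exp M (F T) (\<lambda>\<omega>. U (\<nu> \<omega>) \<omega>) | \<nu>. \<nu> \<in> STs T}.
      AE \<omega> in M. f \<omega> \<le> U T \<omega>" by blast
  moreover have "U T \<in> borel_measurable M" using UT by (rule borel_measurable_integrable)
  ultimately show ?thesis using W_ess_sup[OF T] unfolding is_ess_sup_def by blast
qed

text \<open>
  The first time at which \<open>W\<close> and \<open>U\<close> are within \<open>1 / (m + 1)\<close>: unlike the first meeting time, it is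
  a stopping time by right continuity alone, without a debut theorem.
\<close>

definition near_time :: "nat \<Rightarrow> 'a \<Rightarrow> real" where
  "near_time m \<omega> = Inf (insert T {s. 0 \<le> s \<and> s \<le> T \<and> W s \<omega> - U s \<omega> < inverse (real (Suc m))})"

lemma bdd_near: "bdd_below (insert T {s. 0 \<le> s \<and> s \<le> T \<and> P s})"
  using T_pos by (auto intro!: bdd_belowI[of _ 0])

lemma near_time_range: "0 \<le> near_time m \<omega>" "near_time m \<omega> \<le> T"
proof -
  show "0 \<le> near_time m \<omega>" unfolding near_time_def by (rule cInf_greatest) (use T_pos in auto)
  show "near_time m \<omega> \<le> T" unfolding near_time_def by (rule cInf_lower[OF _ bdd_near]) simp
qed

lemma near_time_mono: "incseq (\<lambda>m. near_time m \<omega>)"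
proof (rule incseq_SucI)
  fix m
  have "inverse (real (Suc (Suc m))) \<le> inverse (real (Suc m))" by (simp add: field_simps)
  then have "x < inverse (real (Suc m))" if "x < inverse (real (Suc (Suc m)))" for x :: real
    using that by (rule order.strict_trans2[rotated])
  then show "near_time m \<omega> \<le> near_time (Suc m) \<omega>"
    unfolding near_time_def by (intro cInf_superset_mono bdd_near) (auto simp del: of_nat_Suc)
qed

lemma near_time_le_first_meeting: "near_time m \<omega> \<le> first_meeting T W U \<omega>"
  unfolding near_time_def first_meeting_def by (intro cInf_superset_mono bdd_near) auto

lemma near_time_gap:
  assumes "0 \<le> s" "s \<le> T" "s < near_time m \<omega>"
  shows "inverse (real (Suc m)) \<le> W s \<omega> - U s \<omega>"
proof (rule ccontr)
  assume "\<not> ?thesis"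
  then have "near_time m \<omega> \<le> s" unfolding near_time_def using assms by (intro cInf_lower bdd_near) auto
  with assms show False by simp
qed

text \<open>A gap \<open>W - U\<close> strictly below the threshold at some time stays below it for
  a while to the right, hence at a rational time. So the strict event is a countable union of events
  known before \<open>t\<close>, up to the null set where right continuity fails.\<close>

lemma near_time_ST: "near_time m \<in> ST"
proof (rule ST_less_I)
  show "0 \<le> near_time m \<omega>" for \<omega> by (rule near_time_range)
  show "AE \<omega> in M. near_time m \<omega> \<le> T" using near_time_range(2) by simp
  fix t assume t: "0 < t" "t \<le> T"
  let ?c = "inverse (real (Suc m))"
  let ?B = "\<Union>q\<in>\<rat> \<inter> {0..<t}. {\<omega>\<in>space (F q). W q \<omega> - U q \<omega> < ?c}"
  have "{\<omega>\<in>space (F q). W q \<omega> - U q \<omega> < ?c} \<in> sets (F t)" if "q \<in> \<rat> \<inter> {0..<t}" for q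
  proof -
    have "{\<omega>\<in>space (F q). W q \<omega> - U q \<omega> < ?c} \<in> sets (F q)"
      using W_adapted[of q] U_adapted[of q] that t by (intro borel_measurable_less borel_measurable_diff) auto
    then show ?thesis using sets_F_mono[of q t] that by auto
  qed
  then have B: "?B \<in> sets (F t)" using countable_rat by (intro sets.countable_UN'') auto
  show "{\<omega>\<in>space M. near_time m \<omega> < t} \<in> sets (F t)"
  proof (rule sets_F_AE[OF B])
    show "AE \<omega> in M. \<omega> \<in> ?B \<longleftrightarrow> \<omega> \<in> {\<omega>\<in>space M. near_time m \<omega> < t}"
      using U_rc[unfolded right_continuous_paths_def] W_rc[unfolded right_continuous_paths_def] AE_space
    proof eventually_elim
      case (elim \<omega>)
      have "\<omega> \<in> ?B" if lt: "near_time m \<omega> < t"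
      proof -
        obtain s where s: "s < t" "s \<in> insert T {s. 0 \<le> s \<and> s \<le> T \<and> W s \<omega> - U s \<omega> < ?c}"
          using lt unfolding near_time_def by (subst (asm) cInf_less_iff[OF _ bdd_near]) auto
        then have s': "0 \<le> s" "s < T" "W s \<omega> - U s \<omega> < ?c" using t by auto
        have "((\<lambda>s. W s \<omega> - U s \<omega>) \<longlongrightarrow> W s \<omega> - U s \<omega>) (at_right s)"
          using elim(1,2) s' by (intro tendsto_diff) auto
        then have "\<forall>\<^sub>F r in at_right s. W r \<omega> - U r \<omega> < ?c" using s'(3) by (rule order_tendstoD)
        then obtain c where c: "c > s" "\<And>r. s < r \<Longrightarrow> r < c \<Longrightarrow> W r \<omega> - U r \<omega> < ?c"
          unfolding eventually_at_right_field by blast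
        obtain q where q: "q \<in> \<rat>" "s < q" "q < min c t" using Rats_dense_in_real[of s "min c t"] c s by auto
        then show ?thesis using c(2)[of q] s' elim(3) by (auto simp: space_F)
      qed
      moreover have "near_time m \<omega> < t" if B: "\<omega> \<in> ?B"
      proof -
        obtain q where q: "q \<in> {0..<t}" "W q \<omega> - U q \<omega> < ?c" using B by blast
        have "near_time m \<omega> \<le> q" using near_time_gap[of q m \<omega>] q t by force
        then show ?thesis using q by auto
      qed
      ultimately show ?case using elim(3) by blast
    qed
  qed (use t in auto)
qed

text \<open>The infimum need not belong to the set, and the strict inequality is weakened when it is
  approached from the right. The extra point \<open>T\<close> is harmless because
  \<open>W T \<le> U T\<close>.\<close>

lemma near_time_near: "AE \<omega> in M. W (near_time m \<omega>) \<omega> - U (near_time m \<omega>) \<omega> \<le> inverse (real (Suc m))"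
  using right_continuous_paths_LIMSEQ[OF U_rc] right_continuous_paths_LIMSEQ[OF W_rc] W_T_le
proof eventually_elim
  case (elim \<omega>)
  let ?c = "inverse (real (Suc m))"
  let ?A = "insert T {s. 0 \<le> s \<and> s \<le> T \<and> W s \<omega> - U s \<omega> < ?c}"
  have small: "0 \<le> s \<and> s \<le> T \<and> near_time m \<omega> \<le> s \<and> W s \<omega> - U s \<omega> \<le> ?c" if "s \<in> ?A" for s
  proof -
    have "near_time m \<omega> \<le> s" unfolding near_time_def by (rule cInf_lower[OF that bdd_near])
    then show ?thesis using that elim(3) T_pos by (auto simp: order_trans[of "W T \<omega> - U T \<omega>" 0])
  qed
  have "\<forall>n. \<exists>s. s \<in> ?A \<and> s < near_time m \<omega> + inverse (real (Suc n))"
  proof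
    fix n
    have "Inf ?A < near_time m \<omega> + inverse (real (Suc n))" by (simp add: near_time_def)
    then show "\<exists>s. s \<in> ?A \<and> s < near_time m \<omega> + inverse (real (Suc n))"
      by (subst (asm) cInf_less_iff[OF _ bdd_near]) blast+
  qed
  from choice[OF this]
  obtain s where s: "\<And>n. s n \<in> ?A" "\<And>n. s n < near_time m \<omega> + inverse (real (Suc n))" by blast
  have "s \<longlonglongrightarrow> near_time m \<omega>"
  proof (rule tendsto_sandwich[of "\<lambda>_. near_time m \<omega>" _ _ "\<lambda>n. near_time m \<omega> + inverse (real (Suc n))"])
    show "(\<lambda>n. near_time m \<omega> + inverse (real (Suc n))) \<longlonglongrightarrow> near_time m \<omega>"
      using tendsto_add[OF tendsto_const[of "near_time m \<omega>"] LIMSEQ_inverse_real_of_nat] by simp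
  qed (use small[OF s(1)] s(2) in \<open>auto intro!: always_eventually less_imp_le\<close>)
  then have "(\<lambda>n. W (s n) \<omega> - U (s n) \<omega>) \<longlonglongrightarrow> W (near_time m \<omega>) \<omega> - U (near_time m \<omega>) \<omega>"
    using elim(1,2) near_time_range(1)[of m \<omega>] small[OF s(1)] by (intro tendsto_diff) auto
  then show ?case by (rule LIMSEQ_le_const2) (use small[OF s(1)] in auto)
qed

text \<open>A nearly optimal stopping time has a small mean gap \<open>W - U\<close>, so it rarely
  stops before \<open>near_time m\<close>, where the gap is at least \<open>1/(m+1)\<close>. On that
  rare event the rewards are negligible by uniform integrability; elsewhere one may stop already at
  \<open>near_time m\<close>, at a cost of at most \<open>1/(m+1)\<close>. The supremum
  \<open>v\<close> is used because no maximiser is available yet.\<close>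

lemma near_time_near_optimal:
  assumes \<nu>: "\<nu> \<in> ST"
  shows "mean_at U \<nu> \<le> mean_at U (near_time m) + inverse (real (Suc m))"
proof -
  let ?c = "inverse (real (Suc m))"
  let ?\<mu> = "near_time m"
  define v where "v = (SUP \<nu>\<in>ST. mean_at U \<nu>)"
  have le_v: "mean_at U \<nu> \<le> v" if "\<nu> \<in> ST" for \<nu>
    unfolding v_def by (rule cSUP_upper[OF that U_bdd])
  have "v \<le> mean_at U ?\<mu> + ?c + \<epsilon>" if \<epsilon>: "\<epsilon> > 0" for \<epsilon>
  proof -
    have "\<epsilon>/4 > 0" using \<epsilon> by simp
    from ui_family_small_sets[OF U_ui this]
    obtain \<delta> where \<delta>: "\<delta> > 0" "\<And>f A. f \<in> (\<lambda>\<nu> \<omega>. U (\<nu> \<omega>) \<omega>) ` ST \<Longrightarrow> A \<in> sets M \<Longrightarrow> measure M A \<le> \<delta> \<Longrightarrow>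
        (\<integral>\<omega>. \<bar>f \<omega>\<bar> * indicator A \<omega> \<partial>M) \<le> \<epsilon>/4"
      by blast
    \<comment> \<open>The bound \<open>?c * \<delta>\<close> gives the rare event probability at
      most \<delta>; the bound \<open>\<epsilon>/4\<close> serves twice, for the distance of \<nu>
      from the supremum and for the mean gap.\<close>
    define d where "d = min (\<epsilon>/4) (?c * \<delta>)"
    have d: "d > 0" "d \<le> \<epsilon>/4" "d \<le> ?c * \<delta>" using \<epsilon> \<delta>(1) unfolding d_def by (auto simp del: of_nat_Suc)
    have "v - d < v" using d by simp
    then obtain \<nu> where \<nu>: "\<nu> \<in> ST" "v - d < mean_at U \<nu>"
      unfolding v_def using less_cSUP_iff[OF _ U_bdd] near_time_ST by blast
    define A where "A = {\<omega>\<in>space M. \<nu> \<omega> < ?\<mu> \<omega>}"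
    have [measurable]: "\<nu> \<in> borel_measurable M" "?\<mu> \<in> borel_measurable M"
      using ST_measurable \<nu>(1) near_time_ST by auto
    have A[measurable]: "A \<in> sets M" unfolding A_def by measurable
    let ?Z = "\<lambda>\<omega>. W (\<nu> \<omega>) \<omega> - U (\<nu> \<omega>) \<omega>"
    have int[simp]: "integrable M (\<lambda>\<omega>. W (\<nu> \<omega>) \<omega>)" "integrable M (\<lambda>\<omega>. U (\<nu> \<omega>) \<omega>)"
        "integrable M (\<lambda>\<omega>. U (?\<mu> \<omega>) \<omega>)"
      using W_integrable[OF \<nu>(1)] U_integrable[OF \<nu>(1)] U_integrable[OF near_time_ST] by auto
    have intA[simp]: "integrable M (\<lambda>\<omega>. \<bar>f \<omega>\<bar> * indicator A \<omega>)" if "integrable M f" for f :: "'a \<Rightarrow> real"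
      by (rule integrable_real_mult_indicator[OF A]) (use that in auto)
    have Zd: "(\<integral>\<omega>. ?Z \<omega> \<partial>M) \<le> d"
      using W_integral_le[OF \<nu>(1) le_v] \<nu>(2) by (subst Bochner_Integration.integral_diff) auto
    have "?c * measure M A = (\<integral>\<omega>. ?c * indicator A \<omega> \<partial>M)" by simp
    also have "\<dots> \<le> (\<integral>\<omega>. ?Z \<omega> \<partial>M)"
    proof (rule integral_mono_AE)
      show "AE \<omega> in M. ?c * indicator A \<omega> \<le> ?Z \<omega>"
        using U_le_W_ST[OF \<nu>(1)] ST_AE_range[OF \<nu>(1)]
        by eventually_elim (use near_time_gap in \<open>auto simp: A_def indicator_def simp del: of_nat_Suc\<close>)
    qed (auto simp: emeasure_eq_measure)
    finally have "?c * measure M A \<le> ?c * \<delta>" using Zd d(3) by linarith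
    then have small: "measure M A \<le> \<delta>" by (subst (asm) mult_le_cancel_left_pos) auto
    let ?\<kappa> = "\<lambda>\<omega>. min (?\<mu> \<omega>) (\<nu> \<omega>)"
    have \<kappa>: "?\<kappa> \<in> ST" by (rule ST_min[OF near_time_ST \<nu>(1)])
    have "mean_at U \<nu> \<le> mean_at W ?\<kappa>"
      by (rule U_integral_le_W[OF \<kappa> \<nu>(1)]) auto
    \<comment> \<open>One integrable bound for both cases: on \<open>A\<close> the gap
      \<open>?Z\<close> together with the absolute values dominates \<open>W\<close> at \<nu>, and
      off \<open>A\<close> the near-meeting bound suffices since \<open>?Z\<close> is
      nonnegative.\<close>
    also have "\<dots> \<le> (\<integral>\<omega>. (U (?\<mu> \<omega>) \<omega> + ?c) + (?Z \<omega> +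
        (\<bar>U (\<nu> \<omega>) \<omega>\<bar> * indicator A \<omega> + \<bar>U (?\<mu> \<omega>) \<omega>\<bar> * indicator A \<omega>)) \<partial>M)"
    proof (rule integral_mono_AE[OF W_integrable[OF \<kappa>]])
      show "AE \<omega> in M. W (?\<kappa> \<omega>) \<omega> \<le> (U (?\<mu> \<omega>) \<omega> + ?c) + (?Z \<omega> +
        (\<bar>U (\<nu> \<omega>) \<omega>\<bar> * indicator A \<omega> + \<bar>U (?\<mu> \<omega>) \<omega>\<bar> * indicator A \<omega>))"
        using U_le_W_ST[OF \<nu>(1)] near_time_near[of m] AE_space
      proof eventually_elim
        case (elim \<omega>)
        have c: "0 < ?c" by simp
        show ?case
        proof (cases "\<nu> \<omega> < ?\<mu> \<omega>")
          case True
          then have "\<omega> \<in> A" "?\<kappa> \<omega> = \<nu> \<omega>" using elim(3) by (auto simp: A_def)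
          then show ?thesis using c by (simp del: of_nat_Suc, linarith)
        next
          case False
          then have "\<omega> \<notin> A" "?\<kappa> \<omega> = ?\<mu> \<omega>" by (auto simp: A_def)
          then show ?thesis using elim by (simp del: of_nat_Suc)
        qed
      qed
    qed auto
    also have "\<dots> = (mean_at U ?\<mu> + ?c) + ((\<integral>\<omega>. ?Z \<omega> \<partial>M) +
        ((\<integral>\<omega>. \<bar>U (\<nu> \<omega>) \<omega>\<bar> * indicator A \<omega> \<partial>M) + (\<integral>\<omega>. \<bar>U (?\<mu> \<omega>) \<omega>\<bar> * indicator A \<omega> \<partial>M)))"
      by (subst Bochner_Integration.integral_add, simp, simp)+ (simp add: prob_space)
    also have "\<dots> \<le> (mean_at U ?\<mu> + ?c) + (\<epsilon>/4 + (\<epsilon>/4 + \<epsilon>/4))"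
      using Zd d(2) \<delta>(2)[OF _ A small] \<nu>(1) near_time_ST by (intro add_mono) (auto intro: imageI)
    finally show ?thesis using \<nu>(2) d(2) by linarith
  qed
  then have "v \<le> mean_at U ?\<mu> + ?c" by (rule field_le_epsilon)
  with le_v[OF \<nu>] show ?thesis by linarith
qed

text \<open>Optimality is proved for the limit \<rho> of the near-meeting times, by
  \<open>U_left\<close>, before it is known that \<open>W\<close> and \<open>U\<close> meet there.
  Meeting follows: the mean of \<open>W\<close> at \<rho> is at most the optimal value, which is the
  mean of \<open>U\<close> at \<rho>, while U \<le> W. Since every near-meeting time is at most the
  first meeting time, \<rho> is that time almost surely.\<close>

theorem first_meeting_optimal:
  shows "first_meeting T W U \<in> ST"
    and "\<nu> \<in> ST \<Longrightarrow> mean_at U \<nu> \<le> mean_at U (first_meeting T W U)"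
proof -
  define \<rho> where "\<rho> \<omega> = lim (\<lambda>m. near_time m \<omega>)" for \<omega>
  have lim: "(\<lambda>m. near_time m \<omega>) \<longlonglongrightarrow> \<rho> \<omega>" for \<omega>
  proof -
    obtain L where "(\<lambda>m. near_time m \<omega>) \<longlonglongrightarrow> L"
      using incseq_convergent[OF near_time_mono] near_time_range(2) by metis
    then show ?thesis unfolding \<rho>_def using limI by force
  qed
  have \<rho>: "\<rho> \<in> ST" by (rule ST_LIM_incseq[OF near_time_ST near_time_mono lim])
  have "AE \<omega> in M. \<exists>L. (\<lambda>m. U (near_time m \<omega>) \<omega>) \<longlonglongrightarrow> L \<and> L \<le> U (\<rho> \<omega>) \<omega>"
    by (rule U_left[OF near_time_ST near_time_mono lim])
  then have L: "AE \<omega> in M. (\<lambda>m. U (near_time m \<omega>) \<omega>) \<longlonglongrightarrow> lim (\<lambda>m. U (near_time m \<omega>) \<omega>)"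
    and L_le: "AE \<omega> in M. lim (\<lambda>m. U (near_time m \<omega>) \<omega>) \<le> U (\<rho> \<omega>) \<omega>"
    by (auto simp: limI elim!: eventually_mono)
  note LU = U_integral_LIMSEQ[OF near_time_ST L]
  have opt: "mean_at U \<nu> \<le> mean_at U \<rho>" if "\<nu> \<in> ST" for \<nu>
  proof -
    have "(\<lambda>m. mean_at U (near_time m) + inverse (real (Suc m)))
        \<longlonglongrightarrow> (\<integral>\<omega>. lim (\<lambda>m. U (near_time m \<omega>) \<omega>) \<partial>M)"
      using tendsto_add[OF LU(2) LIMSEQ_inverse_real_of_nat] by simp
    then have "mean_at U \<nu> \<le> (\<integral>\<omega>. lim (\<lambda>m. U (near_time m \<omega>) \<omega>) \<partial>M)"
      by (rule LIMSEQ_le_const) (use near_time_near_optimal[OF that] in auto)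
    also have "\<dots> \<le> mean_at U \<rho>"
      by (rule integral_mono_AE[OF LU(1) U_integrable[OF \<rho>] L_le])
    finally show ?thesis .
  qed
  have "AE \<omega> in M. W (\<rho> \<omega>) \<omega> - U (\<rho> \<omega>) \<omega> = 0"
  proof (rule integral_nonneg_eq_0_iff_AE[THEN iffD1])
    show i: "integrable M (\<lambda>\<omega>. W (\<rho> \<omega>) \<omega> - U (\<rho> \<omega>) \<omega>)" using W_integrable[OF \<rho>] U_integrable[OF \<rho>] by auto
    show nn: "AE \<omega> in M. 0 \<le> W (\<rho> \<omega>) \<omega> - U (\<rho> \<omega>) \<omega>" using U_le_W_ST[OF \<rho>] by eventually_elim simp
    have "(\<integral>\<omega>. W (\<rho> \<omega>) \<omega> - U (\<rho> \<omega>) \<omega> \<partial>M) \<le> 0"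
      using W_integral_le[OF \<rho> opt] W_integrable[OF \<rho>] U_integrable[OF \<rho>]
      by (subst Bochner_Integration.integral_diff) auto
    then show "(\<integral>\<omega>. W (\<rho> \<omega>) \<omega> - U (\<rho> \<omega>) \<omega> \<partial>M) = 0"
      using integral_nonneg_AE[OF nn] by linarith
  qed
  then have eq: "AE \<omega> in M. \<rho> \<omega> = first_meeting T W U \<omega>"
    using ST_AE_range[OF \<rho>]
  proof eventually_elim
    case (elim \<omega>)
    have "first_meeting T W U \<omega> \<le> \<rho> \<omega>"
      unfolding first_meeting_def using elim by (intro cInf_lower bdd_near) auto
    moreover have "\<rho> \<omega> \<le> first_meeting T W U \<omega>"
      by (rule LIMSEQ_le_const2[OF lim]) (use near_time_le_first_meeting in auto)
    ultimately show ?case by simp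
  qed
  show fm: "first_meeting T W U \<in> ST"
    by (rule ST_cong_AE[OF \<rho> _ eq]) (use order_trans[OF near_time_range(1) near_time_le_first_meeting] in auto)
  have "mean_at U \<rho> = mean_at U (first_meeting T W U)"
    by (rule integral_cong_AE) (use U_integrable[OF \<rho>] U_integrable[OF fm] eq in \<open>auto elim!: eventually_mono\<close>)
  then show "mean_at U \<nu> \<le> mean_at U (first_meeting T W U)" if "\<nu> \<in> ST"
    using opt[OF that] by simp
qed

end

section \<open>The stopping problem of one player\<close>

locale dynkin_player = dynkin_setting M F T
  for M :: "'a measure" and F T +
  fixes X Q Y :: "real \<Rightarrow> 'a \<Rightarrow> real"
  assumes X_prog: "progressively_measurable F T X" and X_D: "class_D M F T X"
    and Q_prog: "progressively_measurable F T Q" and Q_D: "class_D M F T Q"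
    and Y_prog: "progressively_measurable F T Y" and Y_D: "class_D M F T Y"
    and X_rcll: "rcll_paths M T X" and X_jumps: "no_negative_predictable_jumps M F T X"
    and Y_rc: "right_continuous_paths M T Y"
    and XQY: "AE \<omega> in M. \<forall>t\<in>{0..T}. X t \<omega> \<le> Q t \<omega> \<and> Q t \<omega> \<le> Y t \<omega>"
begin

section \<open>Regularity of the reward of one player\<close>

abbreviation Yt :: "real \<Rightarrow> 'a \<Rightarrow> real" where
  "Yt \<equiv> Y_tilde T Q Y"

abbreviation V :: "('a \<Rightarrow> real) \<Rightarrow> real \<Rightarrow> 'a \<Rightarrow> real" where
  "V \<equiv> stopped_payoff T X Q Y"

lemma V_eq: "V \<theta> t \<omega> = (if t < \<theta> \<omega> then X t \<omega> else Yt (\<theta> \<omega>) \<omega>)"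
  by (simp add: stopped_payoff_def)

lemma Yt_T: "Yt T \<omega> = Q T \<omega>"
  and Yt_less: "t < T \<Longrightarrow> Yt t \<omega> = Y t \<omega>"
  by (auto simp: Y_tilde_def)

lemma X_rc: "right_continuous_paths M T X"
  using X_rcll by (simp add: rcll_paths_def)

lemma class_D_ui: "class_D M F T Z \<Longrightarrow> ui_family M {\<lambda>\<omega>. Z (\<nu> \<omega>) \<omega> | \<nu>. \<nu> \<in> ST}"
  unfolding class_D_def by (rule uniformly_integrable_ui_family)

lemma class_D_integrable: "class_D M F T Z \<Longrightarrow> \<nu> \<in> ST \<Longrightarrow> integrable M (\<lambda>\<omega>. Z (\<nu> \<omega>) \<omega>)"
  by (rule ui_familyD[OF class_D_ui]) auto

lemma progressively_measurable_at:
  assumes Z: "progressively_measurable F T Z" and t: "0 \<le> t" "t \<le> T"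
    and s: "s \<in> borel_measurable (F t)" "\<And>\<omega>. \<omega> \<in> space M \<Longrightarrow> 0 \<le> s \<omega> \<and> s \<omega> \<le> t"
  shows "(\<lambda>\<omega>. Z (s \<omega>) \<omega>) \<in> borel_measurable (F t)"
proof -
  have "(\<lambda>(s, \<omega>). Z s \<omega>) \<in> borel_measurable (restrict_space borel {0..t} \<Otimes>\<^sub>M F t)"
    using Z t by (auto simp: progressively_measurable_def)
  moreover have "(\<lambda>\<omega>. (s \<omega>, \<omega>)) \<in> F t \<rightarrow>\<^sub>M (restrict_space borel {0..t} \<Otimes>\<^sub>M F t)"
    by (intro measurable_Pair measurable_restrict_space2) (use s in \<open>auto simp: space_F\<close>)
  ultimately have "(\<lambda>\<omega>. (\<lambda>(s, \<omega>). Z s \<omega>) (s \<omega>, \<omega>)) \<in> borel_measurable (F t)"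
    by (rule measurable_compose[rotated])
  then show ?thesis by simp
qed

lemma min_ST_measurable:
  assumes "\<theta> \<in> ST"
  shows "(\<lambda>\<omega>. min (\<theta> \<omega>) t) \<in> borel_measurable (F t)"
proof (rule borel_measurableI_le)
  fix s
  show "{\<omega>\<in>space (F t). min (\<theta> \<omega>) t \<le> s} \<in> sets (F t)"
  proof (cases "t \<le> s")
    case True
    then have "{\<omega>\<in>space (F t). min (\<theta> \<omega>) t \<le> s} = space (F t)" by auto
    then show ?thesis by simp
  next
    case False
    then have "{\<omega>\<in>space (F t). min (\<theta> \<omega>) t \<le> s} = {\<omega>\<in>space M. \<theta> \<omega> \<le> s}" by (auto simp: space_F)
    then show ?thesis using ST_le_sets[OF assms, of s] sets_F_mono[of s t] False by auto
  qed
qed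

text \<open>Progressive measurability gives \<open>Y\<close> only at random times up to
  \<open>t\<close>, so \<open>Y\<close> is read at the earlier of \<theta> and \<open>t\<close>,
  which is \<theta> once \<theta> has occurred. At \<open>t = T\<close> the value \<open>Q T\<close>
  enters as well.\<close>

lemma V_adapted:
  assumes \<theta>: "\<theta> \<in> ST" and t: "0 \<le> t" "t \<le> T"
  shows "V \<theta> t \<in> borel_measurable (F t)"
proof -
  have [measurable]: "X t \<in> borel_measurable (F t)"
    by (rule progressively_measurable_at[OF X_prog t, of "\<lambda>_. t"]) (use t in auto)
  have [measurable]: "(\<lambda>\<omega>. Y (min (\<theta> \<omega>) t) \<omega>) \<in> borel_measurable (F t)"
    by (rule progressively_measurable_at[OF Y_prog t min_ST_measurable[OF \<theta>]]) (use t ST_nonneg[OF \<theta>] in auto)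
  have [measurable]: "Measurable.pred (F t) (\<lambda>\<omega>. t < \<theta> \<omega>)" using stopping_timeD2[OF ST_stopping_time[OF \<theta>]] .
  have [measurable]: "(\<lambda>\<omega>. min (\<theta> \<omega>) t) \<in> borel_measurable (F t)" by (rule min_ST_measurable[OF \<theta>])
  show ?thesis
  proof (cases "t = T")
    case False
    have "V \<theta> t \<omega> = (if t < \<theta> \<omega> then X t \<omega> else Y (min (\<theta> \<omega>) t) \<omega>)" for \<omega>
      using t False by (simp add: V_eq Yt_less min_def)
    then have "V \<theta> t = (\<lambda>\<omega>. if t < \<theta> \<omega> then X t \<omega> else Y (min (\<theta> \<omega>) t) \<omega>)" by (rule ext)
    then show ?thesis by simp
  next
    case True
    have [measurable]: "Q t \<in> borel_measurable (F t)"
      by (rule progressively_measurable_at[OF Q_prog t, of "\<lambda>_. t"]) (use t in auto)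
    have "V \<theta> t \<omega> = (if t < \<theta> \<omega> then X t \<omega> else if min (\<theta> \<omega>) t < t then Y (min (\<theta> \<omega>) t) \<omega> else Q t \<omega>)" for \<omega>
      using True by (auto simp: V_eq Y_tilde_def min_def)
    then have "V \<theta> t = (\<lambda>\<omega>. if t < \<theta> \<omega> then X t \<omega> else if min (\<theta> \<omega>) t < t then Y (min (\<theta> \<omega>) t) \<omega> else Q t \<omega>)"
      by (rule ext)
    then show ?thesis by simp
  qed
qed

lemma Yt_ST:
  assumes \<theta>: "\<theta> \<in> ST"
  shows Yt_integrable: "integrable M (\<lambda>\<omega>. Yt (\<theta> \<omega>) \<omega>)"
    and Yt_le: "\<bar>Yt (\<theta> \<omega>) \<omega>\<bar> \<le> \<bar>Q T \<omega>\<bar> + \<bar>Y (\<theta> \<omega>) \<omega>\<bar>"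
proof -
  show le: "\<bar>Yt (\<theta> \<omega>) \<omega>\<bar> \<le> \<bar>Q T \<omega>\<bar> + \<bar>Y (\<theta> \<omega>) \<omega>\<bar>" for \<omega> by (auto simp: Y_tilde_def)
  have Qi: "integrable M (Q T)" using class_D_integrable[OF Q_D ST_const[of T]] T_pos by simp
  have Yi: "integrable M (\<lambda>\<omega>. Y (\<theta> \<omega>) \<omega>)" by (rule class_D_integrable[OF Y_D \<theta>])
  have [measurable]: "Q T \<in> borel_measurable M" "(\<lambda>\<omega>. Y (\<theta> \<omega>) \<omega>) \<in> borel_measurable M" "\<theta> \<in> borel_measurable M"
    using Qi Yi ST_measurable[OF \<theta>] by (auto intro: borel_measurable_integrable)
  have m: "(\<lambda>\<omega>. Yt (\<theta> \<omega>) \<omega>) \<in> borel_measurable M" unfolding Y_tilde_def by measurable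
  have b: "integrable M (\<lambda>\<omega>. \<bar>Q T \<omega>\<bar> + \<bar>Y (\<theta> \<omega>) \<omega>\<bar>)" using Qi Yi by auto
  show "integrable M (\<lambda>\<omega>. Yt (\<theta> \<omega>) \<omega>)"
    by (rule Bochner_Integration.integrable_bound[OF b m]) (use le in auto)
qed

lemma V_measurable:
  assumes \<theta>: "\<theta> \<in> ST" and \<nu>: "\<nu> \<in> ST"
  shows "(\<lambda>\<omega>. V \<theta> (\<nu> \<omega>) \<omega>) \<in> borel_measurable M"
proof -
  have [measurable]: "\<theta> \<in> borel_measurable M" "\<nu> \<in> borel_measurable M"
    "(\<lambda>\<omega>. X (\<nu> \<omega>) \<omega>) \<in> borel_measurable M" "(\<lambda>\<omega>. Yt (\<theta> \<omega>) \<omega>) \<in> borel_measurable M"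
    using ST_measurable[OF \<theta>] ST_measurable[OF \<nu>] class_D_integrable[OF X_D \<nu>] Yt_integrable[OF \<theta>]
    by (auto intro: borel_measurable_integrable)
  show ?thesis unfolding V_eq by measurable
qed

text \<open>Uniformity over both times serves the limit of the construction, where the opponents'
  time \<theta> and the player's own time change together.\<close>

lemma V_ui: "ui_family M {\<lambda>\<omega>. V \<theta> (\<nu> \<omega>) \<omega> | \<theta> \<nu>. \<theta> \<in> ST \<and> \<nu> \<in> ST}"
proof -
  have Qi: "integrable M (Q T)" using class_D_integrable[OF Q_D ST_const[of T]] T_pos by simp
  have Yt_ui: "ui_family M {\<lambda>\<omega>. Yt (\<theta> \<omega>) \<omega> | \<theta>. \<theta> \<in> ST}"
  proof (rule ui_family_dominated_sum[OF ui_family_singleton[OF Qi] class_D_ui[OF Y_D]])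
    fix h assume "h \<in> {\<lambda>\<omega>. Yt (\<theta> \<omega>) \<omega> | \<theta>. \<theta> \<in> ST}"
    then obtain \<theta> where \<theta>: "\<theta> \<in> ST" and h: "h = (\<lambda>\<omega>. Yt (\<theta> \<omega>) \<omega>)" by blast
    have "(\<lambda>\<omega>. Y (\<theta> \<omega>) \<omega>) \<in> {\<lambda>\<omega>. Y (\<nu> \<omega>) \<omega> | \<nu>. \<nu> \<in> ST}" using \<theta> by blast
    moreover have "AE \<omega> in M. \<bar>h \<omega>\<bar> \<le> \<bar>Q T \<omega>\<bar> + \<bar>Y (\<theta> \<omega>) \<omega>\<bar>" unfolding h using Yt_le[OF \<theta>] by simp
    moreover have "h \<in> borel_measurable M" unfolding h using Yt_integrable[OF \<theta>] by (rule borel_measurable_integrable)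
    ultimately show "h \<in> borel_measurable M \<and> (\<exists>f\<in>{Q T}. \<exists>g\<in>{\<lambda>\<omega>. Y (\<nu> \<omega>) \<omega> | \<nu>. \<nu> \<in> ST}.
        AE \<omega> in M. \<bar>h \<omega>\<bar> \<le> \<bar>f \<omega>\<bar> + \<bar>g \<omega>\<bar>)"
      by (intro conjI bexI[of _ "Q T"] bexI[of _ "\<lambda>\<omega>. Y (\<theta> \<omega>) \<omega>"] singletonI)
  qed
  show ?thesis
  proof (rule ui_family_dominated_sum[OF class_D_ui[OF X_D] Yt_ui])
    fix h assume "h \<in> {\<lambda>\<omega>. V \<theta> (\<nu> \<omega>) \<omega> | \<theta> \<nu>. \<theta> \<in> ST \<and> \<nu> \<in> ST}"
    then obtain \<theta> \<nu> where \<theta>: "\<theta> \<in> ST" and \<nu>: "\<nu> \<in> ST" and h: "h = (\<lambda>\<omega>. V \<theta> (\<nu> \<omega>) \<omega>)" by blast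
    have "(\<lambda>\<omega>. X (\<nu> \<omega>) \<omega>) \<in> {\<lambda>\<omega>. X (\<nu> \<omega>) \<omega> | \<nu>. \<nu> \<in> ST}"
      "(\<lambda>\<omega>. Yt (\<theta> \<omega>) \<omega>) \<in> {\<lambda>\<omega>. Yt (\<theta> \<omega>) \<omega> | \<theta>. \<theta> \<in> ST}" using \<theta> \<nu> by blast+
    moreover have "AE \<omega> in M. \<bar>h \<omega>\<bar> \<le> \<bar>X (\<nu> \<omega>) \<omega>\<bar> + \<bar>Yt (\<theta> \<omega>) \<omega>\<bar>" unfolding h by (simp add: V_eq)
    moreover have "h \<in> borel_measurable M" unfolding h by (rule V_measurable[OF \<theta> \<nu>])
    ultimately show "h \<in> borel_measurable M \<and> (\<exists>f\<in>{\<lambda>\<omega>. X (\<nu> \<omega>) \<omega> | \<nu>. \<nu> \<in> ST}.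
        \<exists>g\<in>{\<lambda>\<omega>. Yt (\<theta> \<omega>) \<omega> | \<theta>. \<theta> \<in> ST}. AE \<omega> in M. \<bar>h \<omega>\<bar> \<le> \<bar>f \<omega>\<bar> + \<bar>g \<omega>\<bar>)"
      by (intro conjI bexI[of _ "\<lambda>\<omega>. X (\<nu> \<omega>) \<omega>"] bexI[of _ "\<lambda>\<omega>. Yt (\<theta> \<omega>) \<omega>"])
  qed
qed

lemma V_integrable: "\<theta> \<in> ST \<Longrightarrow> \<nu> \<in> ST \<Longrightarrow> integrable M (\<lambda>\<omega>. V \<theta> (\<nu> \<omega>) \<omega>)"
  by (rule ui_familyD[OF V_ui]) blast

lemma V_rc: "right_continuous_paths M T (V \<theta>)"
  using X_rc unfolding right_continuous_paths_def
proof eventually_elim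
  case (elim \<omega>)
  show ?case
  proof (intro allI impI)
    fix t assume t: "0 \<le> t \<and> t < T"
    show "((\<lambda>s. V \<theta> s \<omega>) \<longlongrightarrow> V \<theta> t \<omega>) (at_right t)"
    proof (cases "t < \<theta> \<omega>")
      case True
      have "\<forall>\<^sub>F s in at_right t. X s \<omega> = V \<theta> s \<omega>"
        unfolding eventually_at_right_field using True by (auto simp: V_eq)
      moreover have "((\<lambda>s. X s \<omega>) \<longlongrightarrow> V \<theta> t \<omega>) (at_right t)" using elim t True by (simp add: V_eq)
      ultimately show ?thesis by (rule Lim_transform_eventually[rotated])
    next
      case False
      have "\<forall>\<^sub>F s in at_right t. V \<theta> s \<omega> = V \<theta> t \<omega>"
        unfolding eventually_at_right_field using False by (auto simp: V_eq intro!: exI[of _ "t + 1"])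
      then show ?thesis by (rule tendsto_eventually)
    qed
  qed
qed

lemma Yt_rc: "right_continuous_paths M T Yt"
  using Y_rc unfolding right_continuous_paths_def
proof eventually_elim
  case (elim \<omega>)
  show ?case
  proof (intro allI impI)
    fix t assume t: "0 \<le> t \<and> t < T"
    have "\<forall>\<^sub>F s in at_right t. Y s \<omega> = Yt s \<omega>"
      unfolding eventually_at_right_field using t by (auto simp: Yt_less)
    moreover have "((\<lambda>s. Y s \<omega>) \<longlongrightarrow> Yt t \<omega>) (at_right t)" using elim t by (simp add: Yt_less)
    ultimately show "((\<lambda>s. Yt s \<omega>) \<longlongrightarrow> Yt t \<omega>) (at_right t)" by (rule Lim_transform_eventually[rotated])
  qed
qed

lemma X_le_Yt: "AE \<omega> in M. \<forall>t\<in>{0..T}. X t \<omega> \<le> Yt t \<omega> \<and> Q t \<omega> \<le> Yt t \<omega>"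
  using XQY
proof eventually_elim
  case (elim \<omega>)
  show ?case
  proof
    fix t assume t: "t \<in> {0..T}"
    then show "X t \<omega> \<le> Yt t \<omega> \<and> Q t \<omega> \<le> Yt t \<omega>"
      using elim[rule_format, OF t] by (cases "t = T") (auto simp: Yt_T Yt_less)
  qed
qed

text \<open>
  The event that an increasing sequence of stopping times never reaches its limit \<open>\<rho>\<close> need not be all
  of the space; sending \<open>\<rho>\<close> to \<open>T\<close> off this event, along \<open>T - T / (k + 1)\<close>, gives a predictable time.
\<close>

lemma X_left_limit:
  assumes \<sigma>: "\<And>n. \<sigma> n \<in> ST" and inc: "\<And>\<omega>. \<omega> \<in> space M \<Longrightarrow> incseq (\<lambda>n. \<sigma> n \<omega>)"
    and lim: "\<And>\<omega>. \<omega> \<in> space M \<Longrightarrow> (\<lambda>n. \<sigma> n \<omega>) \<longlonglongrightarrow> \<rho> \<omega>"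
  shows "AE \<omega> in M. (\<forall>n. \<sigma> n \<omega> < \<rho> \<omega>) \<longrightarrow>
    (\<exists>L. (\<lambda>n::nat. X (\<sigma> n \<omega>) \<omega>) \<longlonglongrightarrow> L \<and> L \<le> X (\<rho> \<omega>) \<omega>)"
proof -
  have \<rho>: "\<rho> \<in> ST" by (rule ST_LIM_incseq[OF \<sigma> inc lim])
  define c where "c k = T - T * inverse (real (Suc k))" for k
  have c: "0 \<le> c k" "c k < T" for k
  proof -
    have "inverse (real (Suc k)) \<le> 1" by (simp add: inverse_le_1_iff del: of_nat_Suc)
    then have "T * inverse (real (Suc k)) \<le> T * 1" using T_pos by (intro mult_left_mono) auto
    then show "0 \<le> c k" by (simp add: c_def)
    show "c k < T" using T_pos by (simp add: c_def del: of_nat_Suc)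
  qed
  have c_inc: "incseq c"
  proof (rule incseq_SucI)
    fix k
    have "inverse (real (Suc (Suc k))) \<le> inverse (real (Suc k))" by (simp add: field_simps)
    then have "T * inverse (real (Suc (Suc k))) \<le> T * inverse (real (Suc k))"
      using T_pos by (intro mult_left_mono) auto
    then show "c k \<le> c (Suc k)" by (simp add: c_def)
  qed
  have c_lim: "c \<longlonglongrightarrow> T"
    unfolding c_def using tendsto_diff[OF tendsto_const[of T] tendsto_mult[OF tendsto_const[of T] LIMSEQ_inverse_real_of_nat]]
    by simp
  \<comment> \<open>The cap \<open>c k\<close> applies in both branches: it keeps the sequence
    increasing when \<sigma> reaches \<rho> and the value switches to \<open>T\<close>, and it keeps
    every term strictly below \<open>T\<close>. On the event of interest it has no effect on the
    limit, as \<open>c k\<close> tends to \<open>T\<close>.\<close>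
  define S where "S k \<omega> = min (if \<sigma> k \<omega> < \<rho> \<omega> then \<sigma> k \<omega> else T) (c k)" for k \<omega>
  define \<pi> where "\<pi> \<omega> = (if \<forall>n. \<sigma> n \<omega> < \<rho> \<omega> then min (\<rho> \<omega>) T else T)" for \<omega>
  have S: "S k \<in> ST" for k
  proof -
    have "AE \<omega> in M. \<not> \<sigma> k \<omega> < \<rho> \<omega> \<longrightarrow> \<sigma> k \<omega> \<le> T"
      using ST_AE_le[OF \<sigma>, of k] by eventually_elim simp
    then show ?thesis
      unfolding S_def using c[of k] T_pos
      by (intro ST_min ST_const ST_If_less[OF \<sigma> \<rho> \<sigma>]) auto
  qed
  have S_inc: "incseq (\<lambda>k. S k \<omega>)" if \<omega>: "\<omega> \<in> space M" for \<omega>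
  proof (rule incseq_SucI)
    fix k
    have "\<sigma> k \<omega> \<le> \<sigma> (Suc k) \<omega>" by (rule incseqD[OF inc[OF \<omega>]]) simp
    moreover have "c k \<le> c (Suc k)" by (rule incseqD[OF c_inc]) simp
    ultimately show "S k \<omega> \<le> S (Suc k) \<omega>" using c[of "Suc k"] c[of k] by (auto simp: S_def min_def)
  qed
  have S_lim: "(\<lambda>k. S k \<omega>) \<longlonglongrightarrow> \<pi> \<omega>" if \<omega>: "\<omega> \<in> space M" for \<omega>
  proof (cases "\<forall>n. \<sigma> n \<omega> < \<rho> \<omega>")
    case True
    then have "(\<lambda>k. S k \<omega>) = (\<lambda>k. min (\<sigma> k \<omega>) (c k))" by (simp add: S_def)
    then show ?thesis using True tendsto_min[OF lim[OF \<omega>] c_lim] by (simp add: \<pi>_def)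
  next
    case False
    then obtain n0 where n0: "\<rho> \<omega> \<le> \<sigma> n0 \<omega>" unfolding not_all not_less by blast
    have "S k \<omega> = c k" if "n0 \<le> k" for k
    proof -
      have "\<sigma> n0 \<omega> \<le> \<sigma> k \<omega>" by (rule incseqD[OF inc[OF \<omega>] that])
      then show ?thesis using n0 c[of k] by (simp add: S_def)
    qed
    then have "\<forall>\<^sub>F k in sequentially. c k = S k \<omega>"
      by (intro eventually_mono[OF eventually_ge_at_top[of n0]]) simp
    with c_lim have "(\<lambda>k. S k \<omega>) \<longlonglongrightarrow> T" by (rule Lim_transform_eventually)
    moreover have "\<pi> \<omega> = T" unfolding \<pi>_def using False by (rule if_not_P)
    ultimately show ?thesis by simp
  qed
  have "\<pi> \<in> ST" by (rule ST_LIM_incseq[OF S S_inc S_lim])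
  moreover have "AE \<omega> in M. incseq (\<lambda>k. S k \<omega>) \<and> (\<lambda>k. S k \<omega>) \<longlonglongrightarrow> \<pi> \<omega> \<and> (0 < \<pi> \<omega> \<longrightarrow> (\<forall>k. S k \<omega> < \<pi> \<omega>))"
    using ST_AE_le[OF \<rho>] AE_space
  proof eventually_elim
    case (elim \<omega>)
    have "S k \<omega> < \<pi> \<omega>" for k
    proof (cases "\<forall>n. \<sigma> n \<omega> < \<rho> \<omega>")
      case True
      then have "S k \<omega> \<le> \<sigma> k \<omega>" by (simp add: S_def)
      also have "\<sigma> k \<omega> < \<rho> \<omega>" using True by blast
      finally show ?thesis using True elim(1) by (simp add: \<pi>_def)
    next
      case False
      have "S k \<omega> \<le> c k" by (simp add: S_def)
      moreover have "\<pi> \<omega> = T" unfolding \<pi>_def using False by (rule if_not_P)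
      ultimately show ?thesis using c(2)[of k] by linarith
    qed
    then show ?case using S_inc S_lim elim(2) by blast
  qed
  ultimately have "predictable_stopping_time M F T \<pi>"
    unfolding predictable_stopping_time_def using S by blast
  then have jump: "AE \<omega> in M. left_limit X (\<pi> \<omega>) \<omega> \<le> X (\<pi> \<omega>) \<omega>"
    using X_jumps unfolding no_negative_predictable_jumps_def by blast
  have "AE \<omega> in M. \<forall>t. 0 < t \<and> t \<le> T \<longrightarrow> (\<exists>l. ((\<lambda>s. X s \<omega>) \<longlongrightarrow> l) (at_left t))"
    using X_rcll by (simp add: rcll_paths_def)
  then show ?thesis using jump ST_AE_le[OF \<rho>] AE_space
  proof eventually_elim
    case (elim \<omega>)
    show ?case
    proof
      assume less: "\<forall>n. \<sigma> n \<omega> < \<rho> \<omega>"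
      then have \<pi>: "\<pi> \<omega> = \<rho> \<omega>" using elim(3) by (simp add: \<pi>_def)
      have pos: "0 < \<rho> \<omega>" using less ST_nonneg[OF \<sigma> elim(4), of 0] by (metis order_le_less_trans)
      then obtain l where l: "((\<lambda>s. X s \<omega>) \<longlongrightarrow> l) (at_left (\<rho> \<omega>))" using elim(1,3) by blast
      have "left_limit X (\<rho> \<omega>) \<omega> = l"
        unfolding left_limit_def using pos tendsto_Lim[OF _ l] by (simp add: trivial_limit_at_left_real)
      moreover have "filterlim (\<lambda>n. \<sigma> n \<omega>) (at_left (\<rho> \<omega>)) sequentially"
        unfolding filterlim_at using less lim[OF elim(4)] by (auto simp: less_imp_neq)
      then have "(\<lambda>n. X (\<sigma> n \<omega>) \<omega>) \<longlonglongrightarrow> l" by (rule filterlim_compose[OF l])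
      ultimately show "\<exists>L. (\<lambda>n. X (\<sigma> n \<omega>) \<omega>) \<longlonglongrightarrow> L \<and> L \<le> X (\<rho> \<omega>) \<omega>"
        using elim(2) \<pi> by auto
    qed
  qed
qed

text \<open>The critical sequences are those that never reach \<rho>, since otherwise the rewards
  are eventually constant. Before \<theta> the reward is \<open>X\<close>, and if \<rho> = \<theta>
  it switches from \<open>X\<close> to \<open>Yt\<close>, an upward move by X \<le> Yt; from
  \<theta> on it is constant.\<close>

lemma V_left:
  assumes \<theta>: "\<theta> \<in> ST" and \<sigma>: "\<And>n. \<sigma> n \<in> ST"
    and inc: "\<And>\<omega>. \<omega> \<in> space M \<Longrightarrow> incseq (\<lambda>n. \<sigma> n \<omega>)"
    and lim: "\<And>\<omega>. \<omega> \<in> space M \<Longrightarrow> (\<lambda>n. \<sigma> n \<omega>) \<longlonglongrightarrow> \<rho> \<omega>"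
  shows "AE \<omega> in M. \<exists>L. (\<lambda>n::nat. V \<theta> (\<sigma> n \<omega>) \<omega>) \<longlonglongrightarrow> L \<and> L \<le> V \<theta> (\<rho> \<omega>) \<omega>"
proof -
  have "AE \<omega> in M. (\<forall>n. \<sigma> n \<omega> < \<rho> \<omega>) \<longrightarrow>
      (\<exists>L. (\<lambda>n::nat. X (\<sigma> n \<omega>) \<omega>) \<longlonglongrightarrow> L \<and> L \<le> X (\<rho> \<omega>) \<omega>)"
    by (rule X_left_limit[OF \<sigma> inc lim])
  then show ?thesis
    using X_le_Yt ST_AE_range[OF \<theta>] AE_space
  proof eventually_elim
    case (elim \<omega>)
    have le: "\<sigma> n \<omega> \<le> \<rho> \<omega>" for n using incseq_le[OF inc lim] elim(4) by blast
    show ?case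
    proof (cases "\<forall>n. \<sigma> n \<omega> < \<rho> \<omega>")
      case False
      then obtain n0 where n0: "\<rho> \<omega> \<le> \<sigma> n0 \<omega>" unfolding not_all not_less by blast
      have "\<sigma> k \<omega> = \<rho> \<omega>" if "n0 \<le> k" for k
      proof -
        have "\<sigma> n0 \<omega> \<le> \<sigma> k \<omega>" by (rule incseqD[OF inc[OF elim(4)] that])
        then show ?thesis using n0 le[of k] by simp
      qed
      then have "\<forall>\<^sub>F k in sequentially. V \<theta> (\<sigma> k \<omega>) \<omega> = V \<theta> (\<rho> \<omega>) \<omega>"
        by (intro eventually_mono[OF eventually_ge_at_top[of n0]]) simp
      then have "(\<lambda>k. V \<theta> (\<sigma> k \<omega>) \<omega>) \<longlonglongrightarrow> V \<theta> (\<rho> \<omega>) \<omega>" by (rule tendsto_eventually)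
      then show ?thesis by blast
    next
      case True
      show ?thesis
      proof (cases "\<rho> \<omega> \<le> \<theta> \<omega>")
        case le: True
        obtain L where L: "(\<lambda>n. X (\<sigma> n \<omega>) \<omega>) \<longlonglongrightarrow> L" "L \<le> X (\<rho> \<omega>) \<omega>" using elim(1) True by blast
        have eq: "V \<theta> (\<sigma> n \<omega>) \<omega> = X (\<sigma> n \<omega>) \<omega>" for n
          using True le by (simp add: V_eq order_less_le_trans[of _ "\<rho> \<omega>"])
        have "X (\<rho> \<omega>) \<omega> \<le> V \<theta> (\<rho> \<omega>) \<omega>"
          using le elim(2,3) by (cases "\<rho> \<omega> < \<theta> \<omega>") (auto simp: V_eq)
        then show ?thesis using L unfolding eq by (auto intro: order_trans)
      next
        case False
        then have "\<forall>\<^sub>F n in sequentially. \<theta> \<omega> < \<sigma> n \<omega>"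
          using order_tendstoD(1)[OF lim[OF elim(4)]] by auto
        then have "\<forall>\<^sub>F n in sequentially. V \<theta> (\<sigma> n \<omega>) \<omega> = V \<theta> (\<rho> \<omega>) \<omega>"
          using False by (auto simp: V_eq elim!: eventually_mono)
        then have "(\<lambda>k. V \<theta> (\<sigma> k \<omega>) \<omega>) \<longlonglongrightarrow> V \<theta> (\<rho> \<omega>) \<omega>" by (rule tendsto_eventually)
        then show ?thesis by blast
      qed
    qed
  qed
qed

lemma optimal_stopping_V:
  assumes \<theta>: "\<theta> \<in> ST" and W: "snell_envelope M F T (V \<theta>) W"
  shows "optimal_stopping M F T (V \<theta>) W"
proof
  show "V \<theta> t \<in> borel_measurable (F t)" if "0 \<le> t" "t \<le> T" for t by (rule V_adapted[OF \<theta> that])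
  show "ui_family M ((\<lambda>\<nu> \<omega>. V \<theta> (\<nu> \<omega>) \<omega>) ` ST)"
    by (rule ui_family_mono[OF V_ui]) (use \<theta> in blast)
  show "right_continuous_paths M T (V \<theta>)" by (rule V_rc)
  show "snell_envelope M F T (V \<theta>) W" by (rule W)
qed (rule V_left[OF \<theta>])

text \<open>The reward at \<open>t q\<close> can fail to converge only where \<open>S = R\<close>:
  there it is close to \<open>X\<close> or to \<open>Yt\<close> according to who is ahead at index
  \<open>q\<close>. Adding \<open>d q\<close> fills the gap up to \<open>Yt\<close>, and the sum
  converges to the limiting reward. Comparison with the strategy derived from \<open>S\<close>
  itself bounds the mean of \<open>d q\<close> by a quantity tending to 0, while nonnegativity of
  \<open>d q\<close> transfers optimality to the limit.\<close>

theorem optimality_limit: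
  assumes t: "\<And>q::nat. t q \<in> ST" and \<theta>: "\<And>q. \<theta> q \<in> ST" and S: "S \<in> ST" and R: "R \<in> ST"
    and t_le: "\<And>q \<omega>. \<omega> \<in> space M \<Longrightarrow> S \<omega> \<le> t q \<omega> \<and> t q \<omega> \<le> T"
    and \<theta>_le: "\<And>q \<omega>. \<omega> \<in> space M \<Longrightarrow> R \<omega> \<le> \<theta> q \<omega> \<and> \<theta> q \<omega> \<le> T"
    and t_lim: "\<And>\<omega>. \<omega> \<in> space M \<Longrightarrow> (\<lambda>q. t q \<omega>) \<longlonglongrightarrow> S \<omega>"
    and \<theta>_lim: "\<And>\<omega>. \<omega> \<in> space M \<Longrightarrow> (\<lambda>q. \<theta> q \<omega>) \<longlonglongrightarrow> R \<omega>"
    and opt: "\<And>q \<nu>. \<nu> \<in> ST \<Longrightarrow> mean_at (V (\<theta> q)) \<nu> \<le> mean_at (V (\<theta> q)) (t q)"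
  defines "d \<equiv> \<lambda>q \<omega>. (Yt (R \<omega>) \<omega> - X (S \<omega>) \<omega>) * of_bool (t q \<omega> < \<theta> q \<omega> \<and> S \<omega> = R \<omega>)"
  shows "integrable M (d q)" and "AE \<omega> in M. 0 \<le> d q \<omega>" and "(\<lambda>q. \<integral>\<omega>. d q \<omega> \<partial>M) \<longlonglongrightarrow> 0"
    and "\<nu> \<in> ST \<Longrightarrow> mean_at (V R) \<nu> \<le> mean_at (V R) S"
proof -
  have XS: "integrable M (\<lambda>\<omega>. X (S \<omega>) \<omega>)" by (rule class_D_integrable[OF X_D S])
  have YR: "integrable M (\<lambda>\<omega>. Yt (R \<omega>) \<omega>)" by (rule Yt_integrable[OF R])
  have bound: "integrable M (\<lambda>\<omega>. \<bar>Yt (R \<omega>) \<omega>\<bar> + \<bar>X (S \<omega>) \<omega>\<bar>)" using XS YR by auto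
  have [measurable]: "(\<lambda>\<omega>. X (S \<omega>) \<omega>) \<in> borel_measurable M" "(\<lambda>\<omega>. Yt (R \<omega>) \<omega>) \<in> borel_measurable M"
    using XS YR by (auto intro: borel_measurable_integrable)
  have [measurable]: "S \<in> borel_measurable M" "R \<in> borel_measurable M"
    "t q \<in> borel_measurable M" "\<theta> q \<in> borel_measurable M" for q
    using ST_measurable S R t \<theta> by auto
  have dm[measurable]: "d q \<in> borel_measurable M" for q unfolding d_def by measurable
  have d_le: "\<bar>d q \<omega>\<bar> \<le> \<bar>Yt (R \<omega>) \<omega>\<bar> + \<bar>X (S \<omega>) \<omega>\<bar>" for q \<omega>
    using abs_triangle_ineq4[of "Yt (R \<omega>) \<omega>" "X (S \<omega>) \<omega>"] by (auto simp: d_def)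
  show di: "integrable M (d q)" for q
    by (rule Bochner_Integration.integrable_bound[OF bound dm]) (use d_le in auto)
  show dn: "AE \<omega> in M. 0 \<le> d q \<omega>" for q
    using X_le_Yt ST_AE_range[OF S] ST_AE_range[OF R]
    by eventually_elim (auto simp: d_def)
  have YLIM: "AE \<omega> in M. (\<lambda>q. Yt (\<theta> q \<omega>) \<omega>) \<longlonglongrightarrow> Yt (R \<omega>) \<omega>"
    using right_continuous_paths_LIMSEQ[OF Yt_rc] AE_space
    by eventually_elim (use \<theta>_le \<theta>_lim ST_nonneg[OF R] in auto)
  have XLIM: "AE \<omega> in M. (\<lambda>q. X (t q \<omega>) \<omega>) \<longlonglongrightarrow> X (S \<omega>) \<omega>"
    using right_continuous_paths_LIMSEQ[OF X_rc] AE_space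
    by eventually_elim (use t_le t_lim ST_nonneg[OF S] in auto)
  let ?g = "\<lambda>q \<omega>. V (\<theta> q) (t q \<omega>) \<omega> + d q \<omega>"
  have lim1: "AE \<omega> in M. (\<lambda>q. ?g q \<omega>) \<longlonglongrightarrow> V R (S \<omega>) \<omega>"
    using YLIM XLIM AE_space
  proof eventually_elim
    case (elim \<omega>)
    note tl = t_lim[OF elim(3)] and \<theta>l = \<theta>_lim[OF elim(3)]
    consider "S \<omega> < R \<omega>" | "R \<omega> < S \<omega>" | "S \<omega> = R \<omega>" by linarith
    then show ?case
    proof cases
      case 1
      then have "\<forall>\<^sub>F q in sequentially. t q \<omega> < R \<omega>" by (rule order_tendstoD(2)[OF tl])
      then have "\<forall>\<^sub>F q in sequentially. X (t q \<omega>) \<omega> = ?g q \<omega>"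
      proof eventually_elim
        case (elim q)
        then have "t q \<omega> < \<theta> q \<omega>" using \<theta>_le[OF \<open>\<omega> \<in> space M\<close>, of q] by linarith
        then show ?case using 1 by (simp add: V_eq d_def)
      qed
      with elim(2) have "(\<lambda>q. ?g q \<omega>) \<longlonglongrightarrow> X (S \<omega>) \<omega>" by (rule Lim_transform_eventually)
      then show ?thesis using 1 by (simp add: V_eq)
    next
      case 2
      then have "\<forall>\<^sub>F q in sequentially. \<theta> q \<omega> < S \<omega>" by (rule order_tendstoD(2)[OF \<theta>l])
      then have "\<forall>\<^sub>F q in sequentially. Yt (\<theta> q \<omega>) \<omega> = ?g q \<omega>"
      proof eventually_elim
        case (elim q)
        then have "\<not> t q \<omega> < \<theta> q \<omega>" using t_le[OF \<open>\<omega> \<in> space M\<close>, of q] by linarith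
        then show ?case using 2 by (simp add: V_eq d_def)
      qed
      with elim(1) have "(\<lambda>q. ?g q \<omega>) \<longlonglongrightarrow> Yt (R \<omega>) \<omega>" by (rule Lim_transform_eventually)
      then show ?thesis using 2 by (simp add: V_eq)
    next
      case 3
      let ?e = "\<lambda>q. \<bar>Yt (\<theta> q \<omega>) \<omega> - Yt (R \<omega>) \<omega>\<bar> + \<bar>X (t q \<omega>) \<omega> - X (S \<omega>) \<omega>\<bar>"
      have "?e \<longlonglongrightarrow> \<bar>Yt (R \<omega>) \<omega> - Yt (R \<omega>) \<omega>\<bar> + \<bar>X (S \<omega>) \<omega> - X (S \<omega>) \<omega>\<bar>"
        using elim(1,2) by (intro tendsto_intros)
      then have e0: "?e \<longlonglongrightarrow> 0" by simp
      have "norm (?g q \<omega> - Yt (R \<omega>) \<omega>) \<le> ?e q" for q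
        using 3 by (simp add: V_eq d_def)
      then have "\<forall>\<^sub>F q in sequentially. norm (?g q \<omega> - Yt (R \<omega>) \<omega>) \<le> ?e q"
        by (intro always_eventually allI)
      then have "(\<lambda>q. ?g q \<omega> - Yt (R \<omega>) \<omega>) \<longlonglongrightarrow> 0" using e0 by (rule Lim_null_comparison)
      then have "(\<lambda>q. ?g q \<omega>) \<longlonglongrightarrow> Yt (R \<omega>) \<omega>" by (rule LIM_zero_cancel)
      then show ?thesis using 3 by (simp add: V_eq)
    qed
  qed
  have gm: "?g q \<in> borel_measurable M" for q using V_measurable[OF \<theta> t] by measurable
  have ui1: "ui_family M (range ?g)"
  proof (rule ui_family_dominated_sum[OF V_ui ui_family_singleton[OF bound]])
    fix h assume "h \<in> range ?g"
    then obtain q where h: "h = ?g q" by blast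
    have "(\<lambda>\<omega>. V (\<theta> q) (t q \<omega>) \<omega>) \<in> {\<lambda>\<omega>. V \<theta> (\<nu> \<omega>) \<omega> | \<theta> \<nu>. \<theta> \<in> ST \<and> \<nu> \<in> ST}" using t \<theta> by blast
    moreover have "AE \<omega> in M. \<bar>h \<omega>\<bar> \<le> \<bar>V (\<theta> q) (t q \<omega>) \<omega>\<bar> + \<bar>\<bar>Yt (R \<omega>) \<omega>\<bar> + \<bar>X (S \<omega>) \<omega>\<bar>\<bar>"
    proof (intro AE_I2)
      fix \<omega>
      show "\<bar>h \<omega>\<bar> \<le> \<bar>V (\<theta> q) (t q \<omega>) \<omega>\<bar> + \<bar>\<bar>Yt (R \<omega>) \<omega>\<bar> + \<bar>X (S \<omega>) \<omega>\<bar>\<bar>"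
        unfolding h using d_le[of q \<omega>] by linarith
    qed
    moreover have "h \<in> borel_measurable M" unfolding h by (rule gm)
    ultimately show "h \<in> borel_measurable M \<and> (\<exists>f\<in>{\<lambda>\<omega>. V \<theta> (\<nu> \<omega>) \<omega> | \<theta> \<nu>. \<theta> \<in> ST \<and> \<nu> \<in> ST}.
        \<exists>g\<in>{\<lambda>\<omega>. \<bar>Yt (R \<omega>) \<omega>\<bar> + \<bar>X (S \<omega>) \<omega>\<bar>}. AE \<omega> in M. \<bar>h \<omega>\<bar> \<le> \<bar>f \<omega>\<bar> + \<bar>g \<omega>\<bar>)"
      by (intro conjI bexI[of _ "\<lambda>\<omega>. V (\<theta> q) (t q \<omega>) \<omega>"]
          bexI[of _ "\<lambda>\<omega>. \<bar>Yt (R \<omega>) \<omega>\<bar> + \<bar>X (S \<omega>) \<omega>\<bar>"] singletonI)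
  qed
  have "(\<lambda>q. \<integral>\<omega>. ?g q \<omega> \<partial>M) \<longlonglongrightarrow> mean_at (V R) S"
    by (rule vitali_convergence(2)[OF ui1 _ lim1 V_measurable[OF R S]]) auto
  then have LIM1: "(\<lambda>q. mean_at (V (\<theta> q)) (t q) + (\<integral>\<omega>. d q \<omega> \<partial>M)) \<longlonglongrightarrow> mean_at (V R) S"
    using Bochner_Integration.integral_add[OF V_integrable[OF \<theta> t] di] by simp
  \<comment> \<open>A strategy \<nu> that stops at or after \<open>R\<close> might still precede
    \<open>\<theta> q\<close> and collect \<open>X\<close> instead of \<open>Yt\<close>. Postponing
    it to \<open>T\<close> makes it yield to the opponents for every \<open>q\<close>.\<close>
  define \<nu>' where "\<nu>' \<nu> \<omega> = (if min (\<nu> \<omega>) T < R \<omega> then min (\<nu> \<omega>) T else T)" for \<nu> :: "'a \<Rightarrow> real" and \<omega>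
  have \<nu>': "\<nu>' \<nu> \<in> ST" if "\<nu> \<in> ST" for \<nu>
  proof -
    have T: "(\<lambda>_. T) \<in> ST" using ST_const[of T] T_pos by simp
    have m: "(\<lambda>\<omega>. min (\<nu> \<omega>) T) \<in> ST" by (rule ST_min[OF that T])
    show ?thesis unfolding \<nu>'_def by (rule ST_If_less[OF m R m T]) auto
  qed
  have LIM2: "(\<lambda>q. mean_at (V (\<theta> q)) (\<nu>' \<nu>)) \<longlonglongrightarrow> mean_at (V R) \<nu>" if \<nu>: "\<nu> \<in> ST" for \<nu>
  proof (rule vitali_convergence(2)[OF V_ui _ _ V_measurable[OF R \<nu>]])
    show "(\<lambda>\<omega>. V (\<theta> q) (\<nu>' \<nu> \<omega>) \<omega>) \<in> {\<lambda>\<omega>. V \<theta> (\<nu> \<omega>) \<omega> | \<theta> \<nu>. \<theta> \<in> ST \<and> \<nu> \<in> ST}" for q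
      using \<theta> \<nu>'[OF \<nu>] by blast
    show "AE \<omega> in M. (\<lambda>q. V (\<theta> q) (\<nu>' \<nu> \<omega>) \<omega>) \<longlonglongrightarrow> V R (\<nu> \<omega>) \<omega>"
      using YLIM ST_AE_range[OF \<nu>] AE_space
    proof eventually_elim
      case (elim \<omega>)
      show ?case
      proof (cases "\<nu> \<omega> < R \<omega>")
        case True
        then have "V (\<theta> q) (\<nu>' \<nu> \<omega>) \<omega> = V R (\<nu> \<omega>) \<omega>" for q
          using \<theta>_le[OF elim(3), of q] elim(2) by (simp add: \<nu>'_def V_eq)
        then show ?thesis by simp
      next
        case False
        then have "V (\<theta> q) (\<nu>' \<nu> \<omega>) \<omega> = Yt (\<theta> q \<omega>) \<omega>" for q
          using \<theta>_le[OF elim(3), of q] elim(2) by (simp add: \<nu>'_def V_eq)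
        then show ?thesis using False elim(1) by (simp add: V_eq)
      qed
    qed
  qed
  have dpos: "0 \<le> (\<integral>\<omega>. d q \<omega> \<partial>M)" for q by (rule integral_nonneg_AE[OF dn])
  have le: "mean_at (V (\<theta> q)) (\<nu>' \<nu>) \<le> mean_at (V (\<theta> q)) (t q)" if "\<nu> \<in> ST" for q \<nu>
    by (rule opt[OF \<nu>'[OF that]])
  show "(\<lambda>q. \<integral>\<omega>. d q \<omega> \<partial>M) \<longlonglongrightarrow> 0"
  proof (rule tendsto_sandwich[OF _ _ tendsto_const])
    show "(\<lambda>q. mean_at (V (\<theta> q)) (t q) + (\<integral>\<omega>. d q \<omega> \<partial>M) - mean_at (V (\<theta> q)) (\<nu>' S)) \<longlonglongrightarrow> 0"
      using tendsto_diff[OF LIM1 LIM2[OF S]] by simp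
    show "\<forall>\<^sub>F q in sequentially. (\<integral>\<omega>. d q \<omega> \<partial>M) \<le>
        mean_at (V (\<theta> q)) (t q) + (\<integral>\<omega>. d q \<omega> \<partial>M) - mean_at (V (\<theta> q)) (\<nu>' S)"
      using le[OF S] by simp
  qed (use dpos in simp)
  show "mean_at (V R) \<nu> \<le> mean_at (V R) S" if "\<nu> \<in> ST"
  proof (rule LIMSEQ_le[OF LIM2[OF that] LIM1], intro exI allI impI)
    fix q
    show "mean_at (V (\<theta> q)) (\<nu>' \<nu>) \<le> mean_at (V (\<theta> q)) (t q) + (\<integral>\<omega>. d q \<omega> \<partial>M)"
      using le[OF that, of q] dpos[of q] by linarith
  qed
qed

end

section \<open>The game\<close>

locale dynkin_game = dynkin_setting M F T
  for M :: "'a measure" and F T +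
  fixes N :: nat and X Q Y W :: "nat \<Rightarrow> real \<Rightarrow> 'a \<Rightarrow> real" and \<tau> :: "nat \<Rightarrow> 'a \<Rightarrow> real"
  assumes N_ge: "2 \<le> N"
    and player: "\<And>i. i \<in> {1..N} \<Longrightarrow> dynkin_player M F T (X i) (Q i) (Y i)"
    and strict: "\<And>i \<sigma>. i \<in> {1..N} \<Longrightarrow> \<sigma> \<in> stopping_times M F T (\<lambda>_. 0) \<Longrightarrow>
      AE \<omega> in M. Q i (\<sigma> \<omega>) \<omega> < Y i (\<sigma> \<omega>) \<omega> \<and> \<sigma> \<omega> < T \<longrightarrow>
        (\<forall>j\<in>{1..N}. X j (\<sigma> \<omega>) \<omega> < Y j (\<sigma> \<omega>) \<omega>)"
    and construction: "equilibrium_construction M F T N X Q Y W \<tau>"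
begin

abbreviation \<theta> :: "nat \<Rightarrow> 'a \<Rightarrow> real" where
  "\<theta> n \<equiv> theta_seq N \<tau> n"

section \<open>Pathwise structure of the construction\<close>

definition mover :: "nat \<Rightarrow> nat" where
  "mover n = Suc ((n - 1) mod N)"

definition V :: "nat \<Rightarrow> real \<Rightarrow> 'a \<Rightarrow> real" where
  "V n = stopped_payoff T (X (mover n)) (Q (mover n)) (Y (mover n)) (\<theta> n)"

definition \<mu> :: "nat \<Rightarrow> 'a \<Rightarrow> real" where
  "\<mu> n = first_meeting T (W n) (V n)"

lemma mover_range: "mover n \<in> {1..N}"
  using N_ge by (auto simp: mover_def Suc_le_eq)

lemma mover_eq: "1 \<le> n \<Longrightarrow> n = N * ((n - 1) div N) + mover n"
  unfolding mover_def using mult_div_mod_eq[of N "n - 1"] by linarith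

lemma mover_block: "i \<in> {1..N} \<Longrightarrow> mover (N * q + i) = i"
proof -
  assume i: "i \<in> {1..N}"
  then have "N * q + i - 1 = N * q + (i - 1)" by auto
  moreover have "(N * q + (i - 1)) mod N = i - 1" using i by (subst mod_mult_self4) auto
  ultimately have "(N * q + i - 1) mod N = i - 1" by (simp only:)
  then have "mover (N * q + i) = Suc (i - 1)" unfolding mover_def by (rule arg_cong)
  then show ?thesis using i by auto
qed

lemma \<tau>_init: "n \<in> {1..N} \<Longrightarrow> \<omega> \<in> space M \<Longrightarrow> \<tau> n \<omega> = T"
  using construction unfolding equilibrium_construction_def by blast

lemma construction_step:
  assumes "N < n"
  shows snell_W: "snell_envelope M F T (V n) (W n)"
    and \<tau>_step: "\<omega> \<in> space M \<Longrightarrow> \<tau> n \<omega> =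
      (if min (\<mu> n \<omega>) (\<tau> (n - N) \<omega>) < \<theta> n \<omega> then min (\<mu> n \<omega>) (\<tau> (n - N) \<omega>) else \<tau> (n - N) \<omega>)"
proof -
  have *: "n \<ge> N + 1 \<and> n = N * ((n - 1) div N) + mover n \<and> mover n \<in> {1..N}"
    using assms mover_eq[of n] mover_range by auto
  have "snell_envelope M F T (V n) (W n) \<and>
      (\<forall>\<omega>\<in>space M. \<tau> n \<omega> =
         min (\<mu> n \<omega>) (\<tau> (n - N) \<omega>) * of_bool (min (\<mu> n \<omega>) (\<tau> (n - N) \<omega>) < \<theta> n \<omega>)
         + \<tau> (n - N) \<omega> * of_bool (min (\<mu> n \<omega>) (\<tau> (n - N) \<omega>) \<ge> \<theta> n \<omega>))"
    using construction[unfolded equilibrium_construction_def Let_def] * unfolding V_def \<mu>_def by blast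
  then show "snell_envelope M F T (V n) (W n)"
    and "\<omega> \<in> space M \<Longrightarrow> \<tau> n \<omega> =
      (if min (\<mu> n \<omega>) (\<tau> (n - N) \<omega>) < \<theta> n \<omega> then min (\<mu> n \<omega>) (\<tau> (n - N) \<omega>) else \<tau> (n - N) \<omega>)"
    by auto
qed

lemma \<mu>_range: "0 \<le> \<mu> n \<omega>" "\<mu> n \<omega> \<le> T"
proof -
  show "0 \<le> \<mu> n \<omega>" unfolding \<mu>_def first_meeting_def
    by (rule cInf_greatest) (use T_pos in auto)
  show "\<mu> n \<omega> \<le> T" unfolding \<mu>_def first_meeting_def
    by (rule cInf_lower) (use T_pos in \<open>auto intro!: bdd_belowI[of _ 0]\<close>)
qed

lemma \<tau>_range:
  assumes "1 \<le> n" "\<omega> \<in> space M"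
  shows "0 \<le> \<tau> n \<omega> \<and> \<tau> n \<omega> \<le> T"
  using assms(1)
proof (induction n rule: less_induct)
  case (less n)
  show ?case
  proof (cases "n \<le> N")
    case True
    then show ?thesis using less.prems assms(2) \<tau>_init[of n \<omega>] T_pos by auto
  next
    case False
    then have "0 \<le> \<tau> (n - N) \<omega> \<and> \<tau> (n - N) \<omega> \<le> T" using N_ge by (intro less.IH) auto
    then show ?thesis using \<tau>_step[of n \<omega>] False assms(2) \<mu>_range[of n \<omega>] by auto
  qed
qed

lemma \<tau>_decreasing: "N < n \<Longrightarrow> \<omega> \<in> space M \<Longrightarrow> \<tau> n \<omega> \<le> \<tau> (n - N) \<omega>"
  using \<tau>_step[of n \<omega>] by auto

lemma \<theta>_le: "1 \<le> k \<Longrightarrow> k \<le> N - 1 \<Longrightarrow> \<theta> n \<omega> \<le> \<tau> (n - k) \<omega>"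
  unfolding theta_seq_def by (rule Min_le) auto

lemma \<theta>_attained: obtains k where "1 \<le> k" "k \<le> N - 1" "\<theta> n \<omega> = \<tau> (n - k) \<omega>"
proof -
  have "\<theta> n \<omega> \<in> (\<lambda>k. \<tau> (n - k) \<omega>) ` {1..N - 1}"
    unfolding theta_seq_def by (rule Min_in) (use N_ge in auto)
  then show thesis using that by auto
qed

text \<open>Different players never stop at the same time before \<open>T\<close>, since a player only moves strictly
  ahead of the others.\<close>

lemma \<tau>_distinct:
  assumes "\<omega> \<in> space M" "1 \<le> m" "m < n" "n - m < N" "\<tau> n \<omega> = \<tau> m \<omega>"
  shows "\<tau> n \<omega> = T"
  using assms(2-)
proof (induction n arbitrary: m rule: less_induct)
  case (less n)
  show ?case
  proof (cases "n \<le> N")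
    case True
    then show ?thesis using less.prems assms(1) \<tau>_init by auto
  next
    case False
    then have nN: "N < n" by simp
    have "\<theta> n \<omega> \<le> \<tau> (n - (n - m)) \<omega>" by (rule \<theta>_le) (use less.prems in auto)
    then have \<theta>m: "\<theta> n \<omega> \<le> \<tau> m \<omega>" using less.prems by simp
    \<comment> \<open>A strict move at step \<open>n\<close> would end before \<theta>, hence before
      \<open>\<tau> m\<close>. So the player stays, and the indices \<open>n - N\<close> and
      \<open>m\<close> are again less than \<open>N\<close> apart, with \<open>m\<close> now the
      later one.\<close>
    then have *: "\<tau> n \<omega> = \<tau> (n - N) \<omega>"
      using \<tau>_step[OF nN assms(1)] less.prems(4) by (auto split: if_splits)
    then have "\<tau> m \<omega> = \<tau> (n - N) \<omega>" using less.prems by simp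
    then have "\<tau> m \<omega> = T"
      using less.prems nN by (intro less.IH[of m "n - N"]) auto
    then show ?thesis using less.prems by simp
  qed
qed

text \<open>An opponent who moved after step \<open>n - N\<close> would have done so by getting
  strictly ahead of all others, in particular of \<open>\<tau> (n - N)\<close>. This contradicts
  that \<open>\<tau> (n - N)\<close> lies before every opponent's current time. The bound
  \<open>2 * N < n\<close> ensures that the steps \<open>n - k\<close> are moves and not initial
  values.\<close>

lemma \<theta>_unchanged:
  assumes "\<omega> \<in> space M" "2 * N < n" "\<tau> (n - N) \<omega> < \<theta> n \<omega>"
  shows "\<theta> n \<omega> = \<theta> (n - N) \<omega>"
proof -
  have "\<tau> (n - k) \<omega> = \<tau> (n - N - k) \<omega>" if k: "k \<in> {1..N - 1}" for k
  proof -
    have nk: "N < n - k" using assms(2) k by auto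
    have "\<theta> (n - k) \<omega> \<le> \<tau> (n - k - (N - k)) \<omega>" by (rule \<theta>_le) (use k N_ge in auto)
    also have "n - k - (N - k) = n - N" using k by auto
    finally have "\<theta> (n - k) \<omega> < \<tau> (n - k) \<omega>" using assms(3) \<theta>_le[of k n \<omega>] k by auto
    then have "\<tau> (n - k) \<omega> = \<tau> (n - k - N) \<omega>" using \<tau>_step[OF nk assms(1)] by (auto split: if_splits)
    then show ?thesis by (simp add: add.commute)
  qed
  then have "(\<lambda>k. \<tau> (n - k) \<omega>) ` {1..N - 1} = (\<lambda>k. \<tau> (n - N - k) \<omega>) ` {1..N - 1}"
    by (intro image_cong refl) auto
  then show ?thesis unfolding theta_seq_def by simp
qed

lemma mover_shift: "N < n \<Longrightarrow> mover (n - N) = mover n"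
proof -
  assume "N < n"
  then have "(n - 1) mod N = (n - N - 1) mod N" using le_mod_geq[of N "n - 1"] by auto
  then show ?thesis by (simp add: mover_def)
qed

lemma V_eq: "V n t \<omega> = (if t < \<theta> n \<omega> then X (mover n) t \<omega> else Y_tilde T (Q (mover n)) (Y (mover n)) (\<theta> n \<omega>) \<omega>)"
  by (simp add: V_def stopped_payoff_def)

section \<open>Optimality of every step\<close>

lemma \<theta>_ST:
  assumes "N < n" "\<And>m. m < n \<Longrightarrow> 1 \<le> m \<Longrightarrow> \<tau> m \<in> ST"
  shows "\<theta> n \<in> ST"
proof -
  have "(\<lambda>\<omega>. Min ((\<lambda>k. \<tau> (n - k) \<omega>) ` {1..N - 1})) \<in> ST"
    by (rule ST_Min) (use assms N_ge in auto)
  then show ?thesis by (simp add: theta_seq_def[abs_def])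
qed

lemma V_integrable:
  assumes "\<theta> n \<in> ST" "\<nu> \<in> ST"
  shows "integrable M (\<lambda>\<omega>. V n (\<nu> \<omega>) \<omega>)"
proof -
  interpret P: dynkin_player M F T "X (mover n)" "Q (mover n)" "Y (mover n)"
    by (rule player[OF mover_range])
  show ?thesis unfolding V_def by (rule P.V_integrable[OF assms])
qed

lemma \<mu>_optimal:
  assumes n: "N < n" and \<theta>: "\<theta> n \<in> ST"
  shows "\<mu> n \<in> ST" and "\<nu> \<in> ST \<Longrightarrow> mean_at (V n) \<nu> \<le> mean_at (V n) (\<mu> n)"
proof -
  interpret P: dynkin_player M F T "X (mover n)" "Q (mover n)" "Y (mover n)"
    by (rule player[OF mover_range])
  interpret O: optimal_stopping M F T "V n" "W n"
    using P.optimal_stopping_V[OF \<theta>] snell_W[OF n] unfolding V_def by blast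
  show "\<mu> n \<in> ST" unfolding \<mu>_def by (rule O.first_meeting_optimal(1))
  show "\<nu> \<in> ST \<Longrightarrow> mean_at (V n) \<nu> \<le> mean_at (V n) (\<mu> n)"
    unfolding \<mu>_def by (rule O.first_meeting_optimal(2))
qed

lemma \<tau>_ST: "1 \<le> n \<Longrightarrow> \<tau> n \<in> ST"
proof (induction n rule: less_induct)
  case (less n)
  show ?case
  proof (cases "n \<le> N")
    case True
    have "(\<lambda>_. T) \<in> ST" using ST_const[of T] T_pos by simp
    then show ?thesis
      by (rule ST_cong_AE) (use True less.prems \<tau>_init[of n] T_pos in auto)
  next
    case False
    then have n: "N < n" by simp
    have \<theta>: "\<theta> n \<in> ST" by (rule \<theta>_ST[OF n less.IH])
    have \<tau>': "\<tau> (n - N) \<in> ST" using n N_ge by (intro less.IH) auto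
    have \<kappa>: "(\<lambda>\<omega>. min (\<mu> n \<omega>) (\<tau> (n - N) \<omega>)) \<in> ST" by (rule ST_min[OF \<mu>_optimal(1)[OF n \<theta>] \<tau>'])
    have "(\<lambda>\<omega>. if min (\<mu> n \<omega>) (\<tau> (n - N) \<omega>) < \<theta> n \<omega> then min (\<mu> n \<omega>) (\<tau> (n - N) \<omega>) else \<tau> (n - N) \<omega>) \<in> ST"
      by (rule ST_If_less[OF \<kappa> \<theta> \<kappa> \<tau>']) auto
    then show ?thesis
      by (rule ST_cong_AE) (use \<tau>_range[OF less.prems] \<tau>_step[OF n] in auto)
  qed
qed

text \<open>
  The stopping time \<open>\<tau> n\<close> differs from the optimal \<open>\<mu> n\<close> in an essential way only where
  \<open>\<tau> (n - N)\<close> comes before both \<open>\<mu> n\<close> and \<open>\<theta> n\<close>.  There no opponent has moved since step \<open>n - N\<close>, so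
  \<open>\<tau> (n - N)\<close> is as good as \<open>\<mu> n\<close> by its optimality at step \<open>n - N\<close>.
\<close>

lemma \<tau>_optimal:
  assumes "N < n" "\<nu> \<in> ST"
  shows "mean_at (V n) \<nu> \<le> mean_at (V n) (\<tau> n)"
  using assms
proof (induction n arbitrary: \<nu> rule: less_induct)
  case (less n)
  note n = less.prems(1)
  have \<theta>: "\<theta> n \<in> ST" by (rule \<theta>_ST[OF n \<tau>_ST])
  have \<mu>: "\<mu> n \<in> ST" by (rule \<mu>_optimal(1)[OF n \<theta>])
  have \<tau>: "\<tau> n \<in> ST" using n by (intro \<tau>_ST) auto
  have \<tau>': "\<tau> (n - N) \<in> ST" using n by (intro \<tau>_ST) auto
  let ?\<kappa> = "\<lambda>\<omega>. min (\<mu> n \<omega>) (\<theta> n \<omega>)"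
  let ?D = "{\<omega>\<in>space M. \<tau> (n - N) \<omega> < ?\<kappa> \<omega>}"
  have [measurable]: "\<mu> n \<in> borel_measurable M" "\<theta> n \<in> borel_measurable M" "\<tau> (n - N) \<in> borel_measurable M"
    using ST_measurable \<mu> \<theta> \<tau>' by auto
  have D[measurable]: "?D \<in> sets M" by measurable
  \<comment> \<open>Off \<open>?D\<close> either \<open>\<tau> n\<close> equals
    \<open>\<mu> n\<close>, or both are at or after \<open>\<theta> n\<close>, where the reward is
    frozen.\<close>
  have off: "V n (\<tau> n \<omega>) \<omega> = V n (\<mu> n \<omega>) \<omega>" if "\<omega> \<in> space M" "\<omega> \<notin> ?D" for \<omega>
    using \<tau>_step[OF n that(1)] that by (auto simp: V_eq min_def split: if_splits)
  have int[simp]: "integrable M (\<lambda>\<omega>. V n (\<tau> n \<omega>) \<omega>)" "integrable M (\<lambda>\<omega>. V n (\<mu> n \<omega>) \<omega>)"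
    using V_integrable[OF \<theta>] \<tau> \<mu> by auto
  have onD: "mean_on ?D (V n) (\<mu> n) \<le> mean_on ?D (V n) (\<tau> n)"
  proof (cases "n \<le> 2 * N")
    case True
    \<comment> \<open>In the first round after the initial values, \<open>\<tau> (n - N)\<close> is
      \<open>T\<close> and cannot precede \<open>\<mu> n\<close>, so \<open>?D\<close> is
      empty.\<close>
    have "indicator ?D \<omega> = (0::real)" for \<omega>
    proof (cases "\<omega> \<in> space M")
      case True
      then have "\<tau> (n - N) \<omega> = T" using \<open>n \<le> 2 * N\<close> n by (intro \<tau>_init) auto
      then show ?thesis using \<mu>_range(2)[of n \<omega>] by (auto simp: indicator_def)
    qed simp
    then show ?thesis by simp
  next
    case False
    let ?m = "n - N"
    have m: "N < ?m" "?m < n" using False n N_ge by auto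
    have \<theta>m: "\<theta> ?m \<in> ST" by (rule \<theta>_ST[OF m(1) \<tau>_ST])
    \<comment> \<open>A deviation at step \<open>n - N\<close> from \<open>\<tau> (n - N)\<close> to
      \<open>\<mu> n\<close> on \<open>?D\<close> only. It is a stopping time because it waits for
      \<open>\<tau> (n - N)\<close> before deciding, and off \<open>?D\<close> both sides of the
      induction hypothesis agree and cancel.\<close>
    let ?\<rho> = "\<lambda>\<omega>. if \<tau> ?m \<omega> < ?\<kappa> \<omega> then \<mu> n \<omega> else \<tau> ?m \<omega>"
    have \<rho>: "?\<rho> \<in> ST" by (rule ST_If_less[OF \<tau>' ST_min[OF \<mu> \<theta>] \<mu> \<tau>']) auto
    have le: "mean_at (V ?m) ?\<rho> \<le> mean_at (V ?m) (\<tau> ?m)"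
      by (rule less.IH[OF m(2,1) \<rho>])
    have same: "V ?m t \<omega> = V n t \<omega>" if "\<omega> \<in> ?D" for t \<omega>
      using \<theta>_unchanged[of \<omega> n] that False mover_shift[OF n] by (simp add: V_eq)
    have \<tau>D: "\<tau> n \<omega> = \<tau> ?m \<omega>" if "\<omega> \<in> ?D" for \<omega>
      using \<tau>_step[OF n, of \<omega>] that by auto
    have int2: "integrable M (\<lambda>\<omega>. V ?m (?\<rho> \<omega>) \<omega>)" "integrable M (\<lambda>\<omega>. V ?m (\<tau> ?m \<omega>) \<omega>)"
      using V_integrable[OF \<theta>m] \<rho> \<tau>' by blast+
    have split: "(\<integral>\<omega>. f \<omega> \<partial>M) = (\<integral>\<omega>. f \<omega> * indicator ?D \<omega> \<partial>M) + (\<integral>\<omega>. f \<omega> * indicator (space M - ?D) \<omega> \<partial>M)"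
      if f: "integrable M f" for f :: "'a \<Rightarrow> real"
    proof -
      have "(\<integral>\<omega>. f \<omega> \<partial>M) = (\<integral>\<omega>. f \<omega> * indicator ?D \<omega> + f \<omega> * indicator (space M - ?D) \<omega> \<partial>M)"
        by (rule Bochner_Integration.integral_cong) (auto simp: indicator_def)
      also have "\<dots> = (\<integral>\<omega>. f \<omega> * indicator ?D \<omega> \<partial>M) + (\<integral>\<omega>. f \<omega> * indicator (space M - ?D) \<omega> \<partial>M)"
        by (intro Bochner_Integration.integral_add integrable_real_mult_indicator f) auto
      finally show ?thesis .
    qed
    have "mean_on (space M - ?D) (V ?m) ?\<rho>
        = mean_on (space M - ?D) (V ?m) (\<tau> ?m)"
      by (rule Bochner_Integration.integral_cong) (auto simp: indicator_def)
    then have le': "mean_on ?D (V ?m) ?\<rho> \<le> mean_on ?D (V ?m) (\<tau> ?m)"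
      using le split[OF int2(1)] split[OF int2(2)] by linarith
    have "mean_on ?D (V n) (\<mu> n) = mean_on ?D (V ?m) ?\<rho>"
    proof (rule Bochner_Integration.integral_cong[OF refl])
      fix \<omega>
      show "V n (\<mu> n \<omega>) \<omega> * indicator ?D \<omega> = V ?m (?\<rho> \<omega>) \<omega> * indicator ?D \<omega>"
        using same[of \<omega>] by (cases "\<omega> \<in> ?D") auto
    qed
    also have "\<dots> \<le> mean_on ?D (V ?m) (\<tau> ?m)" by (rule le')
    also have "\<dots> = mean_on ?D (V n) (\<tau> n)"
    proof (rule Bochner_Integration.integral_cong[OF refl])
      fix \<omega>
      show "V ?m (\<tau> ?m \<omega>) \<omega> * indicator ?D \<omega> = V n (\<tau> n \<omega>) \<omega> * indicator ?D \<omega>"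
        using same[of \<omega>] \<tau>D[of \<omega>] by (cases "\<omega> \<in> ?D") auto
    qed
    finally show ?thesis .
  qed
  have "(\<integral>\<omega>. V n (\<mu> n \<omega>) \<omega> - V n (\<tau> n \<omega>) \<omega> \<partial>M)
      = (\<integral>\<omega>. V n (\<mu> n \<omega>) \<omega> * indicator ?D \<omega> - V n (\<tau> n \<omega>) \<omega> * indicator ?D \<omega> \<partial>M)"
  proof (rule Bochner_Integration.integral_cong[OF refl])
    fix \<omega> assume "\<omega> \<in> space M"
    then show "V n (\<mu> n \<omega>) \<omega> - V n (\<tau> n \<omega>) \<omega> = V n (\<mu> n \<omega>) \<omega> * indicator ?D \<omega> - V n (\<tau> n \<omega>) \<omega> * indicator ?D \<omega>"
    proof (cases "\<omega> \<in> ?D")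
      case True
      then have "indicator ?D \<omega> = (1::real)" by (rule indicator_simps(1))
      then show ?thesis by (simp only: mult_1_right)
    next
      case False
      then have "indicator ?D \<omega> = (0::real)" by (rule indicator_simps(2))
      then show ?thesis using off[OF \<open>\<omega> \<in> space M\<close> False] by (simp only: mult_zero_right diff_self)
    qed
  qed
  also have "\<dots> = mean_on ?D (V n) (\<mu> n) - mean_on ?D (V n) (\<tau> n)"
    by (intro Bochner_Integration.integral_diff integrable_real_mult_indicator D int)
  finally have "mean_at (V n) (\<mu> n) - mean_at (V n) (\<tau> n) \<le> 0"
    using onD by (simp only: Bochner_Integration.integral_diff[OF int(2,1)])
  then show ?case using \<mu>_optimal(2)[OF n \<theta> less.prems(2)] by linarith
qed

section \<open>The limit profile\<close>

abbreviation S :: "nat \<Rightarrow> 'a \<Rightarrow> real" where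
  "S \<equiv> limit_profile N \<tau>"

abbreviation R :: "nat \<Rightarrow> 'a \<Rightarrow> real" where
  "R i \<equiv> others_min N S i"

lemma \<tau>_decseq:
  assumes i: "i \<in> {1..N}" and \<omega>: "\<omega> \<in> space M"
  shows "decseq (\<lambda>q. \<tau> (N * q + i) \<omega>)"
proof (rule decseq_SucI)
  fix q
  have "\<tau> (N * Suc q + i) \<omega> \<le> \<tau> (N * Suc q + i - N) \<omega>" by (rule \<tau>_decreasing[OF _ \<omega>]) (use i in auto)
  then show "\<tau> (N * Suc q + i) \<omega> \<le> \<tau> (N * q + i) \<omega>" by simp
qed

lemma S_LIMSEQ:
  assumes i: "i \<in> {1..N}" and \<omega>: "\<omega> \<in> space M"
  shows "(\<lambda>q. \<tau> (N * q + i) \<omega>) \<longlonglongrightarrow> S i \<omega>"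
proof -
  have "0 \<le> \<tau> (N * q + i) \<omega>" for q using \<tau>_range[of "N * q + i" \<omega>] i \<omega> by auto
  then obtain L where "(\<lambda>q. \<tau> (N * q + i) \<omega>) \<longlonglongrightarrow> L"
    using decseq_convergent[OF \<tau>_decseq[OF i \<omega>]] by blast
  then show ?thesis unfolding limit_profile_def by (simp add: limI)
qed

lemma S_le: "i \<in> {1..N} \<Longrightarrow> \<omega> \<in> space M \<Longrightarrow> S i \<omega> \<le> \<tau> (N * q + i) \<omega>"
  using decseq_ge[OF \<tau>_decseq S_LIMSEQ] by blast

lemma S_ST: "i \<in> {1..N} \<Longrightarrow> S i \<in> ST"
  by (rule ST_LIM_decseq[of "\<lambda>q. \<tau> (N * q + i)", OF \<tau>_ST \<tau>_decseq S_LIMSEQ]) auto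

lemma S_le_T: "i \<in> {1..N} \<Longrightarrow> \<omega> \<in> space M \<Longrightarrow> S i \<omega> \<le> T"
  using S_le[of i \<omega> 0] \<tau>_range[of i \<omega>] by auto

lemma others_nonempty: "{1..N} - {i} \<noteq> {}"
proof -
  have "(if i = 1 then 2 else 1) \<in> {1..N} - {i}" using N_ge by auto
  then show ?thesis by blast
qed

lemma R_le: "j \<in> {1..N} \<Longrightarrow> j \<noteq> i \<Longrightarrow> R i \<omega> \<le> S j \<omega>"
  unfolding others_min_def by (rule Min_le) auto

lemma R_attained: obtains j where "j \<in> {1..N}" "j \<noteq> i" "R i \<omega> = S j \<omega>"
proof -
  have "R i \<omega> \<in> (\<lambda>j. S j \<omega>) ` ({1..N} - {i})"
    unfolding others_min_def by (rule Min_in) (use others_nonempty in auto)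
  then obtain j where "R i \<omega> = S j \<omega>" "j \<in> {1..N} - {i}" by (rule imageE)
  then show thesis using that[of j] by blast
qed

lemma R_ST: "R i \<in> ST"
proof -
  have "(\<lambda>\<omega>. Min ((\<lambda>j. S j \<omega>) ` ({1..N} - {i}))) \<in> ST"
    by (rule ST_Min) (use others_nonempty S_ST in auto)
  then show ?thesis by (simp add: others_min_def[abs_def])
qed

text \<open>In block \<open>q + 1\<close>, player \<open>i\<close> meets the current times of block \<open>q + 1\<close> of the players before it and
  those of block \<open>q\<close> of the players after it.\<close>

lemma \<theta>_block_le:
  assumes i: "i \<in> {1..N}" and j: "j \<in> {1..N}" "j \<noteq> i"
  shows "\<theta> (N * Suc q + i) \<omega> \<le> \<tau> (N * (if j < i then Suc q else q) + j) \<omega>"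
proof (cases "j < i")
  case True
  have "\<theta> (N * Suc q + i) \<omega> \<le> \<tau> (N * Suc q + i - (i - j)) \<omega>" by (rule \<theta>_le) (use True i j in auto)
  moreover have "N * Suc q + i - (i - j) = N * Suc q + j" using True by auto
  ultimately show ?thesis using True by (simp only: if_True)
next
  case False
  have "\<theta> (N * Suc q + i) \<omega> \<le> \<tau> (N * Suc q + i - (N + i - j)) \<omega>" by (rule \<theta>_le) (use False i j in auto)
  moreover have "N * Suc q + i - (N + i - j) = N * q + j" using False j by auto
  ultimately show ?thesis using False by (simp only: if_False)
qed

lemma \<theta>_block_attained:
  assumes i: "i \<in> {1..N}"
  obtains j where "j \<in> {1..N}" "j \<noteq> i"
    "\<theta> (N * Suc q + i) \<omega> = \<tau> (N * (if j < i then Suc q else q) + j) \<omega>"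
proof -
  obtain k where k: "1 \<le> k" "k \<le> N - 1" "\<theta> (N * Suc q + i) \<omega> = \<tau> (N * Suc q + i - k) \<omega>"
    by (rule \<theta>_attained)
  show thesis
  proof (cases "k < i")
    case True
    have "N * Suc q + i - k = N * Suc q + (i - k)" using True by simp
    then show thesis using k True i by (intro that[of "i - k"]) auto
  next
    case False
    have "N * Suc q + i - k = N * q + (N + i - k)" using k False by auto
    then show thesis using k False i by (intro that[of "N + i - k"]) auto
  qed
qed

lemma R_le_\<theta>:
  assumes i: "i \<in> {1..N}" and \<omega>: "\<omega> \<in> space M"
  shows "R i \<omega> \<le> \<theta> (N * Suc q + i) \<omega>"
proof -
  obtain j where j: "j \<in> {1..N}" "j \<noteq> i"
    "\<theta> (N * Suc q + i) \<omega> = \<tau> (N * (if j < i then Suc q else q) + j) \<omega>"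
    by (rule \<theta>_block_attained[OF i])
  show ?thesis using R_le[OF j(1,2), of \<omega>] S_le[OF j(1) \<omega>, of "if j < i then Suc q else q"] j(3) by linarith
qed

lemma \<theta>_LIMSEQ:
  assumes i: "i \<in> {1..N}" and \<omega>: "\<omega> \<in> space M"
  shows "(\<lambda>q. \<theta> (N * Suc q + i) \<omega>) \<longlonglongrightarrow> R i \<omega>"
proof -
  obtain j where j: "j \<in> {1..N}" "j \<noteq> i" "R i \<omega> = S j \<omega>" by (rule R_attained)
  have lim: "(\<lambda>q. \<tau> (N * (if j < i then Suc q else q) + j) \<omega>) \<longlonglongrightarrow> S j \<omega>"
    using S_LIMSEQ[OF j(1) \<omega>] LIMSEQ_Suc[OF S_LIMSEQ[OF j(1) \<omega>]] by (cases "j < i") simp_all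
  show ?thesis unfolding j(3)
  proof (rule tendsto_sandwich[OF _ _ tendsto_const lim]; intro always_eventually allI)
    show "S j \<omega> \<le> \<theta> (N * Suc q + i) \<omega>" for q using R_le_\<theta>[OF i \<omega>] unfolding j(3) .
  qed (rule \<theta>_block_le[OF i j(1,2)])
qed

text \<open>
  If several players stop together in the limit, then in every late block one of them moves strictly
  ahead of the others: otherwise none of them moves, and the earliest of them would already be ahead.
\<close>

lemma late_mover:
  assumes i: "i \<in> {1..N}" and \<omega>: "\<omega> \<in> space M" and eq: "S i \<omega> = R i \<omega>" and less: "S i \<omega> < T"
  shows "\<forall>\<^sub>F q in sequentially. \<exists>j\<in>{1..N}. S j \<omega> = S i \<omega> \<and> R j \<omega> = S i \<omega> \<and>
    \<tau> (N * Suc q + j) \<omega> < \<theta> (N * Suc q + j) \<omega>"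
proof -
  define \<sigma> where "\<sigma> = S i \<omega>"
  define A where "A = {j\<in>{1..N}. S j \<omega> = \<sigma>}"
  \<comment> \<open>A separating level above \<sigma>: the players in \<open>A\<close> are below it
    in late blocks, while the other players stay at or above it in every block. Including
    \<open>T\<close> makes the times of \<open>A\<close> fall before \<open>T\<close> as
    well.\<close>
  define c where "c = Min (insert T ((\<lambda>j. S j \<omega>) ` ({1..N} - A)))"
  have fin: "finite A" "A \<noteq> {}" using i by (auto simp: A_def \<sigma>_def)
  have ge: "\<sigma> \<le> S j \<omega>" if "j \<in> {1..N}" for j
    using R_le[OF that, of i \<omega>] eq by (cases "j = i") (auto simp: \<sigma>_def)
  obtain k where k: "k \<in> A" "k \<noteq> i"
    using R_attained[of i \<omega>] eq unfolding A_def \<sigma>_def by (metis (mono_tags, lifting) mem_Collect_eq)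
  have R: "R j \<omega> = \<sigma>" if "j \<in> A" for j
  proof (rule antisym)
    obtain j' where j': "j' \<in> A" "j' \<noteq> j"
    proof (cases "j = i")
      case True then show thesis using k that by blast
    next
      case False then show thesis using i that by (auto simp: A_def \<sigma>_def)
    qed
    show "R j \<omega> \<le> \<sigma>" using R_le[of j' j \<omega>] j' by (auto simp: A_def)
    show "\<sigma> \<le> R j \<omega>" using R_attained[of j \<omega>] ge by metis
  qed
  have "\<sigma> < S j \<omega>" if "j \<in> {1..N} - A" for j
  proof -
    have "S j \<omega> \<noteq> \<sigma>" using that by (simp add: A_def)
    then show ?thesis using ge[of j] that by simp
  qed
  then have c_gr: "\<sigma> < c"
    unfolding c_def using less by (subst Min_gr_iff) (auto simp: \<sigma>_def)
  have c_T: "c \<le> T" unfolding c_def by (rule Min_le) auto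
  have c_S: "c \<le> S j \<omega>" if "j \<in> {1..N}" "j \<notin> A" for j
    unfolding c_def by (rule Min_le) (use that in auto)
  have "\<forall>\<^sub>F q in sequentially. \<forall>j\<in>A. \<tau> (N * q + j) \<omega> < c"
  proof (rule eventually_ball_finite[OF fin(1)], rule ballI)
    fix j assume "j \<in> A"
    then show "\<forall>\<^sub>F q in sequentially. \<tau> (N * q + j) \<omega> < c"
      using S_LIMSEQ[OF _ \<omega>, of j] c_gr by (auto simp: A_def intro: order_tendstoD(2))
  qed
  then show ?thesis
  proof eventually_elim
    case (elim q)
    show ?case
    proof (rule ccontr)
      assume "\<not> ?thesis"
      then have no: "\<not> \<tau> (N * Suc q + j) \<omega> < \<theta> (N * Suc q + j) \<omega>" if "j \<in> A" for j
        using that R by (auto simp: A_def \<sigma>_def)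
      have stay: "\<tau> (N * Suc q + j) \<omega> = \<tau> (N * q + j) \<omega>" if "j \<in> A" for j
      proof -
        have "N < N * Suc q + j" using that by (auto simp: A_def)
        from \<tau>_step[OF this \<omega>] no[OF that] show ?thesis by (auto split: if_splits)
      qed
      \<comment> \<open>The earliest of the players in \<open>A\<close> after block
        \<open>q\<close>. As none of them moves in block \<open>Suc q\<close>, every opponent from
        \<open>A\<close> that it faces still has at least its own time.\<close>
      obtain j where j: "j \<in> A" "\<And>j'. j' \<in> A \<Longrightarrow> \<tau> (N * q + j) \<omega> \<le> \<tau> (N * q + j') \<omega>"
        using arg_min_if_finite(1)[OF fin, of "\<lambda>j. \<tau> (N * q + j) \<omega>"]
          arg_min_least[OF fin, of _ "\<lambda>j. \<tau> (N * q + j) \<omega>"] by blast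
      have jN: "j \<in> {1..N}" using j by (simp add: A_def)
      obtain j' where j': "j' \<in> {1..N}" "j' \<noteq> j"
        "\<theta> (N * Suc q + j) \<omega> = \<tau> (N * (if j' < j then Suc q else q) + j') \<omega>"
        by (rule \<theta>_block_attained[OF jN])
      have \<tau>j: "\<tau> (N * Suc q + j) \<omega> < c" using elim j(1) stay by simp
      have "\<tau> (N * Suc q + j) \<omega> < \<theta> (N * Suc q + j) \<omega>"
      proof (cases "j' \<in> A")
        case False
        then show ?thesis using c_S[OF j'(1)] S_le[OF j'(1) \<omega>, of "if j' < j then Suc q else q"] j'(3) \<tau>j by linarith
      next
        case True
        have "\<theta> (N * Suc q + j) \<omega> = \<tau> (N * q + j') \<omega>" using j'(3) stay[OF True] by (simp split: if_splits)
        then have "\<tau> (N * Suc q + j) \<omega> \<le> \<theta> (N * Suc q + j) \<omega>" using j(2)[OF True] stay[OF j(1)] by simp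
        \<comment> \<open>Equal times are possible only at \<open>T\<close>. The indices compared
          are less than \<open>N\<close> apart, because the later block is read exactly for the
          players before \<open>j\<close>.\<close>
        moreover have "\<tau> (N * Suc q + j) \<omega> \<noteq> \<theta> (N * Suc q + j) \<omega>"
        proof
          assume "\<tau> (N * Suc q + j) \<omega> = \<theta> (N * Suc q + j) \<omega>"
          then have "\<tau> (N * Suc q + j) \<omega> = T"
            unfolding j'(3) by (rule \<tau>_distinct[OF \<omega>, rotated -1]) (use j'(1,2) jN in auto)
          then show False using \<tau>j c_T by simp
        qed
        ultimately show ?thesis by simp
      qed
      with no[OF j(1)] show False by simp
    qed
  qed
qed

lemma limit_optimality:
  assumes i: "i \<in> {1..N}"
  defines "d \<equiv> \<lambda>q \<omega>. (Y_tilde T (Q i) (Y i) (R i \<omega>) \<omega> - X i (S i \<omega>) \<omega>) *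
    of_bool (\<tau> (N * Suc q + i) \<omega> < \<theta> (N * Suc q + i) \<omega> \<and> S i \<omega> = R i \<omega>)"
  shows "integrable M (d q)" and "AE \<omega> in M. 0 \<le> d q \<omega>" and "(\<lambda>q. \<integral>\<omega>. d q \<omega> \<partial>M) \<longlonglongrightarrow> 0"
    and "\<nu> \<in> ST \<Longrightarrow> mean_at (stopped_payoff T (X i) (Q i) (Y i) (R i)) \<nu>
      \<le> mean_at (stopped_payoff T (X i) (Q i) (Y i) (R i)) (S i)"
proof -
  interpret P: dynkin_player M F T "X i" "Q i" "Y i" by (rule player[OF i])
  \<comment> \<open>Blocks are counted from \<open>Suc q\<close>, since block 0 holds the initial
    values, which solve no stopping problem.\<close>
  let ?t = "\<lambda>q. \<tau> (N * Suc q + i)" and ?\<theta> = "\<lambda>q. \<theta> (N * Suc q + i)"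
  have n: "N < N * Suc q + i" for q using i by auto
  have t: "?t q \<in> ST" for q using i by (intro \<tau>_ST) auto
  have \<theta>: "?\<theta> q \<in> ST" for q by (rule \<theta>_ST[OF n \<tau>_ST])
  have t_le: "S i \<omega> \<le> ?t q \<omega> \<and> ?t q \<omega> \<le> T" if "\<omega> \<in> space M" for q \<omega>
    using S_le[OF i that, of "Suc q"] \<tau>_range[of "N * Suc q + i" \<omega>] i that by auto
  have \<theta>_le: "R i \<omega> \<le> ?\<theta> q \<omega> \<and> ?\<theta> q \<omega> \<le> T" if "\<omega> \<in> space M" for q \<omega>
  proof
    show "R i \<omega> \<le> ?\<theta> q \<omega>" by (rule R_le_\<theta>[OF i that])
    have "?\<theta> q \<omega> \<le> \<tau> (N * Suc q + i - 1) \<omega>" by (rule \<theta>_le) (use N_ge in auto)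
    also have "1 \<le> N * Suc q + i - 1" using n[of q] N_ge by linarith
    from \<tau>_range[OF this that] have "\<tau> (N * Suc q + i - 1) \<omega> \<le> T" by blast
    finally show "?\<theta> q \<omega> \<le> T" .
  qed
  have t_lim: "(\<lambda>q. ?t q \<omega>) \<longlonglongrightarrow> S i \<omega>" if "\<omega> \<in> space M" for \<omega>
    by (rule LIMSEQ_Suc[OF S_LIMSEQ[OF i that]])
  have opt: "mean_at (P.V (?\<theta> q)) \<nu> \<le> mean_at (P.V (?\<theta> q)) (?t q)" if "\<nu> \<in> ST" for q \<nu>
    using \<tau>_optimal[OF n that, of q] unfolding V_def mover_block[OF i] .
  note * = P.optimality_limit[of ?t ?\<theta> "S i" "R i", OF t \<theta> S_ST[OF i] R_ST t_le \<theta>_le t_lim \<theta>_LIMSEQ[OF i] opt]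
  show "integrable M (d q)" unfolding d_def by (rule *(1))
  show "AE \<omega> in M. 0 \<le> d q \<omega>" unfolding d_def by (rule *(2))
  show "(\<lambda>q. \<integral>\<omega>. d q \<omega> \<partial>M) \<longlonglongrightarrow> 0" unfolding d_def by (rule *(3))
  show "\<nu> \<in> ST \<Longrightarrow> mean_at (P.V (R i)) \<nu> \<le> mean_at (P.V (R i)) (S i)"
    by (rule *(4))
qed

text \<open>The player who moves ahead may change from block to block, so the quantities
  \<open>d\<close> are summed over all players. Their sum vanishes in mean, hence almost surely
  along a subsequence of blocks, and a subsequence suffices because \<open>late_mover\<close> covers
  every late block. If Q < Y held, \<open>strict\<close> would keep the sum at or above the smallest
  of finitely many positive gaps \<open>Y - X\<close>.\<close>

lemma simultaneous_stopping:
  assumes i: "i \<in> {1..N}"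
  shows "AE \<omega> in M. S i \<omega> = R i \<omega> \<and> S i \<omega> < T \<longrightarrow> \<not> Q i (S i \<omega>) \<omega> < Y i (S i \<omega>) \<omega>"
proof -
  define d where "d j q \<omega> = (Y_tilde T (Q j) (Y j) (R j \<omega>) \<omega> - X j (S j \<omega>) \<omega>) *
    of_bool (\<tau> (N * Suc q + j) \<omega> < \<theta> (N * Suc q + j) \<omega> \<and> S j \<omega> = R j \<omega>)" for j q \<omega>
  define D where "D q \<omega> = (\<Sum>j\<in>{1..N}. d j q \<omega>)" for q \<omega>
  have di: "integrable M (d j q)" if "j \<in> {1..N}" for j q
    unfolding d_def by (rule limit_optimality(1)[OF that])
  have Di: "integrable M (D q)" for q
    unfolding D_def by (intro Bochner_Integration.integrable_sum di)
  have dn: "AE \<omega> in M. \<forall>q. \<forall>j\<in>{1..N}. 0 \<le> d j q \<omega>"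
    unfolding AE_all_countable d_def using limit_optimality(2) by (intro allI AE_finite_allI) auto
  have "(\<lambda>q. \<Sum>j\<in>{1..N}. \<integral>\<omega>. d j q \<omega> \<partial>M) \<longlonglongrightarrow> (\<Sum>j\<in>{1..N}. 0)"
    unfolding d_def by (intro tendsto_sum limit_optimality(3))
  moreover have "(\<integral>\<omega>. norm (D q \<omega>) \<partial>M) = (\<Sum>j\<in>{1..N}. \<integral>\<omega>. d j q \<omega> \<partial>M)" for q
  proof -
    have "AE \<omega> in M. norm (D q \<omega>) = D q \<omega>"
      using dn
    proof eventually_elim
      case (elim \<omega>)
      have "0 \<le> D q \<omega>" unfolding D_def by (rule sum_nonneg) (use elim in blast)
      then show ?case by simp
    qed
    then have "(\<integral>\<omega>. norm (D q \<omega>) \<partial>M) = (\<integral>\<omega>. D q \<omega> \<partial>M)"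
      using Di[of q] by (intro integral_cong_AE) auto
    also have "\<dots> = (\<Sum>j\<in>{1..N}. \<integral>\<omega>. d j q \<omega> \<partial>M)"
      unfolding D_def by (rule Bochner_Integration.integral_sum[OF di])
    finally show ?thesis .
  qed
  ultimately have "(\<lambda>q. \<integral>\<omega>. norm (D q \<omega>) \<partial>M) \<longlonglongrightarrow> 0" by simp
  from tendsto_L1_AE_subseq[OF Di this]
  obtain r :: "nat \<Rightarrow> nat" where r: "strict_mono r" "AE \<omega> in M. (\<lambda>n. D (r n) \<omega>) \<longlonglongrightarrow> 0" by blast
  show ?thesis
    using dn r(2) strict[OF i S_ST[OF i]] AE_space
  proof eventually_elim
    case (elim \<omega>)
    show ?case
    proof (intro impI notI)
      assume *: "S i \<omega> = R i \<omega> \<and> S i \<omega> < T" and QY: "Q i (S i \<omega>) \<omega> < Y i (S i \<omega>) \<omega>"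
      define g where "g = Min ((\<lambda>j. Y j (S i \<omega>) \<omega> - X j (S i \<omega>) \<omega>) ` {1..N})"
      have "\<forall>j\<in>{1..N}. X j (S i \<omega>) \<omega> < Y j (S i \<omega>) \<omega>" using elim(3) * QY by blast
      then have g_pos: "0 < g" unfolding g_def using i by (subst Min_gr_iff) auto
      have "\<forall>\<^sub>F q in sequentially. g \<le> D q \<omega>"
      proof (rule eventually_mono[OF late_mover[OF i elim(4)]])
        show "S i \<omega> = R i \<omega>" "S i \<omega> < T" using * by auto
        fix q
        assume "\<exists>j\<in>{1..N}. S j \<omega> = S i \<omega> \<and> R j \<omega> = S i \<omega> \<and>
          \<tau> (N * Suc q + j) \<omega> < \<theta> (N * Suc q + j) \<omega>"
        then obtain j where j: "j \<in> {1..N}" "S j \<omega> = S i \<omega>" "R j \<omega> = S i \<omega>"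
          "\<tau> (N * Suc q + j) \<omega> < \<theta> (N * Suc q + j) \<omega>" by blast
        have "g \<le> Y j (S i \<omega>) \<omega> - X j (S i \<omega>) \<omega>" unfolding g_def by (rule Min_le) (use j in auto)
        also have "\<dots> = d j q \<omega>"
          unfolding d_def j(2,3) Y_tilde_def using j(4) * by (simp del: mult_Suc_right)
        also have "\<dots> \<le> D q \<omega>"
          unfolding D_def by (rule member_le_sum[OF j(1)]) (use elim(1) in auto)
        finally show "g \<le> D q \<omega>" .
      qed
      then have "\<forall>\<^sub>F n in sequentially. g \<le> D (r n) \<omega>"
        using r(1) by (rule eventually_subseq[rotated])
      then have "g \<le> 0" by (rule tendsto_lowerbound[OF elim(2)]) simp
      with g_pos show False by simp
    qed
  qed
qed

section \<open>The equilibrium property\<close>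

lemma payoff_eq:
  "payoff M N X Q Y i \<rho> = (\<integral>\<omega>.
     (if \<rho> i \<omega> < others_min N \<rho> i \<omega> then X i (\<rho> i \<omega>) \<omega>
      else if \<rho> i \<omega> = others_min N \<rho> i \<omega> then Q i (\<rho> i \<omega>) \<omega>
      else Y i (others_min N \<rho> i \<omega>) \<omega>) \<partial>M)"
  unfolding payoff_def by (rule Bochner_Integration.integral_cong) auto

text \<open>The stopping problem with \<open>Yt\<close> at ties bounds the payoff of every
  deviation, because Q \<le> Yt. At the limit profile itself nothing is lost: almost surely, ties
  before \<open>T\<close> have \<open>Q = Y\<close>, and at \<open>T\<close> the tie payoff is
  \<open>Q\<close> in both problems.\<close>

theorem limit_profile_nash: "nash_equilibrium M F T N X Q Y S"
  unfolding nash_equilibrium_def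
proof (intro conjI ballI)
  show "S i \<in> ST" if "i \<in> {1..N}" for i by (rule S_ST[OF that])
  fix i \<nu> assume i: "i \<in> {1..N}" and \<nu>: "\<nu> \<in> ST"
  interpret P: dynkin_player M F T "X i" "Q i" "Y i" by (rule player[OF i])
  let ?j = "\<lambda>\<rho> \<omega>. if \<rho> \<omega> < R i \<omega> then X i (\<rho> \<omega>) \<omega> else if \<rho> \<omega> = R i \<omega> then Q i (\<rho> \<omega>) \<omega> else Y i (R i \<omega>) \<omega>"
  have j_meas: "?j \<rho> \<in> borel_measurable M" and j_int: "integrable M (?j \<rho>)" if \<rho>: "\<rho> \<in> ST" for \<rho>
  proof -
    have int: "integrable M (\<lambda>\<omega>. X i (\<rho> \<omega>) \<omega>)" "integrable M (\<lambda>\<omega>. Q i (\<rho> \<omega>) \<omega>)" "integrable M (\<lambda>\<omega>. Y i (R i \<omega>) \<omega>)"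
      using P.class_D_integrable[OF P.X_D \<rho>] P.class_D_integrable[OF P.Q_D \<rho>] P.class_D_integrable[OF P.Y_D R_ST]
      by auto
    note [measurable] = int[THEN borel_measurable_integrable] ST_measurable[OF \<rho>] ST_measurable[OF R_ST, of i]
    show m: "?j \<rho> \<in> borel_measurable M" by measurable
    have b: "integrable M (\<lambda>\<omega>. \<bar>X i (\<rho> \<omega>) \<omega>\<bar> + \<bar>Q i (\<rho> \<omega>) \<omega>\<bar> + \<bar>Y i (R i \<omega>) \<omega>\<bar>)" using int by auto
    show "integrable M (?j \<rho>)"
      by (rule Bochner_Integration.integrable_bound[OF b m]) auto
  qed
  have R_T: "R i \<omega> \<le> T" if "\<omega> \<in> space M" for \<omega>
    using R_attained[of i \<omega>] S_le_T that by metis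
  have others: "others_min N (S(i := \<nu>)) i \<omega> = R i \<omega>" for \<omega>
    unfolding others_min_def by (rule arg_cong[of _ _ Min], rule image_cong) auto
  have "payoff M N X Q Y i (S(i := \<nu>)) = (\<integral>\<omega>. ?j \<nu> \<omega> \<partial>M)"
    unfolding payoff_eq others fun_upd_same ..
  also have "\<dots> \<le> mean_at (P.V (R i)) \<nu>"
  proof (rule integral_mono_AE[OF j_int[OF \<nu>] P.V_integrable[OF R_ST \<nu>]])
    show "AE \<omega> in M. ?j \<nu> \<omega> \<le> P.V (R i) (\<nu> \<omega>) \<omega>"
      using P.X_le_Yt ST_AE_range[OF \<nu>] AE_space
    proof eventually_elim
      case (elim \<omega>)
      have "Y i (R i \<omega>) \<omega> = P.Yt (R i \<omega>) \<omega>" if "R i \<omega> < \<nu> \<omega>"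
        using that elim(2) by (intro P.Yt_less[symmetric]) linarith
      moreover have "Q i (\<nu> \<omega>) \<omega> \<le> P.Yt (\<nu> \<omega>) \<omega>" using elim(1,2) by auto
      ultimately show ?case unfolding P.V_eq by (cases "\<nu> \<omega>" "R i \<omega>" rule: linorder_cases) auto
    qed
  qed
  also have "\<dots> \<le> mean_at (P.V (R i)) (S i)" by (rule limit_optimality(4)[OF i \<nu>])
  also have "\<dots> = (\<integral>\<omega>. ?j (S i) \<omega> \<partial>M)"
  proof (rule integral_cong_AE[OF P.V_measurable[OF R_ST S_ST[OF i]] j_meas[OF S_ST[OF i]]])
    show "AE \<omega> in M. P.V (R i) (S i \<omega>) \<omega> = ?j (S i) \<omega>"
      using simultaneous_stopping[OF i] P.XQY ST_AE_range[OF S_ST[OF i]] AE_space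
    proof eventually_elim
      case (elim \<omega>)
      consider "S i \<omega> < R i \<omega>" | "R i \<omega> < S i \<omega>" | "S i \<omega> = R i \<omega>" "S i \<omega> = T" | "S i \<omega> = R i \<omega>" "S i \<omega> < T"
        using elim(3) by linarith
      then show ?case
      proof cases
        case 2
        then have "P.Yt (R i \<omega>) \<omega> = Y i (R i \<omega>) \<omega>" using elim(3) by (intro P.Yt_less) linarith
        then show ?thesis using 2 by (simp add: P.V_eq)
      next
        case 3
        then show ?thesis unfolding P.V_eq using P.Yt_T[of \<omega>] by simp
      next
        case 4
        then have "\<not> Q i (S i \<omega>) \<omega> < Y i (S i \<omega>) \<omega>" using elim(1) by blast
        moreover have "Q i (S i \<omega>) \<omega> \<le> Y i (S i \<omega>) \<omega>" using elim(2,3) by auto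
        moreover have "P.Yt (S i \<omega>) \<omega> = Y i (S i \<omega>) \<omega>" using 4 by (intro P.Yt_less)
        ultimately show ?thesis using 4 by (simp add: P.V_eq)
      qed (simp add: P.V_eq)
    qed
  qed
  also have "\<dots> = payoff M N X Q Y i S" unfolding payoff_eq ..
  finally show "payoff M N X Q Y i (S(i := \<nu>)) \<le> payoff M N X Q Y i S" .
qed

end

theorem theorem4p2:
  fixes M :: "'a measure" and F :: "real \<Rightarrow> 'a measure" and T :: real and N :: nat
    and X Q Y :: "nat \<Rightarrow> real \<Rightarrow> 'a \<Rightarrow> real"
    and W :: "nat \<Rightarrow> real \<Rightarrow> 'a \<Rightarrow> real" and \<tau> :: "nat \<Rightarrow> 'a \<Rightarrow> real"
  assumes "dynkin_setting M F T"
    and "N \<ge> 3"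
    and "\<And>i. i \<in> {1..N} \<Longrightarrow> progressively_measurable F T (X i) \<and> class_D M F T (X i)"
    and "\<And>i. i \<in> {1..N} \<Longrightarrow> progressively_measurable F T (Q i) \<and> class_D M F T (Q i)"
    and "\<And>i. i \<in> {1..N} \<Longrightarrow> progressively_measurable F T (Y i) \<and> class_D M F T (Y i)"
    and A1: "\<And>i. i \<in> {1..N} \<Longrightarrow> rcll_paths M T (X i) \<and> no_negative_predictable_jumps M F T (X i)"
    and A2: "\<And>i. i \<in> {1..N} \<Longrightarrow> right_continuous_paths M T (Y i)"
    and A3: "\<And>i. i \<in> {1..N} \<Longrightarrow>
      AE \<omega> in M. \<forall>t\<in>{0..T}. X i t \<omega> \<le> Q i t \<omega> \<and> Q i t \<omega> \<le> Y i t \<omega>"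
    and A4: "\<And>i \<sigma>. i \<in> {1..N} \<Longrightarrow> \<sigma> \<in> stopping_times M F T (\<lambda>_. 0) \<Longrightarrow>
      AE \<omega> in M. Q i (\<sigma> \<omega>) \<omega> < Y i (\<sigma> \<omega>) \<omega> \<and> \<sigma> \<omega> < T \<longrightarrow>
        (\<forall>j\<in>{1..N}. X j (\<sigma> \<omega>) \<omega> < Y j (\<sigma> \<omega>) \<omega>)"
    and construction: "equilibrium_construction M F T N X Q Y W \<tau>"
  shows "nash_equilibrium M F T N X Q Y (limit_profile N \<tau>)"
proof -
  interpret dynkin_setting M F T by fact
  have player: "dynkin_player M F T (X i) (Q i) (Y i)" if i: "i \<in> {1..N}" for i
    by unfold_locales (use assms(3-5)[OF i] A1[OF i] A2[OF i] A3[OF i] in blast)+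
  interpret dynkin_game M F T N X Q Y W \<tau>
  proof (intro dynkin_game.intro dynkin_game_axioms.intro)
    show "dynkin_setting M F T" by fact
    show "2 \<le> N" using \<open>N \<ge> 3\<close> by simp
  qed (fact player A4 construction)+
  show ?thesis by (rule limit_profile_nash)
qed

end
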